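(* Let $G,F$ be Polish spaces and suppose that the stationary process $(Z_k,Y_k)_{k\in\mathbb{Z}}$ in $G\times F$ is absolutely regular and nondegenerate. Then any (hence all) of the following equivalent conditions hold true: 1. For $\mathbf{Q}$-a.e. $(z,z',y)$, we have $\|\mathbf{P}_y^{z_-}-\mathbf{P}_y^{z'_-}\|_{\mathcal{F}^Z_{n,\infty}}\to 0$ as $n\to\infty$. 2. For $\mathbf{Q}$-a.e. $(z,z',y)$, we have $\mathbf{P}_y^{z_-}(A)=\mathbf{P}_y^{z_-}(A)^2=\mathbf{P}_y^{z'_-}(A)$ for all $A\in\mathcal{A}^Z$. 3. For $\mathbf{Q}$-a.e. $(z,z',y)$, there exists $n\ge 0$ such that $\mathbf{P}_y^{z_-}$ and $\mathbf{P}_y^{z'_-}$ are not mutually singular on $\mathcal{F}^Z_{n,\infty}$.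
   Context: $G,F$ are Polish spaces, $\Omega=(G\times F)^{\mathbb{Z}}$ with its Borel $\sigma$-field $\mathcal{F}$, and $X_n=(Z_n,Y_n)$, $n\in\mathbb{Z}$, is the coordinate process. $\mathbf{P}$ is a stationary (shift-invariant) probability on $(\Omega,\mathcal{F})$. For $m\le n$ (infinite values allowed), $X_{m,n}=(X_k)_{m\le k\le n}$, $Y_{m,n}=(Y_k)_{m\le k\le n}$, $\mathcal{F}^Z_{m,n}=\sigma\{Z_k:m\le k\le n\}$, $\mathcal{F}^Y_{m,n}=\sigma\{Y_k:m\le k\le n\}$, $\mathcal{F}_{m,n}=\mathcal{F}^Z_{m,n}\vee\mathcal{F}^Y_{m,n}$, $\mathcal{F}^Y=\mathcal{F}^Y_{-\infty,\infty}$, and $\mathcal{A}^Z=\bigcap_{n\ge 0}\mathcal{F}^Z_{n,\infty}$. Write $Z=(Z_n)_{n\in\mathbb{Z}}$, $Y=(Y_n)_{n\in\mathbb{Z}}$, and $z_-=(z_n)_{n\le 0}$ for a sequence $z=(z_n)_{n\in\mathbb{Z}}$. Let $\mathbf{Y}=\mathbf{P}[Y\in\cdot\,]$ and fix versions of the regular conditional probabilities $\mathbf{P}_y$ and $\mathbf{P}_y^{z_-}$ with $$\mathbf{P}_Y=\mathbf{P}[\,\cdot\,|\mathcal{F}^Y],\qquad \mathbf{P}_Y^{Z_-}=\mathbf{P}[\,\cdot\,|\mathcal{F}^Y\vee\mathcal{F}^Z_{-\infty,0}].$$ The probability $\mathbf{Q}$ on $G^{\mathbb{Z}}\times G^{\mathbb{Z}}\times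 F^{\mathbb{Z}}$ is defined by $$\int\mathbf{1}_A(z,z',y)\,\mathbf{Q}(dz,dz',dy)=\int\mathbf{1}_A(z,z',y)\,\mathbf{P}_y(Z\in dz)\,\mathbf{P}_y(Z\in dz')\,\mathbf{Y}(dy).$$ For probability measures $\mu,\nu$ and a $\sigma$-field $\mathcal{G}$, $\|\mu-\nu\|_{\mathcal{G}}=2\sup_{A\in\mathcal{G}}|\mu(A)-\nu(A)|$; without subscript the full $\sigma$-field is used. $\mu\sim\nu$ denotes equivalence (mutual absolute continuity). Absolutely regular: $\|\mathbf{P}[X_{-\infty,0},X_{k,\infty}\in\cdot\,]-\mathbf{P}[X_{-\infty,0}\in\cdot\,]\otimes\mathbf{P}[X_{k,\infty}\in\cdot\,]\|\to 0$ as $k\to\infty$. Nondegenerate: for every $-\infty<m\le n<\infty$, $$\mathbf{P}[Y_{m,n}\in\cdot\,|\mathcal{F}_{-\infty,m-1}\vee\mathcal{F}_{n+1,\infty}]\sim\mathbf{P}[Y_{m,n}\in\cdot\,|\mathcal{F}^Y_{-\infty,m-1}\vee\mathcal{F}^Y_{n+1,\infty}]\quad\mathbf{P}\text{-a.s.}$$ *)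

theory Defs
  imports "HOL-Probability.Probability"
begin

text \<open>The path space is \<open>int \<Rightarrow> 'g \<times> 'f\<close>. As \<open>int\<close> is countable and the state space second countable, its Borel
  \<open>\<sigma>\<close>-field is the product \<open>\<sigma>\<close>-field.\<close>

definition Zpath :: "(int \<Rightarrow> 'g \<times> 'f) \<Rightarrow> int \<Rightarrow> 'g" where
  "Zpath \<omega> = (\<lambda>n. fst (\<omega> n))"

definition Ypath :: "(int \<Rightarrow> 'g \<times> 'f) \<Rightarrow> int \<Rightarrow> 'f" where
  "Ypath \<omega> = (\<lambda>n. snd (\<omega> n))"

definition stationary_law :: "(int \<Rightarrow> 'a::second_countable_topology) measure \<Rightarrow> bool" where
  "stationary_law P \<longleftrightarrow>
     prob_space P \<and> sets P = sets borel \<and> distr P borel (\<lambda>\<omega> n. \<omega> (n + 1)) = P"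

text \<open>Sub-\<open>\<sigma>\<close>-fields are represented, as in \<^const>\<open>real_cond_exp\<close>, by measures of which only the
  measurable sets matter. The range \<open>m \<le> k \<le> n\<close> is given by a set of integers
  such as \<open>{m..n}\<close>, \<open>{..n}\<close> or \<open>UNIV\<close>, which accounts for infinite \<open>m\<close> and \<open>n\<close>.\<close>

definition FZ :: "int set \<Rightarrow> (int \<Rightarrow> 'g::polish_space \<times> 'f::polish_space) measure" where
  "FZ I = sigma UNIV {(\<lambda>\<omega>. Zpath \<omega> k) -` B | k B. k \<in> I \<and> B \<in> sets borel}"

definition FY :: "int set \<Rightarrow> (int \<Rightarrow> 'g::polish_space \<times> 'f::polish_space) measure" where
  "FY I = sigma UNIV {(\<lambda>\<omega>. Ypath \<omega> k) -` B | k B. k \<in> I \<and> B \<in> sets borel}"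

definition sigma_join :: "'a measure \<Rightarrow> 'a measure \<Rightarrow> 'a measure" (infixl "\<squnion>\<^sub>\<sigma>" 65) where
  "A \<squnion>\<^sub>\<sigma> B = sigma (space A \<union> space B) (sets A \<union> sets B)"

definition FX :: "int set \<Rightarrow> (int \<Rightarrow> 'g::polish_space \<times> 'f::polish_space) measure" where
  "FX I = FZ I \<squnion>\<^sub>\<sigma> FY I"

definition AZ :: "(int \<Rightarrow> 'g::polish_space \<times> 'f::polish_space) set set" where
  "AZ = (\<Inter>n::nat. sets (FZ {int n..}))"

definition tv_norm :: "'a set set \<Rightarrow> 'a measure \<Rightarrow> 'a measure \<Rightarrow> real" where
  "tv_norm \<G> \<mu> \<nu> = 2 * (SUP A\<in>\<G>. \<bar>measure \<mu> A - measure \<nu> A\<bar>)"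

definition equivalent_measures :: "'a measure \<Rightarrow> 'a measure \<Rightarrow> bool" where
  "equivalent_measures \<mu> \<nu> \<longleftrightarrow> absolutely_continuous \<mu> \<nu> \<and> absolutely_continuous \<nu> \<mu>"

definition mutually_singular_on :: "'a set set \<Rightarrow> 'a measure \<Rightarrow> 'a measure \<Rightarrow> bool" where
  "mutually_singular_on \<G> \<mu> \<nu> \<longleftrightarrow> (\<exists>A\<in>\<G>. emeasure \<mu> A = 0 \<and> emeasure \<nu> (space \<nu> - A) = 0)"

text \<open>\<open>\<kappa>\<close> is a version of the regular conditional distribution \<open>P[X \<in> \<cdot> | \<G>]\<close> of the
  \<open>N\<close>-valued random variable \<open>X\<close>.\<close>

definition regular_cond_distr ::
  "'a measure \<Rightarrow> 'a measure \<Rightarrow> ('a \<Rightarrow> 'b) \<Rightarrow> 'b measure \<Rightarrow> ('a \<Rightarrow> 'b measure) \<Rightarrow> bool" where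
  "regular_cond_distr P \<G> X N \<kappa> \<longleftrightarrow>
     \<kappa> \<in> \<G> \<rightarrow>\<^sub>M prob_algebra N \<and>
     (\<forall>A\<in>sets N. AE \<omega> in P. measure (\<kappa> \<omega>) A =
        real_cond_exp P \<G> (indicator (X -` A \<inter> space P)) \<omega>)"

definition version_Py ::
  "(int \<Rightarrow> 'g::polish_space \<times> 'f::polish_space) measure \<Rightarrow>
   ((int \<Rightarrow> 'f) \<Rightarrow> (int \<Rightarrow> 'g \<times> 'f) measure) \<Rightarrow> bool" where
  "version_Py P Py \<longleftrightarrow>
     Py \<in> borel \<rightarrow>\<^sub>M prob_algebra borel \<and>
     regular_cond_distr P (FY UNIV) (\<lambda>\<omega>. \<omega>) borel (\<lambda>\<omega>. Py (Ypath \<omega>))"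

text \<open>The one-sided sequences \<open>z\<^sub>-\<close> are the elements of the product space indexed by \<open>{..0}\<close>.\<close>

definition past :: "(int \<Rightarrow> 'a) \<Rightarrow> int \<Rightarrow> 'a" where
  "past z = restrict z {..0}"

definition version_Pyz ::
  "(int \<Rightarrow> 'g::polish_space \<times> 'f::polish_space) measure \<Rightarrow>
   ((int \<Rightarrow> 'f) \<Rightarrow> (int \<Rightarrow> 'g) \<Rightarrow> (int \<Rightarrow> 'g \<times> 'f) measure) \<Rightarrow> bool" where
  "version_Pyz P Pyz \<longleftrightarrow>
     case_prod Pyz \<in> borel \<Otimes>\<^sub>M (\<Pi>\<^sub>M k\<in>{..0}. borel) \<rightarrow>\<^sub>M prob_algebra borel \<and>
     regular_cond_distr P (FY UNIV \<squnion>\<^sub>\<sigma> FZ {..0}) (\<lambda>\<omega>. \<omega>) borel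
       (\<lambda>\<omega>. Pyz (Ypath \<omega>) (past (Zpath \<omega>)))"

definition Q_measure ::
  "(int \<Rightarrow> 'g::polish_space \<times> 'f::polish_space) measure \<Rightarrow>
   ((int \<Rightarrow> 'f) \<Rightarrow> (int \<Rightarrow> 'g \<times> 'f) measure) \<Rightarrow>
   ((int \<Rightarrow> 'g) \<times> (int \<Rightarrow> 'g) \<times> (int \<Rightarrow> 'f)) measure" where
  "Q_measure P Py =
     do { y \<leftarrow> distr P borel Ypath;
          z \<leftarrow> distr (Py y) borel Zpath;
          z' \<leftarrow> distr (Py y) borel Zpath;
          return (borel \<Otimes>\<^sub>M (borel \<Otimes>\<^sub>M borel)) (z, z', y) }"

lemma measurable_Zpath [measurable]:
  "Zpath \<in> (borel :: (int \<Rightarrow> 'g::polish_space \<times> 'f::polish_space) measure) \<rightarrow>\<^sub>M borel"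
  unfolding Zpath_def [abs_def]
  by (intro borel_measurable_continuous_onI continuous_on_coordinatewise_then_product
       continuous_on_fst continuous_on_product_coordinates)

lemma measurable_Ypath [measurable]:
  "Ypath \<in> (borel :: (int \<Rightarrow> 'g::polish_space \<times> 'f::polish_space) measure) \<rightarrow>\<^sub>M borel"
  unfolding Ypath_def [abs_def]
  by (intro borel_measurable_continuous_onI continuous_on_coordinatewise_then_product
       continuous_on_snd continuous_on_product_coordinates)

text \<open>The defining property of \<open>Q\<close> as an iterated integral of indicators.\<close>

lemma emeasure_Q_measure:
  fixes P :: "(int \<Rightarrow> 'g::polish_space \<times> 'f::polish_space) measure"
  assumes P: "sets P = sets borel"
    and Py: "Py \<in> borel \<rightarrow>\<^sub>M prob_algebra borel"
    and A: "A \<in> sets (borel \<Otimes>\<^sub>M (borel \<Otimes>\<^sub>M borel))"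
  shows "emeasure (Q_measure P Py) A =
    (\<integral>\<^sup>+y. (\<integral>\<^sup>+z. (\<integral>\<^sup>+z'. indicator A (z, z', y)
       \<partial>distr (Py y) borel Zpath) \<partial>distr (Py y) borel Zpath) \<partial>distr P borel Ypath)"
proof -
  let ?N = "borel \<Otimes>\<^sub>M (borel \<Otimes>\<^sub>M borel) ::
    ((int \<Rightarrow> 'g) \<times> (int \<Rightarrow> 'g) \<times> (int \<Rightarrow> 'f)) measure"
  note A [measurable]
  have [measurable]: "Py \<in> borel \<rightarrow>\<^sub>M subprob_algebra borel"
    using Py by (rule measurable_prob_algebraD)
  have K [measurable]: "(\<lambda>y. distr (Py y) borel Zpath) \<in> borel \<rightarrow>\<^sub>M subprob_algebra borel"
    by (rule measurable_compose [OF _ measurable_distr]) measurable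
  have in1: "(\<lambda>z'. return ?N (z, z', y)) \<in> borel \<rightarrow>\<^sub>M subprob_algebra ?N" for z y
    by measurable
  have in2: "(\<lambda>z. distr (Py y) borel Zpath \<bind> (\<lambda>z'. return ?N (z, z', y)))
      \<in> borel \<rightarrow>\<^sub>M subprob_algebra ?N" for y
    by measurable
  have in3: "(\<lambda>y. distr (Py y) borel Zpath \<bind> (\<lambda>z. distr (Py y) borel Zpath \<bind>
      (\<lambda>z'. return ?N (z, z', y)))) \<in> borel \<rightarrow>\<^sub>M subprob_algebra ?N"
    by measurable
  have "emeasure (Q_measure P Py) A = (\<integral>\<^sup>+y. emeasure (distr (Py y) borel Zpath \<bind>
      (\<lambda>z. distr (Py y) borel Zpath \<bind> (\<lambda>z'. return ?N (z, z', y)))) A \<partial>distr P borel Ypath)"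
    unfolding Q_measure_def using in3 A by (subst emeasure_bind [where N = ?N]) auto
  also have "\<dots> = (\<integral>\<^sup>+y. (\<integral>\<^sup>+z. emeasure (distr (Py y) borel Zpath \<bind>
      (\<lambda>z'. return ?N (z, z', y))) A \<partial>distr (Py y) borel Zpath) \<partial>distr P borel Ypath)"
    using in2 A by (subst emeasure_bind [where N = ?N]) auto
  also have "\<dots> = (\<integral>\<^sup>+y. (\<integral>\<^sup>+z. (\<integral>\<^sup>+z'. indicator A (z, z', y)
       \<partial>distr (Py y) borel Zpath) \<partial>distr (Py y) borel Zpath) \<partial>distr P borel Ypath)"
    using in1 A by (subst emeasure_bind [where N = ?N]) auto
  finally show ?thesis .
qed

definition absolutely_regular :: "(int \<Rightarrow> 'a::second_countable_topology) measure \<Rightarrow> bool" where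
  "absolutely_regular P \<longleftrightarrow>
     (\<lambda>k::nat.
        let Past = (\<Pi>\<^sub>M j\<in>{..0}. borel); Future = (\<Pi>\<^sub>M j\<in>{int k..}. borel)
        in tv_norm (sets (Past \<Otimes>\<^sub>M Future))
             (distr P (Past \<Otimes>\<^sub>M Future) (\<lambda>\<omega>. (restrict \<omega> {..0}, restrict \<omega> {int k..})))
             (distr P Past (\<lambda>\<omega>. restrict \<omega> {..0}) \<Otimes>\<^sub>M
              distr P Future (\<lambda>\<omega>. restrict \<omega> {int k..})))
     \<longlonglongrightarrow> 0"

text \<open>Since the state space of \<open>(Y\<^sub>k)\<close> with \<open>m \<le> k \<le> n\<close> is Polish, the regular conditional
  distributions below exist and are unique up to \<open>P\<close>-null sets; hence the existential
  quantifier over versions expresses the same property as a universal one.\<close>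

definition nondegenerate ::
  "(int \<Rightarrow> 'g::polish_space \<times> 'f::polish_space) measure \<Rightarrow> bool" where
  "nondegenerate P \<longleftrightarrow>
     (\<forall>m n. m \<le> n \<longrightarrow>
       (\<exists>\<kappa> \<kappa>'.
          regular_cond_distr P (FX {..m - 1} \<squnion>\<^sub>\<sigma> FX {n + 1..})
            (\<lambda>\<omega>. restrict (Ypath \<omega>) {m..n}) (\<Pi>\<^sub>M k\<in>{m..n}. borel) \<kappa> \<and>
          regular_cond_distr P (FY {..m - 1} \<squnion>\<^sub>\<sigma> FY {n + 1..})
            (\<lambda>\<omega>. restrict (Ypath \<omega>) {m..n}) (\<Pi>\<^sub>M k\<in>{m..n}. borel) \<kappa>' \<and>
          (AE \<omega> in P. equivalent_measures (\<kappa> \<omega>) (\<kappa>' \<omega>))))"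

end

theory Submission
  imports Defs
begin

text \<open>Write \<open>\<mu>\<^sub>z\<close> for the law \<open>Pyz y (past z)\<close>. All three conclusions come from one statement,
\<open>tail_not_separated\<close>: for \<open>Q\<close>-almost every \<open>(z, z', y)\<close>, no event \<open>A\<close> of \<open>AZ\<close> satisfies both
\<open>\<mu>\<^sub>z(A) > 0\<close> and \<open>\<mu>\<^sub>z'(- A) > 0\<close>. Used for \<open>A\<close> and for \<open>- A\<close> it says that \<open>\<mu>\<^sub>z\<close> and \<open>\<mu>\<^sub>z'\<close>
agree on \<open>AZ\<close> and take only the values 0 and 1 there. Two probabilities that agree on the intersection
of a decreasing sequence of \<open>\<sigma>\<close>-fields become close in total variation along the sequence
(\<open>tail_agreement_imp_total_variation_vanishes\<close>), and total variation below 2 excludes singularity.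

The laws \<open>\<mu>\<^sub>z\<close> and \<open>\<mu>\<^sub>z'\<close> are compared through a reference that depends on \<open>y\<close> alone: the
conditional probability \<open>future_prob\<close> of an event \<open>D\<close> about \<open>Z\<close> from time \<open>n\<close> on, given \<open>Y\<close> from
time \<open>n\<close> on. The key estimate \<open>future_controlled_if_regular_nondegenerate\<close> concerns events \<open>E\<close> about
\<open>Z\<close> up to time 0 and the whole of \<open>Y\<close>, and events \<open>D\<close> that may be chosen depending on these: if \<open>E \<inter> D\<close> is improbable, then
\<open>E\<close> together with an independent draw of the future from the reference is improbable too.
Absolute regularity allows the exchange of \<open>D\<close> and its reference probability against every test
function that ignores \<open>Y\<close> in the gap \<open>1..n - 1\<close>, with an error that vanishes as \<open>n\<close> grows.
But \<open>E\<close> does see the gap. Nondegeneracy repairs this: redrawing \<open>Y\<close> in the gap given only the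
observations outside it changes \<open>P\<close> to a measure that is equivalent on events not involving \<open>Z\<close> in
the gap, and under which \<open>E\<close> may be averaged over
the gap. Equivalence gives no rate, but it enters only after \<open>n\<close> has been fixed, and the
total variation error is added after the constants have been spent, so it is never multiplied by them.

By stationarity the estimate holds with the same constants when the cut is moved from 0 to any
\<open>k \<ge> 0\<close>. Suppose \<open>\<mu>\<^sub>z(A)\<close> and \<open>\<mu>\<^sub>z'(- A)\<close> are both bounded away from 0 for some \<open>A\<close> in \<open>AZ\<close>. For
large \<open>k\<close> the event \<open>A\<close> is approximated, under both laws, by an event \<open>C\<close> about \<open>Z\<close> up to time \<open>k\<close>
and by an event \<open>D\<close> about \<open>Z\<close> from time \<open>k + n\<close> on. Then \<open>C - D\<close> is nearly null for \<open>\<mu>\<^sub>z\<close> and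
\<open>D - C\<close> is nearly null for \<open>\<mu>\<^sub>z'\<close>, while the common reference gives probability at least one half to
\<open>- D\<close> or to \<open>D\<close>. Hence for every large \<open>k\<close> one of \<open>(z, y)\<close>, \<open>(z', y)\<close> lies in a set of small
\<open>P\<close>-probability (\<open>separation_small\<close>), uniformly in \<open>k\<close>. Both pairs have law \<open>P\<close> under \<open>Q\<close>, so such
triples form a \<open>Q\<close>-null set.\<close>

section \<open>Coordinate \<open>\<sigma>\<close>-fields\<close>

text \<open>The \<open>\<sigma>\<close>-fields of the hidden process, of the observations and of both differ only in two index
sets. A single family keeps joins, shifts and gluings of paths to computations with index sets.\<close>

definition coord_field :: "int set \<Rightarrow> int set \<Rightarrow> (int \<Rightarrow> 'g::polish_space \<times> 'f::polish_space) measure" where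
  "coord_field I J = sigma UNIV
     ({(\<lambda>\<omega>. Zpath \<omega> k) -` B | k B. k \<in> I \<and> B \<in> sets borel} \<union>
      {(\<lambda>\<omega>. Ypath \<omega> k) -` B | k B. k \<in> J \<and> B \<in> sets borel})"

lemma space_coord_field [simp]: "space (coord_field I J) = UNIV"
  unfolding coord_field_def by (simp add: space_measure_of_conv)

lemma FZ_eq_coord_field: "FZ I = coord_field I {}"
  unfolding FZ_def coord_field_def by simp

lemma FY_eq_coord_field: "FY J = coord_field {} J"
  unfolding FY_def coord_field_def by simp

lemma measurable_into_coord_field:
  fixes f :: "'x \<Rightarrow> int \<Rightarrow> 'g::polish_space \<times> 'f::polish_space"
  assumes "\<And>k. k \<in> I \<Longrightarrow> (\<lambda>x. Zpath (f x) k) \<in> borel_measurable M"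
    and "\<And>k. k \<in> J \<Longrightarrow> (\<lambda>x. Ypath (f x) k) \<in> borel_measurable M"
  shows "f \<in> M \<rightarrow>\<^sub>M coord_field I J"
  unfolding coord_field_def
proof (rule measurable_measure_of)
  fix S :: "(int \<Rightarrow> 'g \<times> 'f) set" assume "S \<in> {(\<lambda>\<omega>. Zpath \<omega> k) -` B | k B. k \<in> I \<and> B \<in> sets borel} \<union>
      {(\<lambda>\<omega>. Ypath \<omega> k) -` B | k B. k \<in> J \<and> B \<in> sets borel}"
  then show "f -` S \<inter> space M \<in> sets M"
    using measurable_sets[OF assms(1)] measurable_sets[OF assms(2)]
    by (auto simp: vimage_def)
qed auto

lemma measurable_coord_field_Z:
  assumes "k \<in> I" shows "(\<lambda>\<omega>. Zpath \<omega> k) \<in> borel_measurable (coord_field I J)"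
proof (rule measurableI)
  fix B :: "'a set" assume "B \<in> sets borel"
  then show "(\<lambda>\<omega>. Zpath \<omega> k) -` B \<inter> space (coord_field I J) \<in> sets (coord_field I J)"
    unfolding coord_field_def using assms by (auto simp: sets_measure_of_conv space_measure_of_conv
      intro!: sigma_sets.Basic)
qed simp

lemma measurable_coord_field_Y:
  assumes "k \<in> J" shows "(\<lambda>\<omega>. Ypath \<omega> k) \<in> borel_measurable (coord_field I J)"
proof (rule measurableI)
  fix B :: "'b set" assume "B \<in> sets borel"
  then show "(\<lambda>\<omega>. Ypath \<omega> k) -` B \<inter> space (coord_field I J) \<in> sets (coord_field I J)"
    unfolding coord_field_def using assms by (auto simp: sets_measure_of_conv space_measure_of_conv
      intro!: sigma_sets.Basic)
qed simp

lemma coord_field_mono: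
  assumes "I \<subseteq> I'" "J \<subseteq> J'"
  shows "sets (coord_field I J) \<subseteq> sets (coord_field I' J')"
proof -
  have "(\<lambda>x. x) \<in> coord_field I' J' \<rightarrow>\<^sub>M coord_field I J"
    using assms by (intro measurable_into_coord_field measurable_coord_field_Z measurable_coord_field_Y) auto
  then show ?thesis by (auto dest: measurable_sets)
qed

lemma measurable_coord_field_mono:
  assumes "f \<in> coord_field I J \<rightarrow>\<^sub>M N" "I \<subseteq> I'" "J \<subseteq> J'"
  shows "f \<in> coord_field I' J' \<rightarrow>\<^sub>M N"
  using assms(1) coord_field_mono[OF assms(2,3)]
  unfolding measurable_def by auto

lemma sigma_join_coord_field:
  "coord_field I J \<squnion>\<^sub>\<sigma> coord_field I' J' = coord_field (I \<union> I') (J \<union> J')"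
proof -
  let ?A = "sets (coord_field I J) \<union> sets (coord_field I' J') :: (int \<Rightarrow> 'a \<times> 'b) set set"
  have join: "coord_field I J \<squnion>\<^sub>\<sigma> coord_field I' J' = sigma UNIV ?A"
    unfolding sigma_join_def by simp
  have 1: "?A \<subseteq> sets (coord_field (I \<union> I') (J \<union> J'))"
    using coord_field_mono[of I "I \<union> I'" J "J \<union> J'"] coord_field_mono[of I' "I \<union> I'" J' "J \<union> J'"] by auto
  have B: "(\<lambda>x. x) \<in> sigma UNIV ?A \<rightarrow>\<^sub>M coord_field (I \<union> I') (J \<union> J')"
  proof (rule measurable_into_coord_field)
    have *: "f \<in> borel_measurable (sigma UNIV ?A)"
      if "f \<in> borel_measurable (coord_field I J) \<or> f \<in> borel_measurable (coord_field I' J')"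
      for f :: "_ \<Rightarrow> 'c::topological_space"
      using that unfolding measurable_def by (auto simp: space_measure_of_conv sets_measure_of_conv)
    show "(\<lambda>x. Zpath x k) \<in> borel_measurable (sigma UNIV ?A)" if "k \<in> I \<union> I'" for k
      using that by (intro *) (auto intro: measurable_coord_field_Z)
    show "(\<lambda>x. Ypath x k) \<in> borel_measurable (sigma UNIV ?A)" if "k \<in> J \<union> J'" for k
      using that by (intro *) (auto intro: measurable_coord_field_Y)
  qed
  have "sets (sigma UNIV ?A) = sets (coord_field (I \<union> I') (J \<union> J'))"
  proof
    show "sets (sigma UNIV ?A) \<subseteq> sets (coord_field (I \<union> I') (J \<union> J'))"
      using 1 by (metis sets.sigma_sets_subset sets_measure_of_conv space_coord_field subset_UNIV Pow_UNIV)
    show "sets (coord_field (I \<union> I') (J \<union> J')) \<subseteq> sets (sigma UNIV ?A)"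
      using measurable_sets[OF B] by (auto simp: space_measure_of_conv)
  qed
  moreover have "emeasure (sigma UNIV ?A) = emeasure (coord_field (I \<union> I') (J \<union> J'))"
    unfolding coord_field_def by (simp add: emeasure_sigma)
  ultimately show ?thesis unfolding join
    by (intro measure_eqI) auto
qed

lemmas coord_field_joins = FZ_eq_coord_field FY_eq_coord_field FX_def sigma_join_coord_field

lemma measurable_path_Z [measurable]: "(\<lambda>\<omega> :: int \<Rightarrow> 'g::polish_space \<times> 'f::polish_space. Zpath \<omega> k) \<in> borel_measurable borel"
  by (rule measurable_compose[OF measurable_Zpath measurable_product_coordinates])

lemma measurable_path_Y [measurable]: "(\<lambda>\<omega> :: int \<Rightarrow> 'g::polish_space \<times> 'f::polish_space. Ypath \<omega> k) \<in> borel_measurable borel"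
  by (rule measurable_compose[OF measurable_Ypath measurable_product_coordinates])

lemma measurable_into_path:
  fixes f :: "'x \<Rightarrow> int \<Rightarrow> 'g::polish_space \<times> 'f::polish_space"
  assumes [measurable]: "\<And>k. (\<lambda>x. Zpath (f x) k) \<in> borel_measurable M"
    "\<And>k. (\<lambda>x. Ypath (f x) k) \<in> borel_measurable M"
  shows "f \<in> borel_measurable M"
proof (rule measurable_coordinatewise_then_product)
  fix i
  have "(\<lambda>x. (Zpath (f x) i, Ypath (f x) i)) \<in> borel_measurable M"
    by (simp add: borel_prod[symmetric])
  then show "(\<lambda>x. f x i) \<in> borel_measurable M"
    by (simp add: Zpath_def Ypath_def)
qed

lemma coord_field_borel: "sets (coord_field I J) \<subseteq> sets borel"
proof -
  have "(\<lambda>x. x) \<in> borel \<rightarrow>\<^sub>M coord_field I J"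
    by (rule measurable_into_coord_field) measurable
  then show ?thesis by (auto dest: measurable_sets)
qed

lemma coord_field_UNIV: "sets (coord_field UNIV UNIV) = sets borel"
proof
  have "(\<lambda>x. x) \<in> borel_measurable (coord_field UNIV UNIV)"
    by (rule measurable_into_path) (auto intro: measurable_coord_field_Z measurable_coord_field_Y)
  then show "sets borel \<subseteq> sets (coord_field UNIV UNIV)"
    by (auto dest: measurable_sets)
qed (rule coord_field_borel)

lemma subalgebra_coord_field:
  "sets P = sets borel \<Longrightarrow> subalgebra P (coord_field I J)"
  using coord_field_borel sets_eq_imp_space_eq[of P borel] by (auto simp: subalgebra_def)

text \<open>The generators cannot distinguish paths that share the listed coordinates, and complements and
countable unions inherit this. It is how a set or function is recognised to ignore the gap or the other
copy of the path.\<close>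

lemma coord_field_agree:
  assumes "S \<in> sets (coord_field I J)"
    and "\<And>k. k \<in> I \<Longrightarrow> Zpath \<omega> k = Zpath \<omega>' k" "\<And>k. k \<in> J \<Longrightarrow> Ypath \<omega> k = Ypath \<omega>' k"
  shows "\<omega> \<in> S \<longleftrightarrow> \<omega>' \<in> S"
proof -
  have "S \<in> sigma_sets UNIV ({(\<lambda>\<omega>. Zpath \<omega> k) -` B | k B. k \<in> I \<and> B \<in> sets borel} \<union>
      {(\<lambda>\<omega>. Ypath \<omega> k) -` B | k B. k \<in> J \<and> B \<in> sets borel})"
    using assms(1) unfolding coord_field_def by (simp add: sets_measure_of_conv)
  then show ?thesis
    by induction (use assms(2,3) in auto)
qed

lemma coord_field_agree_fun:
  fixes f :: "_ \<Rightarrow> 'c::t1_space"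
  assumes "f \<in> borel_measurable (coord_field I J)"
    and "\<And>k. k \<in> I \<Longrightarrow> Zpath \<omega> k = Zpath \<omega>' k" "\<And>k. k \<in> J \<Longrightarrow> Ypath \<omega> k = Ypath \<omega>' k"
  shows "f \<omega> = f \<omega>'"
proof -
  have "f -` {f \<omega>} \<in> sets (coord_field I J)"
    using measurable_sets[OF assms(1), of "{f \<omega>}"] by simp
  from coord_field_agree[OF this assms(2,3)] show ?thesis by auto
qed

section \<open>Measure-theoretic tools\<close>

text \<open>The constant is a level that the density of \<open>N\<close> exceeds only on a set of \<open>N\<close>-measure at most
\<open>\<delta>\<close>; off that set \<open>N\<close> is at most that level times \<open>M\<close>.\<close>

lemma absolutely_continuous_linear_bound:
  assumes "finite_measure M" "finite_measure N" and sets: "sets N = sets M"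
    and ac: "absolutely_continuous M N" and "\<delta> > (0::real)"
  obtains c :: real where "c > 0"
    and "\<And>S. S \<in> sets M \<Longrightarrow> emeasure N S \<le> ennreal c * emeasure M S + ennreal \<delta>"
proof -
  interpret M: finite_measure M by fact
  interpret N: finite_measure N by fact
  have [measurable_cong]: "sets N = sets M" by fact
  define f where "f = RN_deriv M N"
  have [measurable]: "f \<in> borel_measurable M" unfolding f_def by simp
  have N: "N = density M f"
    using M.density_RN_deriv[OF ac sets] by (simp add: f_def)
  define F where "F k = {x \<in> space M. f x > of_nat k}" for k :: nat
  have [measurable]: "F k \<in> sets M" for k unfolding F_def by measurable
  have "AE x in M. f x \<noteq> \<infinity>"
    unfolding f_def by (rule M.RN_deriv_finite[OF N.sigma_finite_measure_axioms ac sets])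
  then have "emeasure M {x \<in> space M. \<not> f x \<noteq> \<infinity>} = 0"
    by (intro AE_iff_measurable[THEN iffD1, rotated 2]) auto
  then have "{x \<in> space M. f x = \<infinity>} \<in> null_sets M"
    by (intro null_setsI) auto
  then have "emeasure N {x \<in> space M. f x = \<infinity>} = 0"
    using ac unfolding absolutely_continuous_def by (intro null_setsD1) (rule subsetD)
  moreover have "(\<Inter>k. F k) = {x \<in> space M. f x = \<infinity>}"
  proof -
    have "f x = \<infinity>" if gt: "\<And>k::nat. of_nat k < f x" for x
    proof (rule ccontr)
      assume "f x \<noteq> \<infinity>"
      then obtain k :: nat where "f x < of_nat k"
        using ennreal_Ex_less_of_nat[of "f x"] by (auto simp: less_top)
      with gt[of k] show False by (rule order.asym)
    qed
    then show ?thesis unfolding F_def by (auto simp: of_nat_less_top)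
  qed
  ultimately have F0: "emeasure N (\<Inter>k. F k) = 0" by (simp only:)
  have decF: "decseq F"
    unfolding decseq_def F_def 
    by (intro allI impI Collect_mono) (meson le_less_trans of_nat_mono)
  have "(\<lambda>k. emeasure N (F k)) \<longlonglongrightarrow> 0"
    unfolding F0[symmetric] using decF by (intro Lim_emeasure_decseq) auto
  from order_tendstoD(2)[OF this, of "ennreal \<delta>"]
  have "\<forall>\<^sub>F k in sequentially. emeasure N (F k) < ennreal \<delta>"
    using \<open>\<delta> > 0\<close> by simp
  then obtain k0 where k0: "emeasure N (F k0) < ennreal \<delta>"
    by (auto simp: eventually_sequentially)
  define k where "k = Suc k0"
  have "F k \<subseteq> F k0" using decF by (simp add: decseq_def k_def)
  then have "emeasure N (F k) \<le> emeasure N (F k0)"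
    by (intro emeasure_mono) auto
  with k0 have k: "emeasure N (F k) \<le> ennreal \<delta>" by simp
  show thesis
  proof (rule that[of "real k"])
    show "real k > 0" by (simp add: k_def)
    fix S assume S [measurable]: "S \<in> sets M"
    have "emeasure N S \<le> emeasure N (S - F k) + emeasure N (F k)"
    proof -
      have "emeasure N S \<le> emeasure N ((S - F k) \<union> F k)"
        by (rule emeasure_mono) auto
      also have "\<dots> \<le> emeasure N (S - F k) + emeasure N (F k)"
        by (rule emeasure_subadditive) auto
      finally show ?thesis .
    qed
    moreover have "emeasure N (S - F k) \<le> ennreal (real k) * emeasure M S"
    proof -
      have "emeasure N (S - F k) = (\<integral>\<^sup>+x. f x * indicator (S - F k) x \<partial>M)"
        unfolding N by (rule emeasure_density) auto
      also have "\<dots> \<le> (\<integral>\<^sup>+x. of_nat k * indicator S x \<partial>M)"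
        by (intro nn_integral_mono) (auto simp: F_def not_less split: split_indicator)
      also have "\<dots> = ennreal (real k) * emeasure M S"
        by (simp add: nn_integral_cmult ennreal_of_nat_eq_real_of_nat)
      finally show ?thesis .
    qed
    ultimately show "emeasure N S \<le> ennreal (real k) * emeasure M S + ennreal \<delta>"
      using k by (blast intro: add_mono order_trans)
  qed
qed

text \<open>Let \<open>t n\<close> be the supremum of \<open>\<mu> - \<nu>\<close> over \<open>F n\<close> and let \<open>A n\<close> be optimal there up to
\<open>(1/2)^n\<close>. Uniting \<open>A m\<close> with a set \<open>B\<close> from the later fields costs only this error, because
\<open>A m \<inter> B\<close> lies in \<open>F m\<close> and so has difference at most \<open>t m\<close>. Hence the limit superior of the \<open>A n\<close>,
a tail event, has difference at least \<open>lim t\<close>, which must therefore be 0. This argument replaces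
convergence of reverse martingales.\<close>

lemma tail_agreement_imp_total_variation_vanishes:
  assumes "prob_space \<mu>" "prob_space \<nu>" and space: "space \<nu> = space \<mu>"
    and F: "\<And>n::nat. sigma_algebra (space \<mu>) (F n)"
    and F_sub: "\<And>n. F n \<subseteq> sets \<mu>" "\<And>n. F n \<subseteq> sets \<nu>" and dec: "\<And>n. F (Suc n) \<subseteq> F n"
    and tail: "\<And>A. (\<And>n. A \<in> F n) \<Longrightarrow> measure \<mu> A = measure \<nu> A"
  shows "(\<lambda>n. SUP A\<in>F n. \<bar>measure \<mu> A - measure \<nu> A\<bar>) \<longlonglongrightarrow> 0"
proof -
  interpret \<mu>: prob_space \<mu> by fact
  interpret \<nu>: prob_space \<nu> by fact
  interpret F: sigma_algebra "space \<mu>" "F n" for n by (rule F)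
  define g where "g A = measure \<mu> A - measure \<nu> A" for A
  define t where "t n = (SUP A\<in>F n. \<bar>g A\<bar>)" for n
  have anti: "F n \<subseteq> F m" if "m \<le> n" for m n
    using lift_Suc_antimono_le[of F, OF dec that] .
  have abs_le: "\<bar>g A\<bar> \<le> 1" for A
    unfolding g_def using \<mu>.prob_le_1[of A] \<nu>.prob_le_1[of A] measure_nonneg[of \<mu> A] measure_nonneg[of \<nu> A]
    by linarith
  have bdd: "bdd_above ((\<lambda>A. \<bar>g A\<bar>) ` F n)" for n
    using abs_le by (auto intro!: bdd_aboveI[of _ 1])
  have upper: "\<bar>g A\<bar> \<le> t n" if "A \<in> F n" for A n
    unfolding t_def by (rule cSUP_upper[OF that bdd])
  have "decseq t" unfolding decseq_def t_def
    using anti bdd F.empty_sets by (intro allI impI cSUP_subset_mono) auto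
  moreover have t_nonneg: "0 \<le> t n" for n
    using upper[of "{}" n] F.empty_sets by simp
  ultimately obtain T where T: "t \<longlonglongrightarrow> T" and T_le: "\<And>n. T \<le> t n"
    using decseq_convergent[of t 0] by metis
  have "\<exists>A\<in>F n. g A \<ge> t n - (1/2)^n" for n
  proof -
    have "\<exists>A\<in>F n. t n - (1/2)^n < \<bar>g A\<bar>"
      unfolding t_def using bdd F.empty_sets
      by (subst less_cSUP_iff[symmetric]) auto
    then obtain A where A: "A \<in> F n" "t n - (1/2)^n < \<bar>g A\<bar>" by blast
    show ?thesis
    proof (cases "g A \<ge> 0")
      case True with A show ?thesis by force
    next
      case False
      have "g (space \<mu> - A) = - g A"
        using A(1) F_sub[of n] unfolding g_def
        by (subst \<mu>.prob_compl, force) (subst space[symmetric], subst \<nu>.prob_compl, auto)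
      with A False show ?thesis by (intro bexI[of _ "space \<mu> - A"]) auto
    qed
  qed
  then obtain A where A: "\<And>n. A n \<in> F n" and gA: "\<And>n. g (A n) \<ge> t n - (1/2)^n"
    by metis
  have A_in: "A j \<in> F m" if "m \<le> j" for j m using A anti that by blast
  have [measurable]: "A j \<in> sets \<mu>" "A j \<in> sets \<nu>" for j
    using A F_sub by blast+
  have fin: "g (\<Union>j\<in>{m..m+d}. A j) \<ge> T - 2 * (1/2)^m" for m d
  proof (induction d arbitrary: m)
    case 0
    have "T - 2 * (1/2)^m \<le> t m - (1/2)^m"
      using T_le[of m] zero_le_power[of "1/2::real" m] by linarith
    then show ?case using gA[of m] by simp
  next
    case (Suc d)
    let ?B = "\<Union>j\<in>{Suc m..Suc m + d}. A j"
    have [measurable]: "?B \<in> sets \<mu>" "?B \<in> sets \<nu>" by auto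
    have mod: "g (A m \<union> ?B) = g (A m) + g ?B - g (A m \<inter> ?B)"
      unfolding g_def
      by (subst \<mu>.finite_measure_Union', simp, simp, subst \<nu>.finite_measure_Union', simp, simp,
          subst \<mu>.finite_measure_Diff', simp, simp, subst \<nu>.finite_measure_Diff', simp, simp)
        (simp add: Int_commute)
    have "A m \<inter> ?B \<in> F m" using A_in by (intro F.Int F.finite_UN) auto
    then have "g (A m \<inter> ?B) \<le> t m" using upper by fastforce
    moreover have "{m..m + Suc d} = insert m {Suc m..Suc m + d}" by auto
    then have "(\<Union>j\<in>{m..m + Suc d}. A j) = A m \<union> ?B" by simp
    ultimately show ?case using mod gA[of m] Suc[of "Suc m"] by simp
  qed
  define U where "U m = (\<Union>j\<in>{m..}. A j)" for m
  have Um: "U m = (\<Union>d. \<Union>j\<in>{m..m+d}. A j)" for m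
  proof (intro equalityI subsetI)
    fix x assume "x \<in> U m"
    then obtain j where "m \<le> j" "x \<in> A j" by (auto simp: U_def)
    then show "x \<in> (\<Union>d. \<Union>j\<in>{m..m+d}. A j)" by (intro UN_I[of "j - m"] UN_I[of j]) auto
  qed (auto simp: U_def)
  have gU: "g (U m) \<ge> T - 2 * (1/2)^m" for m
  proof (rule LIMSEQ_le_const)
    have inc: "incseq (\<lambda>d. \<Union>j\<in>{m..m+d}. A j)"
      unfolding incseq_def by force
    show "(\<lambda>d. g (\<Union>j\<in>{m..m+d}. A j)) \<longlonglongrightarrow> g (U m)"
      unfolding g_def Um
      by (intro tendsto_diff \<mu>.finite_Lim_measure_incseq \<nu>.finite_Lim_measure_incseq inc) auto
  qed (use fin in auto)
  define L where "L = (\<Inter>m. U m)"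
  have dU: "decseq U" unfolding decseq_def U_def by force
  have "g L \<ge> T"
  proof (rule LIMSEQ_le)
    have "U m \<in> sets \<mu>" "U m \<in> sets \<nu>" for m by (simp_all add: U_def)
    then show "(\<lambda>m. g (U m)) \<longlonglongrightarrow> g L"
      unfolding g_def L_def using dU
      by (intro tendsto_diff \<mu>.finite_Lim_measure_decseq \<nu>.finite_Lim_measure_decseq)
        auto
    have "(\<lambda>m. T - 2 * (1/2)^m) \<longlonglongrightarrow> T - 2 * 0"
      by (intro tendsto_intros) auto
    then show "(\<lambda>m. T - 2 * (1/2)^m) \<longlonglongrightarrow> T" by simp
  qed (use gU in auto)
  moreover have "L \<in> F n" for n
  proof -
    have "L = (\<Inter>m. U (n + m))"
      unfolding L_def using dU by (auto simp: decseq_def) (metis le_add2 subsetD)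
    moreover have "U (n + m) \<in> F n" for m
      unfolding U_def using A_in by (intro F.countable_UN') auto
    ultimately show ?thesis by auto
  qed
  then have "g L = 0" unfolding g_def using tail by simp
  ultimately have "T \<le> 0" by simp
  moreover have "T \<ge> 0" using LIMSEQ_le_const[OF T] t_nonneg by auto
  ultimately show ?thesis using T unfolding t_def g_def by simp
qed

text \<open>The events that can be approximated form a \<open>\<sigma>\<close>-algebra. Two measures are treated at once because
the same approximating event has to serve both conditional laws.\<close>

lemma approximation_by_algebra:
  assumes "finite_measure \<mu>" "finite_measure \<nu>" and alg: "algebra \<Omega> \<D>"
    and sub: "\<D> \<subseteq> sets \<mu>" "\<D> \<subseteq> sets \<nu>" and sp: "space \<mu> = \<Omega>" "space \<nu> = \<Omega>"
    and A: "A \<in> sigma_sets \<Omega> \<D>" and "\<epsilon> > (0::real)"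
  shows "\<exists>D\<in>\<D>. measure \<mu> ((A - D) \<union> (D - A)) < \<epsilon> \<and> measure \<nu> ((A - D) \<union> (D - A)) < \<epsilon>"
proof -
  interpret \<mu>: finite_measure \<mu> by fact
  interpret \<nu>: finite_measure \<nu> by fact
  interpret algebra \<Omega> \<D> by fact
  have sig: "S \<in> sets \<mu>" "S \<in> sets \<nu>" if "S \<in> sigma_sets \<Omega> \<D>" for S
    using that sets.sigma_sets_subset[OF sub(1)] sets.sigma_sets_subset[OF sub(2)] sp by auto
  show ?thesis using A \<open>\<epsilon> > 0\<close>
  proof (induction arbitrary: \<epsilon>)
    case (Basic a) then show ?case by (intro bexI[of _ a]) auto
  next
    case Empty then show ?case by (intro bexI[of _ "{}"]) auto
  next
    case (Compl a)
    then obtain D where D: "D \<in> \<D>" "measure \<mu> ((a - D) \<union> (D - a)) < \<epsilon>"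
      "measure \<nu> ((a - D) \<union> (D - a)) < \<epsilon>" by blast
    have "a \<subseteq> \<Omega>" "D \<subseteq> \<Omega>" using sig(1)[OF Compl.hyps] D(1) sets.sets_into_space sp(1) sub(1) by blast+
    then have "((\<Omega> - a) - (\<Omega> - D)) \<union> ((\<Omega> - D) - (\<Omega> - a)) = (a - D) \<union> (D - a)" by blast
    with D show ?case by (intro bexI[of _ "\<Omega> - D"]) auto
  next
    case (Union a)
    have "\<forall>i. \<exists>D\<in>\<D>. measure \<mu> ((a i - D) \<union> (D - a i)) < \<epsilon> / 2 * (1/2)^Suc i \<and>
        measure \<nu> ((a i - D) \<union> (D - a i)) < \<epsilon> / 2 * (1/2)^Suc i"
      using Union.prems by (intro allI Union.IH) simp
    then obtain D where D: "\<And>i. D i \<in> \<D>"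
      "\<And>i. measure \<mu> ((a i - D i) \<union> (D i - a i)) < \<epsilon> / 2 * (1/2)^Suc i"
      "\<And>i. measure \<nu> ((a i - D i) \<union> (D i - a i)) < \<epsilon> / 2 * (1/2)^Suc i" by metis
    have fine: "\<forall>\<^sub>F N in sequentially. measure \<kappa> (((\<Union>i. a i) - (\<Union>i<N. D i)) \<union> ((\<Union>i<N. D i) - (\<Union>i. a i))) < \<epsilon>"
      if "finite_measure \<kappa>" and a: "\<And>i. a i \<in> sets \<kappa>" and Ds: "\<And>i. D i \<in> sets \<kappa>"
        and small: "\<And>i. measure \<kappa> ((a i - D i) \<union> (D i - a i)) < \<epsilon> / 2 * (1/2)^Suc i" for \<kappa>
    proof -
      interpret \<kappa>: finite_measure \<kappa> by fact
      note [measurable] = a Ds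
      have "(\<lambda>N. measure \<kappa> ((\<Union>i. a i) - (\<Union>i<N. a i))) \<longlonglongrightarrow> measure \<kappa> (\<Inter>N. (\<Union>i. a i) - (\<Union>i<N. a i))"
        by (rule \<kappa>.finite_Lim_measure_decseq) (auto simp: decseq_def)
      moreover have "(\<Inter>N. (\<Union>i. a i) - (\<Union>i<N. a i)) = {}" by auto
      ultimately have "(\<lambda>N. measure \<kappa> ((\<Union>i. a i) - (\<Union>i<N. a i))) \<longlonglongrightarrow> 0"
        by (simp only: measure_empty)
      from order_tendstoD(2)[OF this, of "\<epsilon>/2"] have "\<forall>\<^sub>F N in sequentially. measure \<kappa> ((\<Union>i. a i) - (\<Union>i<N. a i)) < \<epsilon> / 2"
        using \<open>\<epsilon> > 0\<close> by simp
      then show ?thesis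
      proof (rule eventually_mono)
        fix N assume N: "measure \<kappa> ((\<Union>i. a i) - (\<Union>i<N. a i)) < \<epsilon> / 2"
        have "measure \<kappa> (\<Union>i<N. (a i - D i) \<union> (D i - a i)) \<le> (\<Sum>i<N. measure \<kappa> ((a i - D i) \<union> (D i - a i)))"
          by (rule \<kappa>.finite_measure_subadditive_finite) auto
        also have "\<dots> \<le> (\<Sum>i<N. \<epsilon> / 2 * (1/2)^Suc i)" by (intro sum_mono less_imp_le small)
        also have "\<dots> \<le> \<epsilon> / 2"
        proof -
          have "(\<Sum>i<N. (1/2::real)^Suc i) \<le> 1"
            using sum_le_suminf[OF sums_summable[OF power_half_series], of "{..<N}"]
              sums_unique[OF power_half_series] by auto
          then show ?thesis using \<open>\<epsilon> > 0\<close> unfolding sum_distrib_left[symmetric] by simp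
        qed
        finally have 1: "measure \<kappa> (\<Union>i<N. (a i - D i) \<union> (D i - a i)) \<le> \<epsilon> / 2" .
        have "measure \<kappa> (((\<Union>i. a i) - (\<Union>i<N. D i)) \<union> ((\<Union>i<N. D i) - (\<Union>i. a i)))
          \<le> measure \<kappa> (((\<Union>i. a i) - (\<Union>i<N. a i)) \<union> (\<Union>i<N. (a i - D i) \<union> (D i - a i)))"
          by (rule \<kappa>.finite_measure_mono) auto
        also have "\<dots> \<le> measure \<kappa> ((\<Union>i. a i) - (\<Union>i<N. a i)) + measure \<kappa> (\<Union>i<N. (a i - D i) \<union> (D i - a i))"
          by (rule measure_Un_le) auto
        finally show "measure \<kappa> (((\<Union>i. a i) - (\<Union>i<N. D i)) \<union> ((\<Union>i<N. D i) - (\<Union>i. a i))) < \<epsilon>"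
          using 1 N by simp
      qed
    qed
    have "\<forall>\<^sub>F N in sequentially. measure \<mu> (((\<Union>i. a i) - (\<Union>i<N. D i)) \<union> ((\<Union>i<N. D i) - (\<Union>i. a i))) < \<epsilon>
       \<and> measure \<nu> (((\<Union>i. a i) - (\<Union>i<N. D i)) \<union> ((\<Union>i<N. D i) - (\<Union>i. a i))) < \<epsilon>"
      by (intro eventually_conj fine \<mu>.finite_measure_axioms \<nu>.finite_measure_axioms D
            subsetD[OF sub(1)] subsetD[OF sub(2)] sig Union.hyps)
    then obtain N where "measure \<mu> (((\<Union>i. a i) - (\<Union>i<N. D i)) \<union> ((\<Union>i<N. D i) - (\<Union>i. a i))) < \<epsilon>
       \<and> measure \<nu> (((\<Union>i. a i) - (\<Union>i<N. D i)) \<union> ((\<Union>i<N. D i) - (\<Union>i. a i))) < \<epsilon>"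
      by (auto simp: eventually_sequentially)
    then show ?case using D(1) by (intro bexI[of _ "\<Union>i<N. D i"]) auto
  qed
qed

primrec algebra_stage :: "nat \<Rightarrow> 'a set set \<Rightarrow> 'a set set" where
  "algebra_stage 0 G = insert {} G"
| "algebra_stage (Suc n) G = algebra_stage n G \<union> uminus ` algebra_stage n G \<union>
     (\<lambda>(A, B). A \<union> B) ` (algebra_stage n G \<times> algebra_stage n G)"

text \<open>Events from a countable algebra can be enumerated, so that the first one with a required property
is a measurable choice.\<close>

lemma countable_generated_algebra:
  fixes G :: "'a set set"
  assumes "countable G"
  obtains \<D> where "countable \<D>" "algebra UNIV \<D>" "sigma_sets UNIV \<D> = sigma_sets UNIV G"
proof
  let ?D = "\<Union>n. algebra_stage n G"
  have "countable (algebra_stage n G)" for n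
    using assms by (induction n) auto
  then show "countable ?D" by auto
  have step: "algebra_stage m G \<subseteq> algebra_stage n G" if "m \<le> n" for m n
    using that by (rule lift_Suc_mono_le[of "\<lambda>n. algebra_stage n G", rotated]) auto
  show "algebra UNIV ?D"
  proof (subst algebra_iff_Un, intro conjI ballI)
    show "{} \<in> ?D" by (auto intro!: exI[of _ 0])
    fix a assume "a \<in> ?D"
    then obtain m where m: "a \<in> algebra_stage m G" by auto
    then have "- a \<in> algebra_stage (Suc m) G" by auto
    then show "UNIV - a \<in> ?D" unfolding Compl_eq_Diff_UNIV[symmetric] by blast
    fix b assume "b \<in> ?D"
    then obtain n where n: "b \<in> algebra_stage n G" by auto
    have "a \<in> algebra_stage (max m n) G" "b \<in> algebra_stage (max m n) G"
      using m n step[of m "max m n"] step[of n "max m n"] by auto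
    then have "a \<union> b \<in> algebra_stage (Suc (max m n)) G" by auto
    then show "a \<union> b \<in> ?D" by blast
  qed auto
  have "algebra_stage n G \<subseteq> sigma_sets UNIV G" for n
  proof (induction n)
    case (Suc n)
    then show ?case
      by (auto simp: Compl_eq_Diff_UNIV intro: sigma_sets.Compl sigma_sets_Un)
  qed (auto intro: sigma_sets.Empty)
  then have "sigma_sets UNIV ?D \<subseteq> sigma_sets UNIV G"
    by (intro sigma_sets_mono) auto
  moreover have "G \<subseteq> ?D" by (auto intro!: exI[of _ 0])
  ultimately show "sigma_sets UNIV ?D = sigma_sets UNIV G"
    using sigma_sets_subseteq[of G ?D UNIV] by (simp only: set_eq_subset simp_thms)
qed

lemma countable_algebra_generating_FZ:
  obtains \<D> :: "(int \<Rightarrow> 'g::polish_space \<times> 'f::polish_space) set set"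
  where "countable \<D>" "algebra UNIV \<D>" "sigma_sets UNIV \<D> = sets (FZ I)"
proof -
  obtain B :: "'g set set" where B: "countable B" "topological_basis B"
    using ex_countable_basis by auto
  let ?G = "(\<lambda>(k, U). (\<lambda>\<omega>. Zpath \<omega> k) -` U) ` (I \<times> B) :: (int \<Rightarrow> 'g \<times> 'f) set set"
  have "countable ?G" using B by auto
  then obtain \<D> where \<D>: "countable \<D>" "algebra UNIV \<D>" "sigma_sets UNIV \<D> = sigma_sets UNIV ?G"
    by (rule countable_generated_algebra)
  have "(\<lambda>x. x) \<in> sigma UNIV ?G \<rightarrow>\<^sub>M (coord_field I {} :: (int \<Rightarrow> 'g \<times> 'f) measure)"
  proof (rule measurable_into_coord_field)
    fix k assume "k \<in> I"
    then show "(\<lambda>x. Zpath x k) \<in> borel_measurable (sigma UNIV ?G)"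
      unfolding borel_eq_countable_basis[OF B]
      by (intro measurable_measure_of) (auto simp: space_measure_of_conv intro!: sigma_sets.Basic)
  qed auto
  then have "sets (FZ I :: (int \<Rightarrow> 'g \<times> 'f) measure) \<subseteq> sigma_sets UNIV ?G"
    unfolding FZ_eq_coord_field by (auto dest: measurable_sets simp: space_measure_of_conv)
  moreover have "?G \<subseteq> sets (FZ I)"
  proof clarsimp
    fix k U assume "k \<in> I" "U \<in> B"
    then have "U \<in> sets borel" using topological_basis_open[OF B(2)] by auto
    then show "(\<lambda>\<omega>. Zpath \<omega> k) -` U \<in> sets (FZ I :: (int \<Rightarrow> 'g \<times> 'f) measure)"
      using measurable_sets[OF measurable_coord_field_Z[OF \<open>k \<in> I\<close>, of "{}"], of U]
      by (simp add: FZ_eq_coord_field)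
  qed
  then have "sigma_sets UNIV ?G \<subseteq> sets (FZ I)"
    using sets.sigma_sets_subset[of ?G "FZ I"] by (simp add: FZ_eq_coord_field)
  ultimately show thesis using \<D> by (intro that) auto
qed

section \<open>Conditional distributions\<close>

text \<open>Passing to nonnegative conditional expectations allows countable sums of test functions without
integrability conditions.\<close>

lemma regular_cond_distr_nn_cond_exp:
  assumes "prob_space P" and sub: "subalgebra P \<G>" and X: "X \<in> P \<rightarrow>\<^sub>M N"
    and \<kappa>: "regular_cond_distr P \<G> X N \<kappa>" and C: "C \<in> sets N"
  shows "AE \<omega> in P. emeasure (\<kappa> \<omega>) C = nn_cond_exp P \<G> (indicator (X -` C \<inter> space P)) \<omega>"
proof -
  interpret prob_space P by fact
  interpret finite_measure_subalgebra P \<G> by unfold_locales fact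
  have \<kappa>m [measurable]: "\<kappa> \<in> \<G> \<rightarrow>\<^sub>M prob_algebra N" and
    \<kappa>e: "AE \<omega> in P. measure (\<kappa> \<omega>) C = real_cond_exp P \<G> (indicator (X -` C \<inter> space P)) \<omega>"
    using \<kappa> C by (auto simp: regular_cond_distr_def)
  have pr: "prob_space (\<kappa> \<omega>)" if "\<omega> \<in> space P" for \<omega>
    using measurable_space[OF \<kappa>m, of \<omega>] that sub by (auto simp: space_prob_algebra subalgebra_def)
  let ?X = "X -` C \<inter> space P"
  have [measurable]: "?X \<in> sets P" using X C by auto
  have em [measurable]: "(\<lambda>\<omega>. emeasure (\<kappa> \<omega>) C) \<in> borel_measurable \<G>"
    using C by (intro measurable_compose[OF measurable_prob_algebraD[OF \<kappa>m]]) measurable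
  show ?thesis
  proof (rule nn_cond_exp_charact)
    fix A assume A: "A \<in> sets \<G>"
    then have [measurable]: "A \<in> sets P" using sub by (auto simp: subalgebra_def)
    have ind: "integrable P (indicator ?X :: _ \<Rightarrow> real)" by (simp add: emeasure_eq_measure)
    have "(\<integral>\<^sup>+ x\<in>A. emeasure (\<kappa> x) C \<partial>P) = (\<integral>\<^sup>+ x. ennreal (indicator A x * real_cond_exp P \<G> (indicator ?X) x) \<partial>P)"
    proof (rule nn_integral_cong_AE)
      show "AE x in P. emeasure (\<kappa> x) C * indicator A x = ennreal (indicator A x * real_cond_exp P \<G> (indicator ?X) x)"
        using \<kappa>e
      proof eventually_elim
        case (elim x)
        show ?case
        proof (cases "x \<in> A")
          case True
          then have "x \<in> space P" using sets.sets_into_space[of A P] by auto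
          interpret K: prob_space "\<kappa> x" by (rule pr) fact
          show ?thesis using True elim by (simp add: K.emeasure_eq_measure)
        qed simp
      qed
    qed
    also have "\<dots> = ennreal (\<integral>x. indicator A x * real_cond_exp P \<G> (indicator ?X) x \<partial>P)"
    proof (rule nn_integral_eq_integral)
      show "integrable P (\<lambda>x. indicator A x * real_cond_exp P \<G> (indicator ?X) x)"
        using integrable_mult_indicator[OF \<open>A \<in> sets P\<close> real_cond_exp_int(1)[OF ind]] by simp
      show "AE x in P. 0 \<le> indicator A x * real_cond_exp P \<G> (indicator ?X) x"
        using \<kappa>e by eventually_elim (metis indicator_pos_le measure_nonneg mult_nonneg_nonneg)
    qed
    also have "\<dots> = ennreal (\<integral>x. indicator A x * indicator ?X x \<partial>P)"
      using real_cond_exp_intA[OF ind A] by (simp add: set_lebesgue_integral_def)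
    also have "\<dots> = (\<integral>\<^sup>+ x. ennreal (indicator A x * indicator ?X x) \<partial>P)"
      by (rule nn_integral_eq_integral[symmetric])
        (use integrable_mult_indicator[OF \<open>A \<in> sets P\<close> ind] in auto)
    also have "\<dots> = (\<integral>\<^sup>+ x\<in>A. indicator ?X x \<partial>P)"
      by (intro nn_integral_cong) (auto split: split_indicator)
    finally show "(\<integral>\<^sup>+ x\<in>A. indicator ?X x \<partial>P) = (\<integral>\<^sup>+ x\<in>A. emeasure (\<kappa> x) C \<partial>P)" by simp
  qed auto
qed

lemma nn_integral_regular_cond_distr:
  assumes P: "prob_space P" and sub: "subalgebra P \<G>" and X: "X \<in> P \<rightarrow>\<^sub>M N"
    and \<kappa>: "regular_cond_distr P \<G> X N \<kappa>" and C: "C \<in> sets N"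
    and f: "f \<in> borel_measurable \<G>"
  shows "(\<integral>\<^sup>+\<omega>. f \<omega> * emeasure (\<kappa> \<omega>) C \<partial>P) = (\<integral>\<^sup>+\<omega>. f \<omega> * indicator C (X \<omega>) \<partial>P)"
proof -
  interpret prob_space P by fact
  interpret finite_measure_subalgebra P \<G> by unfold_locales fact
  have [measurable]: "X -` C \<inter> space P \<in> sets P" using X C by auto
  have "(\<integral>\<^sup>+\<omega>. f \<omega> * emeasure (\<kappa> \<omega>) C \<partial>P) =
      (\<integral>\<^sup>+\<omega>. f \<omega> * nn_cond_exp P \<G> (indicator (X -` C \<inter> space P)) \<omega> \<partial>P)"
    by (rule nn_integral_cong_AE)
      (use regular_cond_distr_nn_cond_exp[OF assms(1-5)] in \<open>eventually_elim, simp\<close>)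
  also have "\<dots> = (\<integral>\<^sup>+\<omega>. f \<omega> * indicator (X -` C \<inter> space P) \<omega> \<partial>P)"
    by (rule nn_cond_exp_intg[OF f]) simp
  also have "\<dots> = (\<integral>\<^sup>+\<omega>. f \<omega> * indicator C (X \<omega>) \<partial>P)"
    by (intro nn_integral_cong) (auto split: split_indicator)
  finally show ?thesis .
qed

text \<open>The identity is the defining property of \<open>\<kappa>\<close> on rectangles, and both sides are finite measures
in \<open>S\<close>.\<close>

lemma regular_cond_distr_disintegration:
  assumes P: "prob_space P" and sub: "subalgebra P \<G>" and X: "X \<in> P \<rightarrow>\<^sub>M N"
    and \<kappa>: "regular_cond_distr P \<G> X N \<kappa>" and S: "S \<in> sets (\<G> \<Otimes>\<^sub>M N)"
  shows "(\<integral>\<^sup>+\<omega>. emeasure (\<kappa> \<omega>) (Pair \<omega> -` S) \<partial>P) = emeasure P {\<omega> \<in> space P. (\<omega>, X \<omega>) \<in> S}"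
proof -
  interpret prob_space P by fact
  have spG: "space \<G> = space P" using sub by (auto simp: subalgebra_def)
  have \<kappa>m [measurable]: "\<kappa> \<in> \<G> \<rightarrow>\<^sub>M prob_algebra N" using \<kappa> by (auto simp: regular_cond_distr_def)
  have \<kappa>s: "sets (\<kappa> \<omega>) = sets N" "prob_space (\<kappa> \<omega>)" if "\<omega> \<in> space P" for \<omega>
    using measurable_space[OF \<kappa>m, of \<omega>] that spG by (auto simp: space_prob_algebra)
  have pair [measurable]: "(\<lambda>\<omega>. (\<omega>, X \<omega>)) \<in> P \<rightarrow>\<^sub>M \<G> \<Otimes>\<^sub>M N"
    using X measurable_from_subalg[OF sub measurable_ident] by (intro measurable_Pair) (auto simp: id_def)
  have sec: "Pair \<omega> -` T \<in> sets N" if "T \<in> sets (\<G> \<Otimes>\<^sub>M N)" for T \<omega>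
    using that by (rule sets_Pair1)
  have mT: "(\<lambda>\<omega>. emeasure (\<kappa> \<omega>) (Pair \<omega> -` T)) \<in> borel_measurable P"
    if T: "T \<in> sets (\<G> \<Otimes>\<^sub>M N)" for T
  proof (rule measurable_from_subalg[OF sub])
    have "(SIGMA x:space \<G>. Pair x -` T) = T"
      using sets.sets_into_space[OF T] by (auto simp: space_pair_measure)
    then show "(\<lambda>\<omega>. emeasure (\<kappa> \<omega>) (Pair \<omega> -` T)) \<in> borel_measurable \<G>"
      using T by (intro emeasure_measurable_subprob_algebra2[OF _ measurable_prob_algebraD[OF \<kappa>m]]) simp
  qed
  have gen: "sets (\<G> \<Otimes>\<^sub>M N) = sigma_sets (space \<G> \<times> space N) {a \<times> b | a b. a \<in> sets \<G> \<and> b \<in> sets N}"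
    by (rule sets_pair_measure)
  show ?thesis using S unfolding gen
  proof (induction rule: sigma_sets_induct_disjoint[OF Int_stable_pair_measure_generator pair_measure_closed,
      consumes 1, case_names 1 2 3 4])
    case (1 A)
    then obtain a b where ab: "A = a \<times> b" "a \<in> sets \<G>" "b \<in> sets N" by auto
    have [measurable]: "a \<in> sets P" using ab sub by (auto simp: subalgebra_def)
    have [measurable]: "b \<in> sets N" "X \<in> P \<rightarrow>\<^sub>M N" by fact+
    have "(\<integral>\<^sup>+\<omega>. emeasure (\<kappa> \<omega>) (Pair \<omega> -` A) \<partial>P) = (\<integral>\<^sup>+\<omega>. indicator a \<omega> * emeasure (\<kappa> \<omega>) b \<partial>P)"
      by (intro nn_integral_cong) (auto simp: ab split: split_indicator)
    also have "\<dots> = (\<integral>\<^sup>+\<omega>. indicator a \<omega> * indicator b (X \<omega>) \<partial>P)"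
      using ab by (intro nn_integral_regular_cond_distr[OF P sub X \<kappa>]) auto
    also have "\<dots> = (\<integral>\<^sup>+\<omega>. indicator {\<omega> \<in> space P. (\<omega>, X \<omega>) \<in> A} \<omega> \<partial>P)"
      by (intro nn_integral_cong) (auto simp: ab split: split_indicator)
    also have "\<dots> = emeasure P {\<omega> \<in> space P. (\<omega>, X \<omega>) \<in> A}"
      unfolding ab by (rule nn_integral_indicator) measurable
    finally show ?case .
  next
    case 2 show ?case by simp
  next
    case (3 A)
    then have A: "A \<in> sets (\<G> \<Otimes>\<^sub>M N)" by (simp add: gen)
    have top: "space \<G> \<times> space N - A \<in> sets (\<G> \<Otimes>\<^sub>M N)"
      using A by (metis sets.compl_sets space_pair_measure)
    have "(\<integral>\<^sup>+\<omega>. emeasure (\<kappa> \<omega>) (Pair \<omega> -` (space \<G> \<times> space N - A)) \<partial>P)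
       = (\<integral>\<^sup>+\<omega>. 1 - emeasure (\<kappa> \<omega>) (Pair \<omega> -` A) \<partial>P)"
    proof (rule nn_integral_cong)
      fix \<omega> assume \<omega>: "\<omega> \<in> space P"
      interpret K: prob_space "\<kappa> \<omega>" by (rule \<kappa>s(2)[OF \<omega>])
      have "Pair \<omega> -` (space \<G> \<times> space N - A) = space (\<kappa> \<omega>) - Pair \<omega> -` A"
        using \<omega> spG sets_eq_imp_space_eq[OF \<kappa>s(1)[OF \<omega>]] by auto
      then show "emeasure (\<kappa> \<omega>) (Pair \<omega> -` (space \<G> \<times> space N - A)) = 1 - emeasure (\<kappa> \<omega>) (Pair \<omega> -` A)"
        using sec[OF A, of \<omega>] \<kappa>s(1)[OF \<omega>] K.emeasure_space_1
        by (simp add: emeasure_compl K.emeasure_finite)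
    qed
    also have "\<dots> = (\<integral>\<^sup>+\<omega>. 1 \<partial>P) - (\<integral>\<^sup>+\<omega>. emeasure (\<kappa> \<omega>) (Pair \<omega> -` A) \<partial>P)"
    proof (rule nn_integral_diff)
      show "AE \<omega> in P. emeasure (\<kappa> \<omega>) (Pair \<omega> -` A) \<le> 1"
        by (rule AE_I2) (metis \<kappa>s(2) prob_space.measure_le_1)
    qed (use mT[OF A] 3 in \<open>auto simp: emeasure_eq_measure\<close>)
    also have "\<dots> = emeasure P (space P) - emeasure P {\<omega> \<in> space P. (\<omega>, X \<omega>) \<in> A}"
      using 3 by simp
    also have "\<dots> = emeasure P (space P - {\<omega> \<in> space P. (\<omega>, X \<omega>) \<in> A})"
      using measurable_sets[OF pair A] by (intro emeasure_compl[symmetric]) (auto simp: vimage_def Int_def conj_commute)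
    also have "space P - {\<omega> \<in> space P. (\<omega>, X \<omega>) \<in> A} = {\<omega> \<in> space P. (\<omega>, X \<omega>) \<in> space \<G> \<times> space N - A}"
      using spG measurable_space[OF X] by auto
    finally show ?case .
  next
    case (4 A)
    have A: "A i \<in> sets (\<G> \<Otimes>\<^sub>M N)" for i using 4 by (auto simp: gen)
    have "(\<integral>\<^sup>+\<omega>. emeasure (\<kappa> \<omega>) (Pair \<omega> -` (\<Union>i. A i)) \<partial>P)
      = (\<integral>\<^sup>+\<omega>. (\<Sum>i. emeasure (\<kappa> \<omega>) (Pair \<omega> -` A i)) \<partial>P)"
    proof (rule nn_integral_cong)
      fix \<omega> assume \<omega>: "\<omega> \<in> space P"
      show "emeasure (\<kappa> \<omega>) (Pair \<omega> -` (\<Union>i. A i)) = (\<Sum>i. emeasure (\<kappa> \<omega>) (Pair \<omega> -` A i))"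
        unfolding vimage_UN using 4 sec[OF A] \<kappa>s(1)[OF \<omega>]
        by (intro suminf_emeasure[symmetric]) (auto simp: disjoint_family_on_def)
    qed
    also have "\<dots> = (\<Sum>i. \<integral>\<^sup>+\<omega>. emeasure (\<kappa> \<omega>) (Pair \<omega> -` A i) \<partial>P)"
      using mT[OF A] by (rule nn_integral_suminf)
    also have "\<dots> = (\<Sum>i. emeasure P {\<omega> \<in> space P. (\<omega>, X \<omega>) \<in> A i})"
      using 4 by simp
    also have "\<dots> = emeasure P (\<Union>i. {\<omega> \<in> space P. (\<omega>, X \<omega>) \<in> A i})"
      using measurable_sets[OF pair A] 4
      by (intro suminf_emeasure) (auto simp: vimage_def Int_def conj_commute disjoint_family_on_def)
    also have "(\<Union>i. {\<omega> \<in> space P. (\<omega>, X \<omega>) \<in> A i}) = {\<omega> \<in> space P. (\<omega>, X \<omega>) \<in> (\<Union>i. A i)}" by auto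
    finally show ?case .
  qed
qed

lemma nn_cond_exp_le_1:
  assumes "prob_space P" "subalgebra P \<G>" and [measurable]: "f \<in> borel_measurable P"
    and "\<And>\<omega>. f \<omega> \<le> 1"
  shows "AE \<omega> in P. nn_cond_exp P \<G> f \<omega> \<le> 1"
proof -
  interpret prob_space P by fact
  interpret finite_measure_subalgebra P \<G> by unfold_locales fact
  have "AE \<omega> in P. nn_cond_exp P \<G> f \<omega> \<le> nn_cond_exp P \<G> (\<lambda>_. 1) \<omega>"
    by (rule nn_cond_exp_mono) (use assms(4) in auto)
  moreover have "AE \<omega> in P. 1 = nn_cond_exp P \<G> (\<lambda>_. 1) \<omega>"
    by (rule nn_cond_exp_F_meas) simp
  ultimately show ?thesis by eventually_elim simp
qed

section \<open>Decoupling the past from the remote future\<close>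

definition glue :: "(int \<Rightarrow> 'a) \<Rightarrow> (int \<Rightarrow> 'a) \<Rightarrow> int \<Rightarrow> 'a" where
  "glue \<omega> \<omega>' = (\<lambda>j. if j \<le> 0 then \<omega> j else \<omega>' j)"

definition decoupled :: "(int \<Rightarrow> 'a::topological_space) measure \<Rightarrow> (int \<Rightarrow> 'a) measure" where
  "decoupled P = distr (P \<Otimes>\<^sub>M P) borel (\<lambda>(\<omega>, \<omega>'). glue \<omega> \<omega>')"

abbreviation outside :: "nat \<Rightarrow> int set" where
  "outside n \<equiv> {..0} \<union> {int n..}"

lemma path_glue:
  "Zpath (glue \<omega> \<omega>') k = (if k \<le> 0 then Zpath \<omega> k else Zpath \<omega>' k)"
  "Ypath (glue \<omega> \<omega>') k = (if k \<le> 0 then Ypath \<omega> k else Ypath \<omega>' k)"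
  by (auto simp: Zpath_def Ypath_def glue_def)

lemma measurable_glue:
  "(\<lambda>(\<omega>, \<omega>'). glue \<omega> \<omega>') \<in> borel \<Otimes>\<^sub>M borel \<rightarrow>\<^sub>M
     (borel :: (int \<Rightarrow> 'g::polish_space \<times> 'f::polish_space) measure)"
  unfolding case_prod_beta
proof (rule measurable_into_path)
  fix k
  show "(\<lambda>x. Zpath (glue (fst x) (snd x)) k) \<in> borel_measurable (borel \<Otimes>\<^sub>M (borel :: (int \<Rightarrow> 'g \<times> 'f) measure))"
    unfolding path_glue by (cases "k \<le> 0") auto
  show "(\<lambda>x. Ypath (glue (fst x) (snd x)) k) \<in> borel_measurable (borel \<Otimes>\<^sub>M (borel :: (int \<Rightarrow> 'g \<times> 'f) measure))"
    unfolding path_glue by (cases "k \<le> 0") auto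
qed

lemma prob_space_decoupled:
  fixes P :: "(int \<Rightarrow> 'g::polish_space \<times> 'f::polish_space) measure"
  assumes "prob_space P" "sets P = sets borel"
  shows "prob_space (decoupled P)"
proof -
  interpret prob_space P by fact
  interpret pair_prob_space P P ..
  note assms(2)[measurable_cong]
  show ?thesis unfolding decoupled_def
    by (rule prob_space_distr) (use measurable_glue in measurable)
qed

text \<open>Absolute regularity compares the law of the pair of one-sided sequences with the product of its
marginals. An event that ignores the gap is the preimage of an event about such pairs, and gluing
two independent copies of the path realises the product law.\<close>

lemma decoupled_close:
  fixes P :: "(int \<Rightarrow> 'g::polish_space \<times> 'f::polish_space) measure"
  assumes "prob_space P" and sets: "sets P = sets borel" and reg: "absolutely_regular P" and "\<tau> > 0"
  obtains n :: nat where "n \<ge> 2"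
    "\<And>S. S \<in> sets (coord_field (outside n) (outside n)) \<Longrightarrow> \<bar>measure P S - measure (decoupled P) S\<bar> \<le> \<tau>"
proof -
  interpret prob_space P by fact
  interpret pair_prob_space P P ..
  note sets[measurable_cong]
  have spP: "space P = UNIV" using sets_eq_imp_space_eq[OF sets] by simp
  let ?Past = "\<Pi>\<^sub>M j\<in>{..0::int}. (borel :: ('g \<times> 'f) measure)"
  let ?Fut = "\<lambda>n. \<Pi>\<^sub>M j\<in>{int n..}. (borel :: ('g \<times> 'f) measure)"
  let ?g = "\<lambda>n \<omega>. (restrict \<omega> {..0}, restrict \<omega> {int n..})"
  let ?\<mu> = "\<lambda>n. distr P (?Past \<Otimes>\<^sub>M ?Fut n) (?g n)"
  let ?\<nu> = "\<lambda>n. distr P ?Past (\<lambda>\<omega>. restrict \<omega> {..0}) \<Otimes>\<^sub>M distr P (?Fut n) (\<lambda>\<omega>. restrict \<omega> {int n..})"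
  have "\<forall>\<^sub>F n in sequentially. tv_norm (sets (?Past \<Otimes>\<^sub>M ?Fut n)) (?\<mu> n) (?\<nu> n) < \<tau> \<and> 2 \<le> n"
    using reg \<open>\<tau> > 0\<close> unfolding absolutely_regular_def Let_def
    by (intro eventually_conj order_tendstoD(2) eventually_ge_at_top) auto
  then obtain n where tv: "tv_norm (sets (?Past \<Otimes>\<^sub>M ?Fut n)) (?\<mu> n) (?\<nu> n) < \<tau>" and n: "2 \<le> n"
    by (auto simp: eventually_sequentially)
  have rP [measurable]: "(\<lambda>\<omega>. restrict \<omega> I) \<in> P \<rightarrow>\<^sub>M (\<Pi>\<^sub>M j\<in>I. borel)" for I :: "int set"
    by (rule measurable_restrict) measurable
  interpret M: prob_space "?\<mu> n" by (rule prob_space.prob_space_distr[OF assms(1)]) measurable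
  interpret N1: prob_space "distr P ?Past (\<lambda>\<omega>. restrict \<omega> {..0})" by (rule prob_space.prob_space_distr[OF assms(1)]) measurable
  interpret N2: prob_space "distr P (?Fut n) (\<lambda>\<omega>. restrict \<omega> {int n..})" by (rule prob_space.prob_space_distr[OF assms(1)]) measurable
  interpret N: pair_prob_space "distr P ?Past (\<lambda>\<omega>. restrict \<omega> {..0})" "distr P (?Fut n) (\<lambda>\<omega>. restrict \<omega> {int n..})" ..
  have close: "\<bar>measure (?\<mu> n) T - measure (?\<nu> n) T\<bar> \<le> \<tau>" if T: "T \<in> sets (?Past \<Otimes>\<^sub>M ?Fut n)" for T
  proof -
    have "\<bar>measure (?\<mu> n) T - measure (?\<nu> n) T\<bar> \<le> 1" for T
      using M.prob_le_1[of T] N.prob_le_1[of T] measure_nonneg[of "?\<mu> n" T] measure_nonneg[of "?\<nu> n" T]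
      by linarith
    then have bdd: "bdd_above ((\<lambda>T. \<bar>measure (?\<mu> n) T - measure (?\<nu> n) T\<bar>) ` sets (?Past \<Otimes>\<^sub>M ?Fut n))"
      by (intro bdd_aboveI[of _ 1]) blast
    have "\<bar>measure (?\<mu> n) T - measure (?\<nu> n) T\<bar> \<le>
        (SUP T\<in>sets (?Past \<Otimes>\<^sub>M ?Fut n). \<bar>measure (?\<mu> n) T - measure (?\<nu> n) T\<bar>)"
      by (rule cSUP_upper[OF T bdd])
    then show ?thesis using tv unfolding tv_norm_def using abs_ge_zero[of "measure (?\<mu> n) T - measure (?\<nu> n) T"]
      by linarith
  qed
  define h :: "(int \<Rightarrow> 'g \<times> 'f) \<times> (int \<Rightarrow> 'g \<times> 'f) \<Rightarrow> int \<Rightarrow> 'g \<times> 'f"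
    where "h = (\<lambda>(p, q) j. if j \<le> 0 then p j else q j)"
  have h: "h \<in> ?Past \<Otimes>\<^sub>M ?Fut n \<rightarrow>\<^sub>M coord_field (outside n) (outside n)"
  proof (rule measurable_into_coord_field)
    fix k assume k: "k \<in> outside n"
    have c: "(\<lambda>x. h x k) \<in> borel_measurable (?Past \<Otimes>\<^sub>M ?Fut n)"
    proof (cases "k \<le> 0")
      case True
      then have "(\<lambda>x. h x k) = (\<lambda>x. fst x k)" by (auto simp: h_def)
      then show ?thesis using True by simp
    next
      case False
      then have "(\<lambda>x. h x k) = (\<lambda>x. snd x k)" by (auto simp: h_def)
      then show ?thesis using False k by simp
    qed
    show "(\<lambda>x. Zpath (h x) k) \<in> borel_measurable (?Past \<Otimes>\<^sub>M ?Fut n)"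
      unfolding Zpath_def by (rule measurable_compose[OF c borel_measurable_continuous_onI]) (intro continuous_intros)
    show "(\<lambda>x. Ypath (h x) k) \<in> borel_measurable (?Past \<Otimes>\<^sub>M ?Fut n)"
      unfolding Ypath_def by (rule measurable_compose[OF c borel_measurable_continuous_onI]) (intro continuous_intros)
  qed
  show thesis
  proof (rule that[OF n])
    fix S :: "(int \<Rightarrow> 'g \<times> 'f) set"
    assume S: "S \<in> sets (coord_field (outside n) (outside n))"
    then have [measurable]: "S \<in> sets borel" using coord_field_borel by auto
    let ?T = "h -` S \<inter> space (?Past \<Otimes>\<^sub>M ?Fut n)"
    have T: "?T \<in> sets (?Past \<Otimes>\<^sub>M ?Fut n)" using measurable_sets[OF h S] .
    have spg: "(restrict \<omega> {..0}, restrict \<omega>' {int n..}) \<in> space (?Past \<Otimes>\<^sub>M ?Fut n)" for \<omega> \<omega>'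
      by (auto simp: space_pair_measure space_PiM)
    have hS: "h (restrict \<omega> {..0}, restrict \<omega>' {int n..}) \<in> S \<longleftrightarrow> glue \<omega> \<omega>' \<in> S" for \<omega> \<omega>'
      using n by (intro coord_field_agree[OF S]) (auto simp: h_def glue_def Zpath_def Ypath_def)
    have glue_same: "glue \<omega> \<omega> = \<omega>" for \<omega> :: "int \<Rightarrow> 'g \<times> 'f" by (auto simp: glue_def)
    have "measure (?\<mu> n) ?T = measure P (?g n -` ?T \<inter> space P)"
      by (rule measure_distr[OF _ T]) measurable
    also have "?g n -` ?T \<inter> space P = S"
      using hS[of _ _] spg by (auto simp: spP glue_same)
    finally have 1: "measure (?\<mu> n) ?T = measure P S" .
    have "?\<nu> n = distr (P \<Otimes>\<^sub>M P) (?Past \<Otimes>\<^sub>M ?Fut n) (\<lambda>(\<omega>, \<omega>'). (restrict \<omega> {..0}, restrict \<omega>' {int n..}))"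
      by (rule pair_measure_distr) (auto intro: N2.sigma_finite_measure_axioms)
    then have "measure (?\<nu> n) ?T = measure (P \<Otimes>\<^sub>M P)
       ((\<lambda>(\<omega>, \<omega>'). (restrict \<omega> {..0}, restrict \<omega>' {int n..})) -` ?T \<inter> space (P \<Otimes>\<^sub>M P))"
      using T by (simp add: measure_distr)
    also have "(\<lambda>(\<omega>, \<omega>'). (restrict \<omega> {..0}, restrict \<omega>' {int n..})) -` ?T \<inter> space (P \<Otimes>\<^sub>M P)
       = (\<lambda>(\<omega>, \<omega>'). glue \<omega> \<omega>') -` S \<inter> space (P \<Otimes>\<^sub>M P)"
      using hS spg by (auto simp: space_pair_measure)
    also have "measure (P \<Otimes>\<^sub>M P) \<dots> = measure (decoupled P) S"
      unfolding decoupled_def by (rule measure_distr[symmetric]) (use measurable_glue in measurable)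
    finally have 2: "measure (?\<nu> n) ?T = measure (decoupled P) S" .
    show "\<bar>measure P S - measure (decoupled P) S\<bar> \<le> \<tau>"
      using close[OF T] unfolding 1 2 .
  qed
qed

text \<open>Counting the thresholds below \<open>y\<close> recovers \<open>y\<close> up to 1. Integrated, this expresses a function with
values in \<open>[0, 1]\<close> as an average of indicators of its superlevel sets, up to the mesh size.\<close>

lemma count_below:
  fixes y :: real
  assumes "0 \<le> y"
  shows "min y (real N) \<le> (\<Sum>j<N. if real j < y then 1 else 0)"
    and "(\<Sum>j<N. if real j < y then 1 else 0) \<le> min (y + 1) (real N)"
  using assms by (induction N) auto

text \<open>Closeness on sets carries over to the superlevel sets of \<open>h\<close>, hence to their averages, which
approximate the integral of \<open>h\<close>.\<close>

lemma nn_integral_close: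
  assumes M: "prob_space M" and N: "prob_space N" and "subalgebra M \<F>" "subalgebra N \<F>" "\<tau> \<ge> 0"
    and close: "\<And>S. S \<in> sets \<F> \<Longrightarrow> measure M S \<le> measure N S + \<tau>"
    and h [measurable]: "h \<in> borel_measurable \<F>" and h_le: "\<And>x. h x \<le> (1::ennreal)"
  shows "(\<integral>\<^sup>+x. h x \<partial>M) \<le> (\<integral>\<^sup>+x. h x \<partial>N) + ennreal \<tau>"
proof (rule ennreal_le_epsilon)
  interpret M: prob_space M by fact
  interpret N: prob_space N by fact
  fix e :: real assume "e > 0"
  then obtain n where "1 / e < real n" using reals_Archimedean2 by blast
  with \<open>e > 0\<close> have n: "1 \<le> real n * e" "n > 0"
    by (auto simp: field_simps intro: gr0I)
  define r where "r x = enn2real (h x)" for x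
  have hr: "h x = ennreal (r x)" and r: "0 \<le> r x" "r x \<le> 1" for x
    using h_le[of x] by (auto simp: r_def ennreal_enn2real_if top_unique
      intro: enn2real_leI)
  have [measurable]: "r \<in> borel_measurable \<F>" unfolding r_def by measurable
  define S where "S j = {x \<in> space \<F>. real j < real n * r x}" for j
  have S: "S j \<in> sets \<F>" for j unfolding S_def by measurable
  have SM [measurable]: "S j \<in> sets M" "S j \<in> sets N" for j
    using S assms(3,4) by (auto simp: subalgebra_def)
  have [measurable]: "h \<in> borel_measurable M" "h \<in> borel_measurable N"
    using h assms(3,4) measurable_from_subalg by blast+
  have sum_ind: "(\<Sum>j<n. indicator (S j) x) = ennreal (\<Sum>j<n. if real j < real n * r x then 1 else 0)"
    if "x \<in> space \<F>" for x
  proof -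
    have "indicator (S j) x = ennreal (if real j < real n * r x then 1 else 0)" for j
      using that by (auto simp: S_def)
    then show ?thesis by simp
  qed
  have "ennreal n * (\<integral>\<^sup>+x. h x \<partial>M) = (\<integral>\<^sup>+x. ennreal n * h x \<partial>M)"
    by (rule nn_integral_cmult[symmetric]) simp
  also have "\<dots> \<le> (\<integral>\<^sup>+x. (\<Sum>j<n. indicator (S j) x) \<partial>M)"
  proof (rule nn_integral_mono)
    fix x assume "x \<in> space M"
    then have x: "x \<in> space \<F>" using assms(3) by (simp add: subalgebra_def)
    have "real n * r x \<le> (\<Sum>j<n. if real j < real n * r x then 1 else 0)"
      using count_below(1)[of "real n * r x" n] r[of x]
      by (simp add: min_def mult_left_le split: if_splits)
    then show "ennreal n * h x \<le> (\<Sum>j<n. indicator (S j) x)"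
      unfolding sum_ind[OF x] hr by (simp add: ennreal_mult'[symmetric] ennreal_leI)
  qed
  also have "\<dots> = (\<Sum>j<n. emeasure M (S j))" by (simp add: nn_integral_sum)
  also have "\<dots> \<le> (\<Sum>j<n. emeasure N (S j) + ennreal \<tau>)"
    using close[OF S] \<open>\<tau> \<ge> 0\<close>
    by (intro sum_mono) (simp add: M.emeasure_eq_measure N.emeasure_eq_measure ennreal_plus[symmetric] ennreal_leI del: ennreal_plus)
  also have "\<dots> = (\<integral>\<^sup>+x. (\<Sum>j<n. indicator (S j) x) \<partial>N) + ennreal n * ennreal \<tau>"
    by (simp add: nn_integral_sum sum.distrib ennreal_of_nat_eq_real_of_nat)
  also have "(\<integral>\<^sup>+x. (\<Sum>j<n. indicator (S j) x) \<partial>N) \<le> (\<integral>\<^sup>+x. ennreal n * h x + 1 \<partial>N)"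
  proof (rule nn_integral_mono)
    fix x assume "x \<in> space N"
    then have x: "x \<in> space \<F>" using assms(4) by (simp add: subalgebra_def)
    have "(\<Sum>j<n. if real j < real n * r x then 1 else 0) \<le> real n * r x + 1"
      using count_below(2)[of "real n * r x" n] r[of x] by simp
    then have "ennreal (\<Sum>j<n. if real j < real n * r x then 1 else 0) \<le> ennreal (real n * r x + 1)"
      by (rule ennreal_leI)
    then show "(\<Sum>j<n. indicator (S j) x) \<le> ennreal n * h x + 1"
      unfolding sum_ind[OF x] hr using r[of x] by (simp add: ennreal_mult)
  qed
  also have "(\<integral>\<^sup>+x. ennreal n * h x + 1 \<partial>N) = ennreal n * (\<integral>\<^sup>+x. h x \<partial>N) + 1"
    by (simp add: nn_integral_add nn_integral_cmult N.emeasure_space_1)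
  finally have "ennreal n * (\<integral>\<^sup>+x. h x \<partial>M) \<le> ennreal n * (\<integral>\<^sup>+x. h x \<partial>N) + 1 + ennreal n * ennreal \<tau>"
    by simp
  also have "\<dots> \<le> ennreal n * (\<integral>\<^sup>+x. h x \<partial>N) + ennreal n * ennreal e + ennreal n * ennreal \<tau>"
    using n(1) \<open>e > 0\<close> by (intro add_mono order_refl) (simp add: ennreal_mult[symmetric])
  also have "\<dots> = ennreal n * ((\<integral>\<^sup>+x. h x \<partial>N) + ennreal \<tau> + ennreal e)"
    by (simp add: distrib_left ac_simps)
  finally show "(\<integral>\<^sup>+x. h x \<partial>M) \<le> (\<integral>\<^sup>+x. h x \<partial>N) + ennreal \<tau> + ennreal e"
    using n(2) by (subst (asm) ennreal_mult_le_mult_iff) (auto simp: ennreal_of_nat_eq_real_of_nat[symmetric])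
qed

text \<open>Truncating at 1 changes the conditional probability only on a null set of \<open>P\<close>. The pointwise
bound is needed because integrals are also taken under \<open>decoupled P\<close>, which need not be absolutely
continuous with respect to \<open>P\<close>.\<close>

definition future_prob ::
  "(int \<Rightarrow> 'g::polish_space \<times> 'f::polish_space) measure \<Rightarrow> nat \<Rightarrow> (int \<Rightarrow> 'g \<times> 'f) set \<Rightarrow> (int \<Rightarrow> 'g \<times> 'f) \<Rightarrow> ennreal"
  where "future_prob P n D \<omega> = min 1 (nn_cond_exp P (FY {int n..}) (indicator D) \<omega>)"

lemma future_prob_le_1: "future_prob P n D \<omega> \<le> 1"
  by (simp add: future_prob_def)

lemma measurable_future_prob: "future_prob P n D \<in> borel_measurable (FY {int n..})"
  unfolding future_prob_def by measurable

lemma future_prob_eq: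
  assumes "prob_space P" "sets P = sets borel" "D \<in> sets borel"
  shows "AE \<omega> in P. future_prob P n D \<omega> = nn_cond_exp P (FY {int n..}) (indicator D) \<omega>"
proof -
  have "AE \<omega> in P. nn_cond_exp P (FY {int n..}) (indicator D) \<omega> \<le> 1"
    using assms by (intro nn_cond_exp_le_1)
      (auto simp: FY_eq_coord_field subalgebra_coord_field measurable_cong_sets[OF assms(2) refl] split: split_indicator)
  then show ?thesis by eventually_elim (simp add: future_prob_def min_def)
qed

text \<open>Once the copy that supplies the past is fixed, \<open>b\<close> is a function of the observations from time \<open>n\<close>
on of the other copy. The identity is then the definition of the conditional probability of \<open>D\<close>.\<close>

lemma decoupled_future_prob:
  fixes P :: "(int \<Rightarrow> 'g::polish_space \<times> 'f::polish_space) measure"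
  assumes "prob_space P" and sets: "sets P = sets borel" and n: "n \<ge> 1"
    and D: "D \<in> sets (FZ {int n..})"
    and b: "b \<in> borel_measurable (coord_field {..0} (outside n))"
  shows "(\<integral>\<^sup>+\<omega>. b \<omega> * future_prob P n D \<omega> \<partial>decoupled P) = (\<integral>\<^sup>+\<omega>. b \<omega> * indicator D \<omega> \<partial>decoupled P)"
proof -
  interpret P: prob_space P by fact
  note sets[measurable_cong]
  have sub: "subalgebra P (FY {int n..})"
    unfolding FY_eq_coord_field by (rule subalgebra_coord_field[OF sets])
  interpret finite_measure_subalgebra P "FY {int n..}" by unfold_locales (rule sub)
  note measurable_glue[measurable]
  have [measurable]: "D \<in> sets borel" using D coord_field_borel unfolding FZ_eq_coord_field by auto
  have [measurable]: "b \<in> borel_measurable borel"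
    using b measurable_from_subalg[OF subalgebra_coord_field[OF refl]] by blast
  have [measurable]: "future_prob P n D \<in> borel_measurable borel"
    using measurable_future_prob measurable_from_subalg[OF subalgebra_coord_field[OF refl]]
    unfolding FY_eq_coord_field by blast
  have inner: "(\<integral>\<^sup>+\<omega>'. b (glue \<omega> \<omega>') * future_prob P n D (glue \<omega> \<omega>') \<partial>P)
     = (\<integral>\<^sup>+\<omega>'. b (glue \<omega> \<omega>') * indicator D (glue \<omega> \<omega>') \<partial>P)" for \<omega>
  proof -
    have m: "(\<lambda>\<omega>'. b (glue \<omega> \<omega>')) \<in> borel_measurable (FY {int n..})"
    proof (rule measurable_compose[OF _ b])
      show "glue \<omega> \<in> FY {int n..} \<rightarrow>\<^sub>M coord_field {..0} (outside n)"
        unfolding FY_eq_coord_field using n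
        by (intro measurable_into_coord_field) (auto simp: path_glue intro: measurable_coord_field_Y)
    qed
    have eqd: "future_prob P n D (glue \<omega> \<omega>') = future_prob P n D \<omega>'" for \<omega>'
      using n by (intro coord_field_agree_fun[OF measurable_future_prob[unfolded FY_eq_coord_field]])
        (auto simp: path_glue)
    have eqD: "glue \<omega> \<omega>' \<in> D \<longleftrightarrow> \<omega>' \<in> D" for \<omega>'
      using n by (intro coord_field_agree[OF D[unfolded FZ_eq_coord_field]]) (auto simp: path_glue)
    have "(\<integral>\<^sup>+\<omega>'. b (glue \<omega> \<omega>') * future_prob P n D (glue \<omega> \<omega>') \<partial>P)
      = (\<integral>\<^sup>+\<omega>'. b (glue \<omega> \<omega>') * nn_cond_exp P (FY {int n..}) (indicator D) \<omega>' \<partial>P)"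
      unfolding eqd
      by (rule nn_integral_cong_AE)
        (use future_prob_eq[OF assms(1) sets \<open>D \<in> sets borel\<close>, of n] in \<open>eventually_elim, simp\<close>)
    also have "\<dots> = (\<integral>\<^sup>+\<omega>'. b (glue \<omega> \<omega>') * indicator D \<omega>' \<partial>P)"
      by (rule nn_cond_exp_intg[OF m]) measurable
    also have "\<dots> = (\<integral>\<^sup>+\<omega>'. b (glue \<omega> \<omega>') * indicator D (glue \<omega> \<omega>') \<partial>P)"
      by (simp add: eqD indicator_def)
    finally show ?thesis .
  qed
  have iter: "(\<integral>\<^sup>+\<omega>. f \<omega> \<partial>decoupled P) = (\<integral>\<^sup>+\<omega>. \<integral>\<^sup>+\<omega>'. f (glue \<omega> \<omega>') \<partial>P \<partial>P)"
    if [measurable]: "f \<in> borel_measurable borel" for f :: "_ \<Rightarrow> ennreal"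
  proof -
    have "(\<integral>\<^sup>+\<omega>. f \<omega> \<partial>decoupled P) = (\<integral>\<^sup>+x. f (glue (fst x) (snd x)) \<partial>(P \<Otimes>\<^sub>M P))"
      unfolding decoupled_def by (subst nn_integral_distr) (auto simp: case_prod_beta')
    also have "\<dots> = (\<integral>\<^sup>+\<omega>. \<integral>\<^sup>+\<omega>'. f (glue \<omega> \<omega>') \<partial>P \<partial>P)"
    proof -
      have "(\<lambda>x. f (glue (fst x) (snd x))) \<in> borel_measurable (P \<Otimes>\<^sub>M P)"
        using measurable_compose[OF measurable_glue that] by (simp add: case_prod_beta')
      from P.nn_integral_fst[OF this] show ?thesis by simp
    qed
    finally show ?thesis .
  qed
  show ?thesis by (subst (1 2) iter) (auto simp: inner)
qed

section \<open>Resampling the observations in a gap\<close>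

abbreviation gap_space :: "nat \<Rightarrow> (int \<Rightarrow> 'f::topological_space) measure" where
  "gap_space n \<equiv> \<Pi>\<^sub>M k\<in>{1..int n - 1}. borel"

definition resample :: "nat \<Rightarrow> (int \<Rightarrow> 'g \<times> 'f) \<Rightarrow> (int \<Rightarrow> 'f) \<Rightarrow> int \<Rightarrow> 'g \<times> 'f" where
  "resample n \<omega> m = (\<lambda>j. (fst (\<omega> j), if j \<in> {1..int n - 1} then m j else snd (\<omega> j)))"

text \<open>When \<open>\<kappa>\<close> depends on the observations outside the gap only, the gap becomes conditionally
independent, given these, of the hidden process.\<close>

definition resampled ::
  "nat \<Rightarrow> (int \<Rightarrow> 'g::polish_space \<times> 'f::polish_space) measure \<Rightarrow>
   ((int \<Rightarrow> 'g \<times> 'f) \<Rightarrow> (int \<Rightarrow> 'f) measure) \<Rightarrow> (int \<Rightarrow> 'g \<times> 'f) measure" where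
  "resampled n P \<kappa> = P \<bind> (\<lambda>\<omega>. distr (\<kappa> \<omega>) borel (resample n \<omega>))"

lemma path_resample:
  "Zpath (resample n \<omega> m) k = Zpath \<omega> k"
  "Ypath (resample n \<omega> m) k = (if k \<in> {1..int n - 1} then m k else Ypath \<omega> k)"
  by (auto simp: resample_def Zpath_def Ypath_def)

lemma measurable_resample:
  "(\<lambda>(\<omega>, m). resample n \<omega> m) \<in> coord_field I (outside n) \<Otimes>\<^sub>M gap_space n \<rightarrow>\<^sub>M coord_field I UNIV"
  unfolding case_prod_beta
proof (rule measurable_into_coord_field)
  fix k assume "k \<in> I"
  then show "(\<lambda>x. Zpath (resample n (fst x) (snd x)) k) \<in> borel_measurable (coord_field I (outside n) \<Otimes>\<^sub>M gap_space n)"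
    unfolding path_resample by (intro measurable_compose[OF measurable_fst] measurable_coord_field_Z)
next
  fix k :: int
  show "(\<lambda>x. Ypath (resample n (fst x) (snd x)) k) \<in> borel_measurable (coord_field I (outside n) \<Otimes>\<^sub>M gap_space n)"
  proof (cases "k \<in> {1..int n - 1}")
    case True
    then show ?thesis unfolding path_resample by simp
  next
    case False
    then have "(\<lambda>x. Ypath (fst x) k) \<in> borel_measurable (coord_field I (outside n) \<Otimes>\<^sub>M gap_space n)"
      by (intro measurable_compose[OF measurable_fst] measurable_coord_field_Y) auto
    with False show ?thesis unfolding path_resample by (simp only: if_False)
  qed
qed

lemma measurable_gap:
  "(\<lambda>\<omega>. restrict (Ypath \<omega>) {1..int n - 1}) \<in> (borel :: (int \<Rightarrow> 'g::polish_space \<times> 'f::polish_space) measure) \<rightarrow>\<^sub>M gap_space n"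
  by (rule measurable_restrict) measurable

context
  fixes P :: "(int \<Rightarrow> 'g::polish_space \<times> 'f::polish_space) measure"
    and n :: nat and \<kappa> :: "(int \<Rightarrow> 'g \<times> 'f) \<Rightarrow> (int \<Rightarrow> 'f) measure"
  assumes P: "prob_space P" "sets P = sets borel"
    and \<kappa>: "\<kappa> \<in> coord_field {} (outside n) \<rightarrow>\<^sub>M prob_algebra (gap_space n)"
begin

lemma gap_kernel: "sets (\<kappa> \<omega>) = sets (gap_space n)" "prob_space (\<kappa> \<omega>)"
  using measurable_space[OF \<kappa>, of \<omega>] by (auto simp: space_prob_algebra)

lemma measurable_resampled_kernel:
  "(\<lambda>\<omega>. distr (\<kappa> \<omega>) borel (resample n \<omega>)) \<in> P \<rightarrow>\<^sub>M prob_algebra borel"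
proof (rule measurable_distr_prob_space2)
  show "\<kappa> \<in> P \<rightarrow>\<^sub>M prob_algebra (gap_space n)"
    using measurable_from_subalg[OF subalgebra_coord_field[OF P(2)] \<kappa>] .
  have "(\<lambda>(\<omega>, m). resample n \<omega> m) \<in> coord_field UNIV (outside n) \<Otimes>\<^sub>M gap_space n \<rightarrow>\<^sub>M (borel :: (int \<Rightarrow> 'g \<times> 'f) measure)"
    using measurable_resample[of n UNIV] measurable_cong_sets[OF refl coord_field_UNIV] by blast
  moreover have "(\<lambda>x. x) \<in> P \<Otimes>\<^sub>M gap_space n \<rightarrow>\<^sub>M coord_field UNIV (outside n) \<Otimes>\<^sub>M gap_space n"
    using measurable_from_subalg[OF subalgebra_coord_field[OF P(2)] measurable_ident, of UNIV "outside n"]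
      measurable_compose[OF measurable_fst, of _ P _ "gap_space n"]
    by (intro measurable_pair) (auto simp: id_def comp_def)
  ultimately show "(\<lambda>(\<omega>, m). resample n \<omega> m) \<in> P \<Otimes>\<^sub>M gap_space n \<rightarrow>\<^sub>M borel"
    using measurable_compose by blast
qed

lemma prob_space_resampled: "prob_space (resampled n P \<kappa>)"
  and sets_resampled: "sets (resampled n P \<kappa>) = sets borel"
proof -
  interpret prob_space P by fact
  have "P \<in> space (prob_algebra P)" by (simp add: space_prob_algebra P)
  from prob_space_bind'[OF this measurable_resampled_kernel] sets_bind'[OF this measurable_resampled_kernel]
  show "prob_space (resampled n P \<kappa>)" "sets (resampled n P \<kappa>) = sets borel"
    unfolding resampled_def by auto
qed

lemma resample_section:
  fixes S :: "(int \<Rightarrow> 'g \<times> 'f) set" and \<omega> :: "int \<Rightarrow> 'g \<times> 'f"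
  assumes S: "S \<in> sets borel"
  shows "{m \<in> space (gap_space n). resample n \<omega> m \<in> S} \<in> sets (gap_space n)"
proof -
  have *: "(\<lambda>(\<omega>, m). resample n \<omega> m) \<in> coord_field UNIV (outside n) \<Otimes>\<^sub>M gap_space n \<rightarrow>\<^sub>M (borel :: (int \<Rightarrow> 'g \<times> 'f) measure)"
    using measurable_resample[of n UNIV] measurable_cong_sets[OF refl coord_field_UNIV] by blast
  have "resample n \<omega> \<in> gap_space n \<rightarrow>\<^sub>M borel"
    using measurable_compose[OF measurable_Pair1' *, of \<omega>] by simp
  from measurable_sets[OF this S] show ?thesis
    by (simp add: vimage_def Int_def conj_commute)
qed

lemma emeasure_resampled:
  fixes S :: "(int \<Rightarrow> 'g \<times> 'f) set"
  assumes S: "S \<in> sets borel"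
  shows "emeasure (resampled n P \<kappa>) S =
    (\<integral>\<^sup>+\<omega>. emeasure (\<kappa> \<omega>) {m \<in> space (gap_space n). resample n \<omega> m \<in> S} \<partial>P)"
proof -
  interpret prob_space P by fact
  have "emeasure (resampled n P \<kappa>) S = (\<integral>\<^sup>+\<omega>. emeasure (distr (\<kappa> \<omega>) borel (resample n \<omega>)) S \<partial>P)"
    unfolding resampled_def
    by (rule emeasure_bind[OF not_empty measurable_prob_algebraD[OF measurable_resampled_kernel] S])
  also have "\<dots> = (\<integral>\<^sup>+\<omega>. emeasure (\<kappa> \<omega>) {m \<in> space (gap_space n). resample n \<omega> m \<in> S} \<partial>P)"
  proof (rule nn_integral_cong)
    fix \<omega> :: "int \<Rightarrow> 'g \<times> 'f"
    have *: "(\<lambda>(\<omega>, m). resample n \<omega> m) \<in> coord_field UNIV (outside n) \<Otimes>\<^sub>M gap_space n \<rightarrow>\<^sub>M (borel :: (int \<Rightarrow> 'g \<times> 'f) measure)"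
      using measurable_resample[of n UNIV] measurable_cong_sets[OF refl coord_field_UNIV] by blast
    have "resample n \<omega> \<in> gap_space n \<rightarrow>\<^sub>M borel"
      using measurable_compose[OF measurable_Pair1' *, of \<omega>] by simp
    then have "resample n \<omega> \<in> \<kappa> \<omega> \<rightarrow>\<^sub>M borel"
      using measurable_cong_sets[OF gap_kernel(1) refl] by blast
    then show "emeasure (distr (\<kappa> \<omega>) borel (resample n \<omega>)) S =
        emeasure (\<kappa> \<omega>) {m \<in> space (gap_space n). resample n \<omega> m \<in> S}"
      using S sets_eq_imp_space_eq[OF gap_kernel(1)]
      by (simp add: emeasure_distr vimage_def Int_def conj_commute)
  qed
  finally show ?thesis .
qed

lemma measurable_resample_prob:
  fixes S :: "(int \<Rightarrow> 'g \<times> 'f) set"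
  assumes S: "S \<in> sets (coord_field I UNIV)"
  shows "(\<lambda>\<omega>. emeasure (\<kappa> \<omega>) {m \<in> space (gap_space n). resample n \<omega> m \<in> S})
     \<in> borel_measurable (coord_field I (outside n))"
proof (rule emeasure_measurable_subprob_algebra2)
  show "\<kappa> \<in> coord_field I (outside n) \<rightarrow>\<^sub>M subprob_algebra (gap_space n)"
    by (rule measurable_prob_algebraD[OF measurable_coord_field_mono[OF \<kappa>]]) auto
  show "(SIGMA \<omega>:space (coord_field I (outside n)). {m \<in> space (gap_space n). resample n \<omega> m \<in> S})
      \<in> sets (coord_field I (outside n) \<Otimes>\<^sub>M gap_space n)"
    using measurable_sets[OF measurable_resample S, of n]
    by (auto simp: space_pair_measure vimage_def Int_def Sigma_def elim!: back_subst[of "\<lambda>S. S \<in> sets _"])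
qed

lemma emeasure_resampled_Int:
  fixes S H :: "(int \<Rightarrow> 'g \<times> 'f) set"
  assumes S: "S \<in> sets borel" and H: "H \<in> sets (coord_field UNIV (outside n))"
  shows "emeasure (resampled n P \<kappa>) (S \<inter> H) =
    (\<integral>\<^sup>+\<omega>. emeasure (\<kappa> \<omega>) {m \<in> space (gap_space n). resample n \<omega> m \<in> S} * indicator H \<omega> \<partial>P)"
proof -
  have "H \<in> sets borel" using H coord_field_borel by auto
  then have "emeasure (resampled n P \<kappa>) (S \<inter> H) =
      (\<integral>\<^sup>+\<omega>. emeasure (\<kappa> \<omega>) {m \<in> space (gap_space n). resample n \<omega> m \<in> S \<inter> H} \<partial>P)"
    using S by (intro emeasure_resampled) auto
  also have "\<dots> = (\<integral>\<^sup>+\<omega>. emeasure (\<kappa> \<omega>) {m \<in> space (gap_space n). resample n \<omega> m \<in> S} * indicator H \<omega> \<partial>P)"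
  proof (rule nn_integral_cong)
    fix \<omega> :: "int \<Rightarrow> 'g \<times> 'f"
    have "resample n \<omega> m \<in> H \<longleftrightarrow> \<omega> \<in> H" for m
      by (rule coord_field_agree[OF H]) (auto simp: path_resample)
    then show "emeasure (\<kappa> \<omega>) {m \<in> space (gap_space n). resample n \<omega> m \<in> S \<inter> H} =
        emeasure (\<kappa> \<omega>) {m \<in> space (gap_space n). resample n \<omega> m \<in> S} * indicator H \<omega>"
      by (auto split: split_indicator)
  qed
  finally show ?thesis .
qed

end

text \<open>Resampling from the conditional law given everything outside the gap reproduces \<open>P\<close>, on events
that do not involve the hidden process inside the gap. Nondegeneracy says that this conditional law
is equivalent to the one given the observations alone, so the two resamplings have the same null sets.\<close>

lemma nondegenerate_resampling:
  fixes P :: "(int \<Rightarrow> 'g::polish_space \<times> 'f::polish_space) measure"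
  assumes P: "prob_space P" "sets P = sets borel" and nd: "nondegenerate P" and n: "n \<ge> 2"
  obtains \<kappa>' :: "(int \<Rightarrow> 'g \<times> 'f) \<Rightarrow> (int \<Rightarrow> 'f) measure"
  where "\<kappa>' \<in> coord_field {} (outside n) \<rightarrow>\<^sub>M prob_algebra (gap_space n)"
    and "\<And>S. S \<in> sets (coord_field (outside n) UNIV) \<Longrightarrow>
       emeasure (resampled n P \<kappa>') S = 0 \<longleftrightarrow> emeasure P S = 0"
proof -
  have "1 \<le> int n - 1" using n by simp
  from nd[unfolded nondegenerate_def, rule_format, OF this]
  obtain \<kappa> \<kappa>' where
    \<kappa>: "regular_cond_distr P (coord_field (outside n) (outside n)) (\<lambda>\<omega>. restrict (Ypath \<omega>) {1..int n - 1}) (gap_space n) \<kappa>"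
    and \<kappa>': "regular_cond_distr P (coord_field {} (outside n)) (\<lambda>\<omega>. restrict (Ypath \<omega>) {1..int n - 1}) (gap_space n) \<kappa>'"
    and eqv: "AE \<omega> in P. equivalent_measures (\<kappa> \<omega>) (\<kappa>' \<omega>)"
    by (auto simp: coord_field_joins)
  have m': "\<kappa>' \<in> coord_field {} (outside n) \<rightarrow>\<^sub>M prob_algebra (gap_space n)"
    using \<kappa>' by (simp add: regular_cond_distr_def)
  have m: "\<kappa> \<in> coord_field (outside n) (outside n) \<rightarrow>\<^sub>M prob_algebra (gap_space n)"
    using \<kappa> by (simp add: regular_cond_distr_def)
  have sets\<kappa>: "sets (\<kappa> \<omega>) = sets (gap_space n)" for \<omega>
    using measurable_space[OF m, of \<omega>] by (auto simp: space_prob_algebra)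
  have spP: "space P = UNIV" using sets_eq_imp_space_eq[OF P(2)] by simp
  show thesis
  proof (rule that[OF m'])
    fix S :: "(int \<Rightarrow> 'g \<times> 'f) set"
    assume S: "S \<in> sets (coord_field (outside n) UNIV)"
    then have Sb: "S \<in> sets borel" using coord_field_borel by auto
    let ?sec = "\<lambda>\<omega>. {m \<in> space (gap_space n). resample n \<omega> m \<in> S}"
    let ?T = "(\<lambda>(\<omega>, m). resample n \<omega> m) -` S \<inter> space (coord_field (outside n) (outside n) \<Otimes>\<^sub>M gap_space n)"
    have T: "?T \<in> sets (coord_field (outside n) (outside n) \<Otimes>\<^sub>M gap_space n)"
      by (rule measurable_sets[OF measurable_resample S])
    have X: "(\<lambda>\<omega>. restrict (Ypath \<omega>) {1..int n - 1}) \<in> P \<rightarrow>\<^sub>M gap_space n"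
      using measurable_gap measurable_cong_sets[OF P(2) refl] by blast
    have secT: "Pair \<omega> -` ?T = ?sec \<omega>" for \<omega>
      by (auto simp: space_pair_measure)
    have same: "resample n \<omega> (restrict (Ypath \<omega>) {1..int n - 1}) = \<omega>" for \<omega> :: "int \<Rightarrow> 'g \<times> 'f"
      by (auto simp: resample_def Ypath_def)
    have "{\<omega> \<in> space P. (\<omega>, restrict (Ypath \<omega>) {1..int n - 1}) \<in> ?T} = S"
      using measurable_space[OF X] by (auto simp: spP space_pair_measure same)
    with regular_cond_distr_disintegration[OF P(1) subalgebra_coord_field[OF P(2)] X \<kappa> T]
    have PS: "emeasure P S = (\<integral>\<^sup>+\<omega>. emeasure (\<kappa> \<omega>) (?sec \<omega>) \<partial>P)"
      unfolding secT by simp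
    have sec: "?sec \<omega> \<in> sets (gap_space n)" for \<omega> by (rule resample_section[OF P m' Sb])
    have meas: "(\<lambda>\<omega>. emeasure (\<kappa> \<omega>) (?sec \<omega>)) \<in> borel_measurable P"
      "(\<lambda>\<omega>. emeasure (\<kappa>' \<omega>) (?sec \<omega>)) \<in> borel_measurable P"
    proof -
      have "(SIGMA \<omega>:space (coord_field (outside n) (outside n)). ?sec \<omega>) = ?T"
        by (auto simp: space_pair_measure)
      then have "(\<lambda>\<omega>. emeasure (\<kappa> \<omega>) (?sec \<omega>)) \<in> borel_measurable (coord_field (outside n) (outside n))"
        using T by (intro emeasure_measurable_subprob_algebra2[OF _ measurable_prob_algebraD[OF m]]) simp
      then show "(\<lambda>\<omega>. emeasure (\<kappa> \<omega>) (?sec \<omega>)) \<in> borel_measurable P"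
        by (rule measurable_from_subalg[OF subalgebra_coord_field[OF P(2)]])
      show "(\<lambda>\<omega>. emeasure (\<kappa>' \<omega>) (?sec \<omega>)) \<in> borel_measurable P"
        by (rule measurable_from_subalg[OF subalgebra_coord_field[OF P(2)] measurable_resample_prob[OF P m' S]])
    qed
    have "AE \<omega> in P. emeasure (\<kappa>' \<omega>) (?sec \<omega>) = 0 \<longleftrightarrow> emeasure (\<kappa> \<omega>) (?sec \<omega>) = 0"
      using eqv
    proof eventually_elim
      case (elim \<omega>)
      then have "null_sets (\<kappa> \<omega>) = null_sets (\<kappa>' \<omega>)"
        by (auto simp: equivalent_measures_def absolutely_continuous_def)
      then show ?case
        using sec[of \<omega>] sets\<kappa>[of \<omega>] gap_kernel(1)[OF P m', of \<omega>] by (auto simp: null_sets_def set_eq_iff)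
    qed
    then have "(AE \<omega> in P. emeasure (\<kappa>' \<omega>) (?sec \<omega>) = 0) \<longleftrightarrow> (AE \<omega> in P. emeasure (\<kappa> \<omega>) (?sec \<omega>) = 0)"
      by (auto elim: AE_mp intro: AE_cong)
    then show "emeasure (resampled n P \<kappa>') S = 0 \<longleftrightarrow> emeasure P S = 0"
      unfolding PS emeasure_resampled[OF P m' Sb] using meas by (simp add: nn_integral_0_iff_AE)
  qed
qed

section \<open>Control of the future by its law given the observations\<close>

lemma null_equivalent_linear_bound:
  assumes M: "prob_space M" and N: "prob_space N" and sub: "subalgebra M \<F>" "subalgebra N \<F>"
    and null: "\<And>S. S \<in> sets \<F> \<Longrightarrow> emeasure M S = 0 \<Longrightarrow> emeasure N S = 0" and "\<delta> > (0::real)"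
  obtains c :: real where "c > 0"
    "\<And>S. S \<in> sets \<F> \<Longrightarrow> emeasure N S \<le> ennreal c * emeasure M S + ennreal \<delta>"
proof -
  have fin: "finite_measure (restr_to_subalg M \<F>)" "finite_measure (restr_to_subalg N \<F>)"
    using M N sub by (simp_all add: finite_measure_restr_to_subalg prob_space.finite_measure)
  have sets: "sets (restr_to_subalg N \<F>) = sets (restr_to_subalg M \<F>)"
    using sub by (simp add: sets_restr_to_subalg)
  have ac: "absolutely_continuous (restr_to_subalg M \<F>) (restr_to_subalg N \<F>)"
    using null sub unfolding absolutely_continuous_def
    by (auto simp: null_sets_def sets_restr_to_subalg emeasure_restr_to_subalg)
  obtain c where "c > 0"
    "\<And>S. S \<in> sets (restr_to_subalg M \<F>) \<Longrightarrow>
      emeasure (restr_to_subalg N \<F>) S \<le> ennreal c * emeasure (restr_to_subalg M \<F>) S + ennreal \<delta>"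
    using absolutely_continuous_linear_bound[OF fin sets ac \<open>\<delta> > 0\<close>] by metis
  then show thesis using sub by (intro that[of c]) (auto simp: sets_restr_to_subalg emeasure_restr_to_subalg)
qed

text \<open>The disjoint events \<open>E i\<close> with their partners \<open>D i\<close> encode a future event that is chosen
measurably from the observations and the hidden past. The sum in the conclusion is the probability that
the chosen event occurs when the future is drawn afresh from its law given \<open>Y\<close> from time \<open>n\<close> on.\<close>

definition future_controlled ::
  "(int \<Rightarrow> 'g::polish_space \<times> 'f::polish_space) measure \<Rightarrow> nat \<Rightarrow> real \<Rightarrow> real \<Rightarrow> bool" where
  "future_controlled P n \<epsilon> \<delta> \<longleftrightarrow> (\<forall>E D :: nat \<Rightarrow> (int \<Rightarrow> 'g \<times> 'f) set.
     disjoint_family E \<longrightarrow> (\<forall>i. E i \<in> sets (coord_field {..0} UNIV)) \<longrightarrow> (\<forall>i. D i \<in> sets (FZ {int n..})) \<longrightarrow>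
     emeasure P (\<Union>i. E i \<inter> D i) \<le> ennreal \<epsilon> \<longrightarrow>
     (\<Sum>i. \<integral>\<^sup>+\<omega>. indicator (E i) \<omega> * future_prob P n (D i) \<omega> \<partial>P) \<le> ennreal \<delta>)"

text \<open>With \<open>e i\<close> and \<open>a i\<close> the probabilities of \<open>E i\<close> given the hidden past and the observations
outside the gap, under resampling and under \<open>P\<close>, the integral of \<open>a i\<close> over the event \<open>D i\<close> must
be shown to be small and then exchanged with the integral of \<open>a i * d i\<close>.
Where \<open>a i\<close> is at most a constant times \<open>e i\<close>, the first is bounded by the resampled probability of
\<open>E i \<inter> D i\<close>; the places \<open>H i\<close> where this fails carry little mass, because \<open>P\<close> is dominated by the
resampled law up to a small error. The exchange is legitimate because \<open>a i\<close> does not see the gap.\<close>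

lemma future_controlled_if_regular_nondegenerate:
  fixes P :: "(int \<Rightarrow> 'g::polish_space \<times> 'f::polish_space) measure"
  assumes P: "prob_space P" "sets P = sets borel" and reg: "absolutely_regular P" and nd: "nondegenerate P"
    and "\<delta> > 0"
  obtains n :: nat and \<epsilon> :: real where "\<epsilon> > 0" "future_controlled P n \<epsilon> \<delta>"
proof -
  interpret P: prob_space P by fact
  note P(2)[measurable_cong]
  have spP: "space P = UNIV" using sets_eq_imp_space_eq[OF P(2)] by simp
  obtain n where n: "n \<ge> 2" and close: "\<And>S. S \<in> sets (coord_field (outside n) (outside n)) \<Longrightarrow>
      \<bar>measure P S - measure (decoupled P) S\<bar> \<le> \<delta> / 8"
    using decoupled_close[OF P reg, of "\<delta> / 8"] \<open>\<delta> > 0\<close> by auto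
  obtain \<kappa> where \<kappa>: "\<kappa> \<in> coord_field {} (outside n) \<rightarrow>\<^sub>M prob_algebra (gap_space n)"
    and eqv: "\<And>S. S \<in> sets (coord_field (outside n) UNIV) \<Longrightarrow>
       emeasure (resampled n P \<kappa>) S = 0 \<longleftrightarrow> emeasure P S = 0"
    using nondegenerate_resampling[OF P nd n] by metis
  let ?R = "resampled n P \<kappa>"
  let ?H = "coord_field (outside n) UNIV :: (int \<Rightarrow> 'g \<times> 'f) measure"
  let ?C = "coord_field {..0} (outside n) :: (int \<Rightarrow> 'g \<times> 'f) measure"
  let ?B = "coord_field (outside n) (outside n) :: (int \<Rightarrow> 'g \<times> 'f) measure"
  note R = prob_space_resampled[OF P \<kappa>] sets_resampled[OF P \<kappa>]
  interpret R: prob_space ?R by (rule R(1))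
  obtain c where c: "c > 0" and PR: "\<And>S. S \<in> sets ?H \<Longrightarrow>
      emeasure P S \<le> ennreal c * emeasure ?R S + ennreal (\<delta> / 4)"
    using null_equivalent_linear_bound[OF R(1) P(1) subalgebra_coord_field[OF R(2)] subalgebra_coord_field[OF P(2)],
        of "outside n" UNIV "\<delta> / 4"] eqv \<open>\<delta> > 0\<close> by auto
  \<comment> \<open>The bound \<open>2 * c\<close> will multiply \<open>c1 * \<epsilon> + \<delta>1 = 2 * \<delta>1\<close>, giving \<open>\<delta> / 4\<close>; the set where domination
    fails costs \<open>\<delta> / 2\<close>, and the two exchanges under total variation cost \<open>\<delta> / 8\<close> each.\<close>
  define \<delta>1 where "\<delta>1 = \<delta> / (16 * c)"
  have \<delta>1: "\<delta>1 > 0" using \<open>\<delta> > 0\<close> c by (simp add: \<delta>1_def)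
  obtain c1 where c1: "c1 > 0" and RP: "\<And>S. S \<in> sets ?H \<Longrightarrow>
      emeasure ?R S \<le> ennreal c1 * emeasure P S + ennreal \<delta>1"
    using null_equivalent_linear_bound[OF P(1) R(1) subalgebra_coord_field[OF P(2)] subalgebra_coord_field[OF R(2)],
        of "outside n" UNIV \<delta>1] eqv \<delta>1 by auto
  define \<epsilon> where "\<epsilon> = \<delta>1 / c1"
  show thesis
  proof (rule that)
    show "\<epsilon> > 0" using \<delta>1 c1 by (simp add: \<epsilon>_def)
    show "future_controlled P n \<epsilon> \<delta>"
      unfolding future_controlled_def
    proof (intro allI impI)
      fix E D :: "nat \<Rightarrow> (int \<Rightarrow> 'g \<times> 'f) set"
      assume disj: "disjoint_family E" and "\<forall>i. E i \<in> sets (coord_field {..0} UNIV)"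
        and "\<forall>i. D i \<in> sets (FZ {int n..})"
        and small: "emeasure P (\<Union>i. E i \<inter> D i) \<le> ennreal \<epsilon>"
      then have E: "E i \<in> sets (coord_field {..0} UNIV)" and D: "D i \<in> sets (FZ {int n..})" for i by auto
      have EH: "E i \<in> sets ?H" for i using E coord_field_mono[of "{..0}" "outside n" UNIV UNIV] by auto
      have DB: "D i \<in> sets ?B" for i
        using D[of i] coord_field_mono[of "{int n..}" "outside n" "{}" "outside n"] by (auto simp: FZ_eq_coord_field)
      have BH: "S \<in> sets ?H" "S \<in> sets (coord_field UNIV (outside n))" if "S \<in> sets ?B" for S
        using that coord_field_mono[of "outside n" "outside n" "outside n" UNIV]
          coord_field_mono[of "outside n" UNIV "outside n" "outside n"] by auto
      have CB: "S \<in> sets ?B" if "S \<in> sets ?C" for S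
        using that coord_field_mono[of "{..0}" "outside n" "outside n" "outside n"] by auto
      have [measurable]: "E i \<in> sets borel" "D i \<in> sets borel" for i
        using EH DB coord_field_borel by blast+
      have subC: "subalgebra P ?C" by (rule subalgebra_coord_field[OF P(2)])
      interpret C: finite_measure_subalgebra P ?C by unfold_locales (rule subC)
      define e where "e i \<omega> = emeasure (\<kappa> \<omega>) {m \<in> space (gap_space n). resample n \<omega> m \<in> E i}" for i \<omega>
      have e [measurable]: "e i \<in> borel_measurable ?C" for i
        unfolding e_def by (rule measurable_resample_prob[OF P \<kappa> E])
      define a where "a i = nn_cond_exp P ?C (indicator (E i))" for i
      have a [measurable]: "a i \<in> borel_measurable ?C" for i unfolding a_def by measurable
      have a_int: "(\<integral>\<^sup>+\<omega>. f \<omega> * a i \<omega> \<partial>P) = (\<integral>\<^sup>+\<omega>. f \<omega> * indicator (E i) \<omega> \<partial>P)"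
        if "f \<in> borel_measurable ?C" for f i
        unfolding a_def using that by (rule C.nn_cond_exp_intg) measurable
      define d where "d i = future_prob P n (D i)" for i
      have d [measurable]: "d i \<in> borel_measurable ?C" for i
        unfolding d_def
        by (rule measurable_coord_field_mono[OF measurable_future_prob[unfolded FY_eq_coord_field]]) auto
      have d1: "d i \<omega> \<le> 1" for i \<omega> by (simp add: d_def future_prob_le_1)
      \<comment> \<open>Where the domination of \<open>a i\<close> by \<open>e i\<close> fails. The factor 2 lets the bound for
        \<open>P (\<Union>i. E i \<inter> H i)\<close> absorb itself.\<close>
      define H where "H i = {\<omega>. ennreal (2 * c) * e i \<omega> < a i \<omega>}" for i
      have H: "H i \<in> sets ?C" for i
        using measurable_sets[of "\<lambda>\<omega>. (ennreal (2 * c) * e i \<omega> < a i \<omega>)" ?C "count_space UNIV" "{True}"]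
        by (simp add: H_def vimage_def)
      have P_meas: "f \<in> borel_measurable P" if "f \<in> borel_measurable ?C" for f :: "_ \<Rightarrow> ennreal"
        using measurable_from_subalg[OF subC that] .
      have borC: "S \<in> sets borel" if "S \<in> sets ?C" for S using that coord_field_borel by auto
      note e[THEN P_meas, measurable] a[THEN P_meas, measurable] d[THEN P_meas, measurable] H[THEN borC, measurable]

      have union: "emeasure Q (\<Union>i. E i \<inter> S i) = (\<Sum>i. emeasure Q (E i \<inter> S i))"
        if "sets Q = sets borel" "\<And>i. S i \<in> sets borel" for Q S
      proof (rule suminf_emeasure[symmetric])
        show "disjoint_family (\<lambda>i. E i \<inter> S i)"
          using disj unfolding disjoint_family_on_def by blast
      qed (use that \<open>\<And>i. E i \<in> sets borel\<close> in auto)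

      have exceptional: "(\<Sum>i. emeasure P (E i \<inter> H i)) \<le> ennreal (\<delta> / 2)"
      proof -
        define U where "U = (\<Union>i. E i \<inter> H i)"
        have UH: "U \<in> sets ?H" unfolding U_def using EH BH(1)[OF CB[OF H]] by auto
        have PU: "emeasure P U = (\<Sum>i. emeasure P (E i \<inter> H i))"
          unfolding U_def by (rule union[OF P(2)]) measurable
        have "ennreal (2 * c) * emeasure ?R U = (\<Sum>i. ennreal (2 * c) * emeasure ?R (E i \<inter> H i))"
          unfolding U_def by (subst union[OF R(2)]) (auto simp: ennreal_suminf_cmult)
        also have "\<dots> \<le> (\<Sum>i. emeasure P (E i \<inter> H i))"
        proof (rule suminf_le)
          fix i
          have "ennreal (2 * c) * emeasure ?R (E i \<inter> H i) =
              ennreal (2 * c) * (\<integral>\<^sup>+\<omega>. e i \<omega> * indicator (H i) \<omega> \<partial>P)"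
            unfolding e_def by (subst emeasure_resampled_Int[OF P \<kappa> _ BH(2)[OF CB[OF H]]]) auto
          also have "\<dots> = (\<integral>\<^sup>+\<omega>. ennreal (2 * c) * (e i \<omega> * indicator (H i) \<omega>) \<partial>P)"
            by (rule nn_integral_cmult[symmetric]) measurable
          also have "\<dots> \<le> (\<integral>\<^sup>+\<omega>. indicator (H i) \<omega> * a i \<omega> \<partial>P)"
            by (intro nn_integral_mono) (auto simp: H_def split: split_indicator)
          also have "\<dots> = (\<integral>\<^sup>+\<omega>. indicator (H i) \<omega> * indicator (E i) \<omega> \<partial>P)"
            using H by (intro a_int) auto
          also have "\<dots> = (\<integral>\<^sup>+\<omega>. indicator (E i \<inter> H i) \<omega> \<partial>P)"
            by (intro nn_integral_cong) (auto split: split_indicator)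
          also have "\<dots> = emeasure P (E i \<inter> H i)" by (rule nn_integral_indicator) measurable
          finally show "ennreal (2 * c) * emeasure ?R (E i \<inter> H i) \<le> emeasure P (E i \<inter> H i)" .
        qed auto
        finally have 1: "ennreal (2 * c) * emeasure ?R U \<le> emeasure P U" unfolding PU .
        have "2 * c * measure ?R U \<le> measure P U" "measure P U \<le> c * measure ?R U + \<delta> / 4"
          using 1 PR[OF UH] c \<open>\<delta> > 0\<close>
          by (simp_all add: P.emeasure_eq_measure R.emeasure_eq_measure ennreal_mult[symmetric] ennreal_plus[symmetric]
              del: ennreal_plus)
        then have "measure P U \<le> \<delta> / 2" by linarith
        then have "emeasure P U \<le> ennreal (\<delta> / 2)"
          by (simp add: P.emeasure_eq_measure ennreal_leI)
        then show ?thesis unfolding PU .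
      qed

      \<comment> \<open>Outside \<open>A\<close>, a null set of \<open>P\<close>, the weights are set to 0: the total mass must be at most 1
        everywhere, since \<open>decoupled P\<close> may charge that set.\<close>
      define A where "A = {\<omega>. (\<Sum>i. a i \<omega>) \<le> 1}"
      have A: "A \<in> sets ?C"
        using measurable_sets[of "\<lambda>\<omega>. (\<Sum>i. a i \<omega>) \<le> 1" ?C "count_space UNIV" "{True}"]
        by (simp add: A_def vimage_def)
      have AE_A: "AE \<omega> in P. \<omega> \<in> A"
      proof -
        have "AE \<omega> in P. (\<Sum>i. a i \<omega>) = nn_cond_exp P ?C (indicator (\<Union>i. E i)) \<omega>"
        proof (rule C.nn_cond_exp_charact)
          fix S assume S: "S \<in> sets ?C"
          then have [measurable]: "S \<in> sets borel" by (rule borC)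
          have "(\<integral>\<^sup>+\<omega>\<in>S. (\<Sum>i. a i \<omega>) \<partial>P) = (\<Sum>i. \<integral>\<^sup>+\<omega>. indicator S \<omega> * a i \<omega> \<partial>P)"
            by (subst nn_integral_suminf[symmetric]) (auto simp: ennreal_suminf_multc mult.commute)
          also have "\<dots> = (\<Sum>i. \<integral>\<^sup>+\<omega>. indicator S \<omega> * indicator (E i) \<omega> \<partial>P)"
            using S by (subst a_int) auto
          also have "\<dots> = (\<integral>\<^sup>+\<omega>. (\<Sum>i. indicator (E i) \<omega>) * indicator S \<omega> \<partial>P)"
            by (subst nn_integral_suminf[symmetric]) (auto simp: ennreal_suminf_multc mult.commute)
          also have "\<dots> = (\<integral>\<^sup>+\<omega>\<in>S. indicator (\<Union>i. E i) \<omega> \<partial>P)"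
            by (simp add: suminf_indicator[OF disj])
          finally show "(\<integral>\<^sup>+\<omega>\<in>S. indicator (\<Union>i. E i) \<omega> \<partial>P) = (\<integral>\<^sup>+\<omega>\<in>S. (\<Sum>i. a i \<omega>) \<partial>P)" ..
        qed auto
        moreover have "AE \<omega> in P. nn_cond_exp P ?C (indicator (\<Union>i. E i)) \<omega> \<le> 1"
          by (rule nn_cond_exp_le_1[OF P(1) subC]) (auto split: split_indicator)
        ultimately show ?thesis unfolding A_def by eventually_elim simp
      qed

      define b where "b i \<omega> = indicator (A - H i) \<omega> * a i \<omega>" for i \<omega>
      have b [measurable]: "b i \<in> borel_measurable ?C" for i unfolding b_def using A H by measurable
      have b_sum: "(\<Sum>i. b i \<omega>) \<le> 1" for \<omega>
      proof (cases "\<omega> \<in> A")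
        case True
        have "(\<Sum>i. b i \<omega>) \<le> (\<Sum>i. a i \<omega>)"
          by (intro suminf_le) (auto simp: b_def split: split_indicator)
        with True show ?thesis by (auto simp: A_def)
      qed (simp add: b_def)
      have b_le: "b i \<omega> \<le> ennreal (2 * c) * e i \<omega>" for i \<omega>
        by (auto simp: b_def H_def not_less split: split_indicator)
      note b[THEN P_meas, measurable]

      have split: "(\<integral>\<^sup>+\<omega>. indicator (E i) \<omega> * d i \<omega> \<partial>P) \<le> emeasure P (E i \<inter> H i) + (\<integral>\<^sup>+\<omega>. b i \<omega> * d i \<omega> \<partial>P)" for i
      proof -
        have "(\<integral>\<^sup>+\<omega>. indicator (E i) \<omega> * d i \<omega> \<partial>P) \<le>
            (\<integral>\<^sup>+\<omega>. indicator (E i \<inter> H i) \<omega> + (indicator (A - H i) \<omega> * d i \<omega>) * indicator (E i) \<omega> \<partial>P)"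
        proof (rule nn_integral_mono_AE)
          show "AE \<omega> in P. indicator (E i) \<omega> * d i \<omega> \<le>
              indicator (E i \<inter> H i) \<omega> + (indicator (A - H i) \<omega> * d i \<omega>) * indicator (E i) \<omega>"
            using AE_A by eventually_elim (auto simp: d1 split: split_indicator)
        qed
        also have "\<dots> = emeasure P (E i \<inter> H i) + (\<integral>\<^sup>+\<omega>. (indicator (A - H i) \<omega> * d i \<omega>) * indicator (E i) \<omega> \<partial>P)"
          using borC[OF A] by (subst nn_integral_add) auto
        also have "(\<integral>\<^sup>+\<omega>. (indicator (A - H i) \<omega> * d i \<omega>) * indicator (E i) \<omega> \<partial>P) =
            (\<integral>\<^sup>+\<omega>. (indicator (A - H i) \<omega> * d i \<omega>) * a i \<omega> \<partial>P)"
          by (rule a_int[symmetric]) (use A H in measurable)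
        also have "\<dots> = (\<integral>\<^sup>+\<omega>. b i \<omega> * d i \<omega> \<partial>P)" by (simp add: b_def ac_simps)
        finally show ?thesis .
      qed

      have BC: "f \<in> borel_measurable ?B" if "f \<in> borel_measurable ?C" for f :: "_ \<Rightarrow> ennreal"
        using that by (rule measurable_coord_field_mono) auto
      note b[THEN BC, measurable] d[THEN BC, measurable] DB[measurable]
      note dec = prob_space_decoupled[OF P]
      have sets_dec: "sets (decoupled P) = sets borel" by (simp add: decoupled_def)
      note subB = subalgebra_coord_field[OF P(2), of "outside n" "outside n"]
        subalgebra_coord_field[OF sets_dec, of "outside n" "outside n"]
      have dec_meas: "f \<in> borel_measurable P" "f \<in> borel_measurable (decoupled P)"
        if "f \<in> borel_measurable ?B" for f :: "_ \<Rightarrow> ennreal"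
        using measurable_from_subalg[OF subB(1) that] measurable_from_subalg[OF subB(2) that] .
      have le1: "(\<Sum>i. b i \<omega> * f i \<omega>) \<le> 1" if "\<And>i. f i \<omega> \<le> 1" for f :: "nat \<Rightarrow> _ \<Rightarrow> ennreal" and \<omega>
      proof -
        have "(\<Sum>i. b i \<omega> * f i \<omega>) \<le> (\<Sum>i. b i \<omega> * 1)"
          using that by (intro suminf_le mult_left_mono) auto
        also have "\<dots> \<le> 1" using b_sum by simp
        finally show ?thesis .
      qed
      have "(\<Sum>i. \<integral>\<^sup>+\<omega>. b i \<omega> * d i \<omega> \<partial>P) = (\<integral>\<^sup>+\<omega>. (\<Sum>i. b i \<omega> * d i \<omega>) \<partial>P)"
        by (rule nn_integral_suminf[symmetric]) measurable
      also have "\<dots> \<le> (\<integral>\<^sup>+\<omega>. (\<Sum>i. b i \<omega> * d i \<omega>) \<partial>decoupled P) + ennreal (\<delta> / 8)"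
      proof (rule nn_integral_close[OF P(1) dec subB])
        show "measure P S \<le> measure (decoupled P) S + \<delta> / 8" if "S \<in> sets ?B" for S
          using close[OF that] by linarith
      qed (use \<open>\<delta> > 0\<close> in \<open>auto intro!: le1 d1\<close>)
      also have "(\<integral>\<^sup>+\<omega>. (\<Sum>i. b i \<omega> * d i \<omega>) \<partial>decoupled P) = (\<Sum>i. \<integral>\<^sup>+\<omega>. b i \<omega> * d i \<omega> \<partial>decoupled P)"
        by (rule nn_integral_suminf) (rule dec_meas, measurable)
      also have "\<dots> = (\<Sum>i. \<integral>\<^sup>+\<omega>. b i \<omega> * indicator (D i) \<omega> \<partial>decoupled P)"
        unfolding d_def using n by (subst decoupled_future_prob[OF P _ D b]) auto
      also have "\<dots> = (\<integral>\<^sup>+\<omega>. (\<Sum>i. b i \<omega> * indicator (D i) \<omega>) \<partial>decoupled P)"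
        by (rule nn_integral_suminf[symmetric]) (rule dec_meas, measurable)
      also have "\<dots> \<le> (\<integral>\<^sup>+\<omega>. (\<Sum>i. b i \<omega> * indicator (D i) \<omega>) \<partial>P) + ennreal (\<delta> / 8)"
      proof (rule nn_integral_close[OF dec P(1) subB(2,1)])
        show "measure (decoupled P) S \<le> measure P S + \<delta> / 8" if "S \<in> sets ?B" for S
          using close[OF that] by linarith
      qed (use \<open>\<delta> > 0\<close> in \<open>auto intro!: le1 split: split_indicator\<close>)
      also have "(\<integral>\<^sup>+\<omega>. (\<Sum>i. b i \<omega> * indicator (D i) \<omega>) \<partial>P) = (\<Sum>i. \<integral>\<^sup>+\<omega>. b i \<omega> * indicator (D i) \<omega> \<partial>P)"
        by (rule nn_integral_suminf) measurable
      also have "\<dots> \<le> (\<Sum>i. ennreal (2 * c) * emeasure ?R (E i \<inter> D i))"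
      proof (rule suminf_le)
        fix i
        have "(\<integral>\<^sup>+\<omega>. b i \<omega> * indicator (D i) \<omega> \<partial>P) \<le> (\<integral>\<^sup>+\<omega>. ennreal (2 * c) * (e i \<omega> * indicator (D i) \<omega>) \<partial>P)"
          using b_le by (intro nn_integral_mono) (auto split: split_indicator)
        also have "\<dots> = ennreal (2 * c) * (\<integral>\<^sup>+\<omega>. e i \<omega> * indicator (D i) \<omega> \<partial>P)"
          by (rule nn_integral_cmult) measurable
        also have "\<dots> = ennreal (2 * c) * emeasure ?R (E i \<inter> D i)"
          unfolding e_def by (subst emeasure_resampled_Int[OF P \<kappa> _ BH(2)[OF DB]]) auto
        finally show "(\<integral>\<^sup>+\<omega>. b i \<omega> * indicator (D i) \<omega> \<partial>P) \<le> ennreal (2 * c) * emeasure ?R (E i \<inter> D i)" .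
      qed auto
      also have "\<dots> = ennreal (2 * c) * emeasure ?R (\<Union>i. E i \<inter> D i)"
        by (subst union[OF R(2)]) (auto simp: ennreal_suminf_cmult)
      also have "\<dots> \<le> ennreal (2 * c) * (ennreal c1 * ennreal \<epsilon> + ennreal \<delta>1)"
      proof (intro mult_left_mono)
        have "(\<Union>i. E i \<inter> D i) \<in> sets ?H" using EH BH(1)[OF DB] by auto
        from RP[OF this] show "emeasure ?R (\<Union>i. E i \<inter> D i) \<le> ennreal c1 * ennreal \<epsilon> + ennreal \<delta>1"
          by (rule order_trans) (intro add_right_mono mult_left_mono small, simp)
      qed simp
      also have "\<dots> = ennreal (\<delta> / 4)"
        using c c1 \<delta>1 \<open>\<delta> > 0\<close>
        by (simp add: ennreal_mult[symmetric] ennreal_plus[symmetric] \<epsilon>_def \<delta>1_def del: ennreal_plus)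
      finally have bd: "(\<Sum>i. \<integral>\<^sup>+\<omega>. b i \<omega> * d i \<omega> \<partial>P) \<le> ennreal (\<delta> / 4) + ennreal (\<delta> / 8) + ennreal (\<delta> / 8)"
        by (simp add: add_right_mono)
      have "(\<Sum>i. \<integral>\<^sup>+\<omega>. indicator (E i) \<omega> * d i \<omega> \<partial>P) \<le>
          (\<Sum>i. emeasure P (E i \<inter> H i) + (\<integral>\<^sup>+\<omega>. b i \<omega> * d i \<omega> \<partial>P))"
        by (intro suminf_le split) auto
      also have "\<dots> = (\<Sum>i. emeasure P (E i \<inter> H i)) + (\<Sum>i. \<integral>\<^sup>+\<omega>. b i \<omega> * d i \<omega> \<partial>P)"
        by (rule suminf_add[symmetric]) auto
      also have "\<dots> \<le> ennreal (\<delta> / 2) + (ennreal (\<delta> / 4) + ennreal (\<delta> / 8) + ennreal (\<delta> / 8))"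
        by (intro add_mono exceptional bd)
      also have "\<dots> = ennreal \<delta>"
        using \<open>\<delta> > 0\<close> by (simp add: ennreal_plus[symmetric] del: ennreal_plus)
      finally show "(\<Sum>i. \<integral>\<^sup>+\<omega>. indicator (E i) \<omega> * future_prob P n (D i) \<omega> \<partial>P) \<le> ennreal \<delta>"
        unfolding d_def .
    qed
  qed
qed

section \<open>Shifting the cut\<close>

definition shift_path :: "int \<Rightarrow> (int \<Rightarrow> 'a) \<Rightarrow> int \<Rightarrow> 'a" where
  "shift_path k \<omega> = (\<lambda>j. \<omega> (j + k))"

lemma path_shift:
  "Zpath (shift_path k \<omega>) j = Zpath \<omega> (j + k)" "Ypath (shift_path k \<omega>) j = Ypath \<omega> (j + k)"
  by (auto simp: Zpath_def Ypath_def shift_path_def)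

lemma shift_inverse [simp]: "shift_path k (shift_path (- k) \<omega>) = \<omega>" "shift_path (- k) (shift_path k \<omega>) = \<omega>"
  by (auto simp: shift_path_def)

lemma measurable_shift_coord_field:
  assumes "\<And>j. j \<in> I \<Longrightarrow> j + k \<in> I'" "\<And>j. j \<in> J \<Longrightarrow> j + k \<in> J'"
  shows "shift_path k \<in> coord_field I' J' \<rightarrow>\<^sub>M coord_field I J"
  using assms by (intro measurable_into_coord_field)
    (auto simp: path_shift intro: measurable_coord_field_Z measurable_coord_field_Y)

lemma measurable_shift [measurable]:
  "shift_path k \<in> (borel :: (int \<Rightarrow> 'g::polish_space \<times> 'f::polish_space) measure) \<rightarrow>\<^sub>M borel"
  by (rule measurable_into_path) (auto simp: path_shift)

lemma shift_vimage_coord_field: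
  assumes "S \<in> sets (coord_field I J)" "\<And>j. j \<in> I \<Longrightarrow> j + k \<in> I'" "\<And>j. j \<in> J \<Longrightarrow> j + k \<in> J'"
  shows "shift_path k -` S \<in> sets (coord_field I' J')"
  using measurable_sets[OF measurable_shift_coord_field[OF assms(2,3)] assms(1)] by simp

lemma stationary_shift:
  fixes P :: "(int \<Rightarrow> 'g::polish_space \<times> 'f::polish_space) measure"
  assumes "stationary_law P"
  shows "distr P borel (shift_path (int k)) = P"
proof (induction k)
  case 0
  have "shift_path 0 = (\<lambda>\<omega>. \<omega> :: int \<Rightarrow> 'g \<times> 'f)" by (auto simp: shift_path_def)
  then show ?case using assms distr_id2[of borel P] by (simp add: stationary_law_def)
next
  case (Suc k)
  have sets [measurable_cong]: "sets P = sets borel" and 1: "distr P borel (shift_path 1) = P"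
    using assms by (auto simp: stationary_law_def shift_path_def[abs_def])
  have "shift_path (int (Suc k)) = shift_path 1 \<circ> (shift_path (int k) :: (int \<Rightarrow> 'g \<times> 'f) \<Rightarrow> _)"
    by (auto simp: shift_path_def fun_eq_iff ac_simps)
  then have "distr P borel (shift_path (int (Suc k))) = distr (distr P borel (shift_path (int k))) borel (shift_path 1)"
    by (simp add: distr_distr)
  then show ?case using Suc 1 by simp
qed

lemma future_prob_complement:
  fixes P :: "(int \<Rightarrow> 'g::polish_space \<times> 'f::polish_space) measure"
  assumes st: "stationary_law P" and D: "D \<in> sets borel"
  shows "AE \<omega> in P. 1 \<le> future_prob P n D (shift_path (int k) \<omega>) + future_prob P n (- D) (shift_path (int k) \<omega>)"
proof -
  have P: "prob_space P" "sets P = sets borel" using st by (auto simp: stationary_law_def)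
  note P(2)[measurable_cong]
  have sub: "subalgebra P (FY {int n..})" unfolding FY_eq_coord_field by (rule subalgebra_coord_field[OF P(2)])
  interpret prob_space P by fact
  interpret finite_measure_subalgebra P "FY {int n..}" by unfold_locales (rule sub)
  note D[measurable]
  have Dc: "- D \<in> sets borel" using D by auto
  note this[measurable]
  have "AE \<omega> in P. nn_cond_exp P (FY {int n..}) (indicator D) \<omega> + nn_cond_exp P (FY {int n..}) (indicator (- D)) \<omega>
     = nn_cond_exp P (FY {int n..}) (\<lambda>\<omega>. indicator D \<omega> + indicator (- D) \<omega>) \<omega>"
    by (rule nn_cond_exp_sum) auto
  moreover have "(\<lambda>\<omega>. indicator D \<omega> + indicator (- D) \<omega>) = (\<lambda>_. 1 :: ennreal)"
    by (auto split: split_indicator)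
  moreover have "AE \<omega> in P. 1 = nn_cond_exp P (FY {int n..}) (\<lambda>_. 1) \<omega>"
    by (rule nn_cond_exp_F_meas) simp
  ultimately have "AE \<omega> in P. 1 \<le> future_prob P n D \<omega> + future_prob P n (- D) \<omega>"
    using future_prob_eq[OF P D, of n] future_prob_eq[OF P Dc, of n] by auto
  then have "AE \<omega> in distr P borel (shift_path (int k)). 1 \<le> future_prob P n D \<omega> + future_prob P n (- D) \<omega>"
    unfolding stationary_shift[OF st] .
  then show ?thesis by (rule AE_distrD[rotated]) measurable
qed

text \<open>The set \<open>W i\<close> collects the paths for which \<open>C i\<close> and the shifted \<open>D i\<close> nearly exclude each other
under the conditional law although \<open>C i\<close> is likely and \<open>D i\<close> is likely for the reference. Selecting
the first such \<open>i\<close> gives a measurable choice of events, and the shift by \<open>k\<close> carries it to the cut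
at 0. The bound does not depend on \<open>k\<close>.\<close>

lemma separation_small:
  fixes P :: "(int \<Rightarrow> 'g::polish_space \<times> 'f::polish_space) measure" and k n :: nat
    and C D :: "nat \<Rightarrow> (int \<Rightarrow> 'g \<times> 'f) set" and \<epsilon> \<delta> \<eta> :: real
  assumes st: "stationary_law P"
    and K: "regular_cond_distr P (coord_field {..0} UNIV) (\<lambda>\<omega>. \<omega>) borel K"
    and small: "future_controlled P n \<epsilon> \<delta>"
    and C: "\<And>i. C i \<in> sets (coord_field {..int k} UNIV)" and D: "\<And>i. D i \<in> sets (FZ {int n..})"
  defines "W \<equiv> (\<lambda>i. {\<omega>. emeasure (K \<omega>) (C i \<inter> shift_path (int k) -` D i) \<le> ennreal \<epsilon> \<and>
      ennreal \<eta> \<le> emeasure (K \<omega>) (C i) * future_prob P n (D i) (shift_path (int k) \<omega>)})"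
  shows "(\<Union>i. W i) \<in> sets borel" and "ennreal \<eta> * emeasure P (\<Union>i. W i) \<le> ennreal \<delta>"
proof -
  have P: "prob_space P" "sets P = sets borel" using st by (auto simp: stationary_law_def)
  interpret prob_space P by fact
  note P(2)[measurable_cong]
  have spP: "space P = UNIV" using sets_eq_imp_space_eq[OF P(2)] by simp
  let ?G = "coord_field {..0} UNIV :: (int \<Rightarrow> 'g \<times> 'f) measure"
  have sub: "subalgebra P ?G" by (rule subalgebra_coord_field[OF P(2)])
  have Km: "K \<in> ?G \<rightarrow>\<^sub>M prob_algebra borel" using K by (simp add: regular_cond_distr_def)
  have [measurable]: "(\<lambda>\<omega>. emeasure (K \<omega>) S) \<in> borel_measurable ?G" if "S \<in> sets borel" for S
    by (rule measurable_compose[OF measurable_prob_algebraD[OF Km] measurable_emeasure_subprob_algebra[OF that]])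
  have Cb [measurable]: "C i \<in> sets borel" for i using C coord_field_borel by blast
  have Db [measurable]: "D i \<in> sets borel" for i using D coord_field_borel by (auto simp: FZ_eq_coord_field)
  define T where "T = (shift_path (int k) :: (int \<Rightarrow> 'g \<times> 'f) \<Rightarrow> _)"
  have T [measurable]: "T \<in> borel \<rightarrow>\<^sub>M borel" unfolding T_def by measurable
  have TD [measurable]: "T -` D i \<in> sets borel" for i using measurable_sets[OF T Db, of i] by simp
  have distrT: "distr P borel T = P" unfolding T_def by (rule stationary_shift[OF st])
  define d where "d i \<omega> = future_prob P n (D i) (T \<omega>)" for i \<omega>
  have dG [measurable]: "d i \<in> borel_measurable ?G" for i
    unfolding d_def T_def
    by (rule measurable_compose[OF measurable_shift_coord_field measurable_future_prob[unfolded FY_eq_coord_field]]) auto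
  have KC [measurable]: "(\<lambda>\<omega>. emeasure (K \<omega>) (C i \<inter> T -` D i)) \<in> borel_measurable ?G"
    "(\<lambda>\<omega>. emeasure (K \<omega>) (C i)) \<in> borel_measurable ?G" for i
    by measurable
  have W: "W i \<in> sets ?G" for i
  proof -
    have "{\<omega> \<in> space ?G. emeasure (K \<omega>) (C i \<inter> T -` D i) \<le> ennreal \<epsilon> \<and>
      ennreal \<eta> \<le> emeasure (K \<omega>) (C i) * d i \<omega>} \<in> sets ?G" by measurable
    then show ?thesis by (simp add: W_def T_def d_def)
  qed
  then have UW: "(\<Union>i. W i) \<in> sets ?G" by auto
  then show UWb: "(\<Union>i. W i) \<in> sets borel" using coord_field_borel by blast
  \<comment> \<open>On \<open>V i\<close> the index \<open>i\<close> is the first that works.\<close>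
  define V where "V = disjointed W"
  have V: "V i \<in> sets ?G" for i
    using W sets.range_disjointed_sets[of W ?G] by (auto simp: V_def)
  have Vb [measurable]: "V i \<in> sets borel" for i using V coord_field_borel by blast
  have V_disj: "disjoint_family V" unfolding V_def by (rule disjoint_family_disjointed)
  have V_sub: "V i \<subseteq> W i" for i unfolding V_def by (rule disjointed_subset)
  have V_un: "(\<Union>i. V i) = (\<Union>i. W i)" unfolding V_def by (rule UN_disjointed_eq)
  have VC: "V i \<inter> C i \<in> sets (coord_field {..int k} UNIV)" for i
    using V[of i] C[of i] coord_field_mono[of "{..0}" "{..int k}" UNIV UNIV] by auto
  define E where "E i = shift_path (- int k) -` (V i \<inter> C i)" for i
  have E: "E i \<in> sets ?G" for i
    unfolding E_def by (rule shift_vimage_coord_field[OF VC]) auto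
  have Eb [measurable]: "E i \<in> sets borel" for i using E coord_field_borel by blast
  have TE: "T -` E i = V i \<inter> C i" for i
    by (auto simp: E_def T_def)
  have E_disj: "disjoint_family E"
    using V_disj unfolding disjoint_family_on_def E_def by blast

  have kernel: "(\<integral>\<^sup>+\<omega>. f \<omega> * emeasure (K \<omega>) S \<partial>P) = (\<integral>\<^sup>+\<omega>. f \<omega> * indicator S \<omega> \<partial>P)"
    if "S \<in> sets borel" "f \<in> borel_measurable ?G" for f S
    using nn_integral_regular_cond_distr[OF P(1) sub _ K that] by simp
  have mP: "f \<in> borel_measurable P" if "f \<in> borel_measurable ?G" for f :: "_ \<Rightarrow> ennreal"
    using measurable_from_subalg[OF sub that] .
  note dG[THEN mP, measurable] KC[THEN mP, measurable]

  have "emeasure P (\<Union>i. E i \<inter> D i) = emeasure P (T -` (\<Union>i. E i \<inter> D i))"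
    using emeasure_distr[of T P borel "\<Union>i. E i \<inter> D i"] unfolding distrT by (simp add: spP)
  also have "T -` (\<Union>i. E i \<inter> D i) = (\<Union>i. V i \<inter> (C i \<inter> T -` D i))"
    using TE by auto
  also have "emeasure P \<dots> = (\<Sum>i. emeasure P (V i \<inter> (C i \<inter> T -` D i)))"
  proof (rule suminf_emeasure[symmetric])
    show "disjoint_family (\<lambda>i. V i \<inter> (C i \<inter> T -` D i))"
      using V_disj unfolding disjoint_family_on_def by blast
  qed auto
  also have "\<dots> \<le> (\<Sum>i. ennreal \<epsilon> * emeasure P (V i))"
  proof (rule suminf_le)
    fix i
    have "emeasure P (V i \<inter> (C i \<inter> T -` D i)) = (\<integral>\<^sup>+\<omega>. indicator (V i \<inter> (C i \<inter> T -` D i)) \<omega> \<partial>P)"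
      by (rule nn_integral_indicator[symmetric]) measurable
    also have "\<dots> = (\<integral>\<^sup>+\<omega>. indicator (V i) \<omega> * indicator (C i \<inter> T -` D i) \<omega> \<partial>P)"
      by (intro nn_integral_cong) (auto split: split_indicator)
    also have "\<dots> = (\<integral>\<^sup>+\<omega>. indicator (V i) \<omega> * emeasure (K \<omega>) (C i \<inter> T -` D i) \<partial>P)"
      using V by (intro kernel[symmetric]) auto
    also have "\<dots> \<le> (\<integral>\<^sup>+\<omega>. ennreal \<epsilon> * indicator (V i) \<omega> \<partial>P)"
      using V_sub[of i] by (intro nn_integral_mono) (auto simp: W_def T_def split: split_indicator)
    also have "\<dots> = ennreal \<epsilon> * emeasure P (V i)"
      by (rule nn_integral_cmult_indicator) measurable
    finally show "emeasure P (V i \<inter> (C i \<inter> T -` D i)) \<le> ennreal \<epsilon> * emeasure P (V i)" .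
  qed auto
  also have "\<dots> = ennreal \<epsilon> * emeasure P (\<Union>i. V i)"
    using V_disj by (subst ennreal_suminf_cmult, subst suminf_emeasure) auto
  also have "\<dots> \<le> ennreal \<epsilon> * 1" by (intro mult_left_mono measure_le_1) auto
  finally have "emeasure P (\<Union>i. E i \<inter> D i) \<le> ennreal \<epsilon>" by simp
  with small E_disj E D
  have bound: "(\<Sum>i. \<integral>\<^sup>+\<omega>. indicator (E i) \<omega> * future_prob P n (D i) \<omega> \<partial>P) \<le> ennreal \<delta>"
    unfolding future_controlled_def by blast

  have "ennreal \<eta> * emeasure P (\<Union>i. W i) = ennreal \<eta> * emeasure P (\<Union>i. V i)" by (simp add: V_un)
  also have "\<dots> = (\<Sum>i. ennreal \<eta> * emeasure P (V i))"
    using V_disj by (subst suminf_emeasure[symmetric]) (auto simp: ennreal_suminf_cmult)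
  also have "\<dots> \<le> (\<Sum>i. \<integral>\<^sup>+\<omega>. indicator (E i) \<omega> * future_prob P n (D i) \<omega> \<partial>P)"
  proof (rule suminf_le)
    fix i
    have fm: "future_prob P n (D i) \<in> borel_measurable borel"
      using measurable_future_prob[of P n "D i"] measurable_from_subalg[OF subalgebra_coord_field[OF refl]]
      unfolding FY_eq_coord_field by blast
    have "ennreal \<eta> * emeasure P (V i) = (\<integral>\<^sup>+\<omega>. ennreal \<eta> * indicator (V i) \<omega> \<partial>P)"
      by (rule nn_integral_cmult_indicator[symmetric]) measurable
    also have "\<dots> \<le> (\<integral>\<^sup>+\<omega>. (indicator (V i) \<omega> * d i \<omega>) * emeasure (K \<omega>) (C i) \<partial>P)"
      using V_sub[of i]
      by (intro nn_integral_mono) (auto simp: W_def T_def d_def mult.commute split: split_indicator)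
    also have "\<dots> = (\<integral>\<^sup>+\<omega>. (indicator (V i) \<omega> * d i \<omega>) * indicator (C i) \<omega> \<partial>P)"
      using V by (intro kernel) auto
    also have "\<dots> = (\<integral>\<^sup>+\<omega>. indicator (E i) (T \<omega>) * future_prob P n (D i) (T \<omega>) \<partial>P)"
      using TE[of i] by (intro nn_integral_cong) (auto simp: d_def split: split_indicator)
    also have "\<dots> = (\<integral>\<^sup>+\<omega>. indicator (E i) \<omega> * future_prob P n (D i) \<omega> \<partial>distr P borel T)"
      using fm by (subst nn_integral_distr) auto
    also have "\<dots> = (\<integral>\<^sup>+\<omega>. indicator (E i) \<omega> * future_prob P n (D i) \<omega> \<partial>P)"
      unfolding distrT ..
    finally show "ennreal \<eta> * emeasure P (V i) \<le> (\<integral>\<^sup>+\<omega>. indicator (E i) \<omega> * future_prob P n (D i) \<omega> \<partial>P)" .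
  qed auto
  also note bound
  finally show "ennreal \<eta> * emeasure P (\<Union>i. W i) \<le> ennreal \<delta>" .
qed

section \<open>The conditionally independent coupling\<close>

definition zip_path :: "(int \<Rightarrow> 'g) \<Rightarrow> (int \<Rightarrow> 'f) \<Rightarrow> int \<Rightarrow> 'g \<times> 'f" where
  "zip_path z y = (\<lambda>j. (z j, y j))"

lemma path_zip [simp]: "Zpath (zip_path z y) = z" "Ypath (zip_path z y) = y" "zip_path (Zpath \<omega>) (Ypath \<omega>) = \<omega>"
  by (auto simp: Zpath_def Ypath_def zip_path_def)

lemma measurable_zip_path:
  "(\<lambda>(z, y). zip_path z y) \<in> borel \<Otimes>\<^sub>M borel \<rightarrow>\<^sub>M (borel :: (int \<Rightarrow> 'g::polish_space \<times> 'f::polish_space) measure)"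
  unfolding case_prod_beta
proof (rule measurable_into_path)
  fix k
  show "(\<lambda>x. Zpath (zip_path (fst x) (snd x)) k) \<in> borel_measurable (borel \<Otimes>\<^sub>M (borel :: (int \<Rightarrow> 'f) measure))"
    by (simp add: measurable_compose[OF measurable_fst measurable_product_coordinates])
  show "(\<lambda>x. Ypath (zip_path (fst x) (snd x)) k) \<in> borel_measurable ((borel :: (int \<Rightarrow> 'g) measure) \<Otimes>\<^sub>M borel)"
    by (simp add: measurable_compose[OF measurable_snd measurable_product_coordinates])
qed

lemma sets_Q_measure:
  fixes P :: "(int \<Rightarrow> 'g::polish_space \<times> 'f::polish_space) measure"
  assumes Py: "Py \<in> borel \<rightarrow>\<^sub>M prob_algebra borel"
  shows "sets (Q_measure P Py) = sets (borel \<Otimes>\<^sub>M (borel \<Otimes>\<^sub>M borel))"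
proof -
  have [measurable]: "Py \<in> borel \<rightarrow>\<^sub>M subprob_algebra borel"
    using Py by (rule measurable_prob_algebraD)
  have [measurable]: "(\<lambda>y. distr (Py y) borel Zpath) \<in> borel \<rightarrow>\<^sub>M subprob_algebra borel"
    by (rule measurable_compose [OF _ measurable_distr]) measurable
  have "(\<lambda>y. distr (Py y) borel Zpath \<bind> (\<lambda>z. distr (Py y) borel Zpath \<bind>
      (\<lambda>z'. return (borel \<Otimes>\<^sub>M (borel \<Otimes>\<^sub>M borel)) (z, z', y)))) \<in> borel \<rightarrow>\<^sub>M
      subprob_algebra (borel \<Otimes>\<^sub>M (borel \<Otimes>\<^sub>M (borel :: (int \<Rightarrow> 'f) measure)) :: ((int \<Rightarrow> 'g) \<times> (int \<Rightarrow> 'g) \<times> (int \<Rightarrow> 'f)) measure)"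
    by measurable
  then show ?thesis unfolding Q_measure_def
    by (intro sets_bind) (auto dest: subprob_measurableD)
qed

text \<open>Each of the two hidden sequences, joined with the observations, has the original law under the
coupling: once the other hidden sequence is integrated out, what is left is the disintegration of \<open>P\<close>
over \<open>Y\<close>.\<close>

lemma Q_measure_marginals:
  fixes P :: "(int \<Rightarrow> 'g::polish_space \<times> 'f::polish_space) measure"
  assumes P: "prob_space P" "sets P = sets borel" and Py: "version_Py P Py" and S: "S \<in> sets borel"
  shows "emeasure (Q_measure P Py) {(z, z', y). zip_path z y \<in> S} = emeasure P S"
    and "emeasure (Q_measure P Py) {(z, z', y). zip_path z' y \<in> S} = emeasure P S"
    and "{(z, z', y). zip_path z y \<in> S} \<in> sets (borel \<Otimes>\<^sub>M (borel \<Otimes>\<^sub>M borel))"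
    and "{(z, z', y). zip_path z' y \<in> S} \<in> sets (borel \<Otimes>\<^sub>M (borel \<Otimes>\<^sub>M borel))"
proof -
  interpret prob_space P by fact
  note P(2)[measurable_cong]
  have spP: "space P = UNIV" using sets_eq_imp_space_eq[OF P(2)] by simp
  have Pym: "Py \<in> borel \<rightarrow>\<^sub>M prob_algebra borel"
    and rcd: "regular_cond_distr P (FY UNIV) (\<lambda>\<omega>. \<omega>) borel (\<lambda>\<omega>. Py (Ypath \<omega>))"
    using Py by (auto simp: version_Py_def)
  have pr: "prob_space (Py y)" "sets (Py y) = sets borel" for y
    using measurable_space[OF Pym, of y] by (auto simp: space_prob_algebra)
  have prZ: "prob_space (distr (Py y) borel Zpath)" for y
    using pr(2)[of y] by (intro prob_space.prob_space_distr[OF pr(1)]) (simp cong: measurable_cong_sets)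
  note measurable_zip_path[measurable]
  have "(\<lambda>(z, z', y). zip_path z y) \<in> borel \<Otimes>\<^sub>M (borel \<Otimes>\<^sub>M borel) \<rightarrow>\<^sub>M (borel :: (int \<Rightarrow> 'g \<times> 'f) measure)"
    "(\<lambda>(z, z', y). zip_path z' y) \<in> borel \<Otimes>\<^sub>M (borel \<Otimes>\<^sub>M borel) \<rightarrow>\<^sub>M (borel :: (int \<Rightarrow> 'g \<times> 'f) measure)"
    unfolding case_prod_beta using measurable_compose[OF _ measurable_zip_path] by (auto simp: case_prod_beta)
  from this[THEN measurable_sets, OF S]
  show 1: "{(z, z', y). zip_path z y \<in> S} \<in> sets (borel \<Otimes>\<^sub>M (borel \<Otimes>\<^sub>M borel))"
    and 2: "{(z, z', y). zip_path z' y \<in> S} \<in> sets (borel \<Otimes>\<^sub>M (borel \<Otimes>\<^sub>M borel))"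
    by (simp_all add: vimage_def space_pair_measure case_prod_beta')
  let ?S = "{(\<omega> :: int \<Rightarrow> 'g \<times> 'f, \<omega>' :: int \<Rightarrow> 'g \<times> 'f). zip_path (Zpath \<omega>') (Ypath \<omega>) \<in> S}"
  have "(\<lambda>x. zip_path (Zpath (snd x)) (Ypath (fst x))) \<in> (FY UNIV :: (int \<Rightarrow> 'g \<times> 'f) measure) \<Otimes>\<^sub>M (borel :: (int \<Rightarrow> 'g \<times> 'f) measure) \<rightarrow>\<^sub>M (borel :: (int \<Rightarrow> 'g \<times> 'f) measure)"
    unfolding FY_eq_coord_field
  proof (rule measurable_into_path)
    fix k
    show "(\<lambda>x. Zpath (zip_path (Zpath (snd x)) (Ypath (fst x))) k) \<in> borel_measurable ((coord_field {} UNIV :: (int \<Rightarrow> 'g \<times> 'f) measure) \<Otimes>\<^sub>M (borel :: (int \<Rightarrow> 'g \<times> 'f) measure))"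
      by simp
    show "(\<lambda>x. Ypath (zip_path (Zpath (snd x)) (Ypath (fst x))) k) \<in> borel_measurable ((coord_field {} UNIV :: (int \<Rightarrow> 'g \<times> 'f) measure) \<Otimes>\<^sub>M (borel :: (int \<Rightarrow> 'g \<times> 'f) measure))"
      by simp (rule measurable_compose[OF measurable_fst measurable_coord_field_Y], simp)
  qed
  from measurable_sets[OF this S]
  have S': "?S \<in> sets (FY UNIV \<Otimes>\<^sub>M (borel :: (int \<Rightarrow> 'g \<times> 'f) measure))"
    by (simp add: vimage_def space_pair_measure FY_eq_coord_field case_prod_beta')
  have sub: "subalgebra P (FY UNIV)" unfolding FY_eq_coord_field by (rule subalgebra_coord_field[OF P(2)])
  have "(\<integral>\<^sup>+\<omega>. emeasure (Py (Ypath \<omega>)) (Pair \<omega> -` ?S) \<partial>P) = emeasure P {\<omega> \<in> space P. (\<omega>, \<omega>) \<in> ?S}"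
    by (rule regular_cond_distr_disintegration[OF P(1) sub _ rcd S']) measurable
  then have disint: "(\<integral>\<^sup>+\<omega>. emeasure (Py (Ypath \<omega>)) {\<omega>'. zip_path (Zpath \<omega>') (Ypath \<omega>) \<in> S} \<partial>P) = emeasure P S"
    by (simp add: spP vimage_def)
  have slice: "{z. zip_path z y \<in> S} \<in> sets borel" for y
    using measurable_sets[OF measurable_compose[OF measurable_Pair2' measurable_zip_path] S, of y]
    by (simp add: vimage_def)
  have margin: "emeasure (distr (Py y) borel Zpath) {z. zip_path z y \<in> S} =
      emeasure (Py y) {\<omega>'. zip_path (Zpath \<omega>') y \<in> S}" for y
    using slice[of y] sets_eq_imp_space_eq[OF pr(2)[of y]] pr(2)[of y]
    by (subst emeasure_distr) (auto simp: vimage_def cong: measurable_cong_sets)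
  have mm: "(\<lambda>y. emeasure (Py y) {\<omega>'. zip_path (Zpath \<omega>') y \<in> S}) \<in> borel_measurable borel"
  proof (rule emeasure_measurable_subprob_algebra2[OF _ measurable_prob_algebraD[OF Pym]])
    have "(\<lambda>x. (Zpath (snd x), fst x)) \<in> (borel :: (int \<Rightarrow> 'f) measure) \<Otimes>\<^sub>M
        (borel :: (int \<Rightarrow> 'g \<times> 'f) measure) \<rightarrow>\<^sub>M borel \<Otimes>\<^sub>M borel"
      by measurable
    from measurable_compose[OF this measurable_zip_path]
    have "(\<lambda>x. zip_path (Zpath (snd x)) (fst x)) \<in> (borel :: (int \<Rightarrow> 'f) measure) \<Otimes>\<^sub>M
        (borel :: (int \<Rightarrow> 'g \<times> 'f) measure) \<rightarrow>\<^sub>M (borel :: (int \<Rightarrow> 'g \<times> 'f) measure)"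
      by simp
    from measurable_sets[OF this S]
    have "(\<lambda>x :: (int \<Rightarrow> 'f) \<times> (int \<Rightarrow> 'g \<times> 'f). zip_path (Zpath (snd x)) (fst x)) -` S \<inter> UNIV \<in>
        sets ((borel :: (int \<Rightarrow> 'f) measure) \<Otimes>\<^sub>M (borel :: (int \<Rightarrow> 'g \<times> 'f) measure))"
      by (simp add: space_pair_measure)
    moreover have "(\<lambda>x :: (int \<Rightarrow> 'f) \<times> (int \<Rightarrow> 'g \<times> 'f). zip_path (Zpath (snd x)) (fst x)) -` S \<inter> UNIV =
        (SIGMA y:space borel. {\<omega>' :: int \<Rightarrow> 'g \<times> 'f. zip_path (Zpath \<omega>') y \<in> S})"
      by auto
    ultimately show "(SIGMA y:space borel. {\<omega>' :: int \<Rightarrow> 'g \<times> 'f. zip_path (Zpath \<omega>') y \<in> S}) \<in> sets (borel \<Otimes>\<^sub>M borel)"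
      by (simp only:)
  qed
  have avg: "(\<integral>\<^sup>+y. emeasure (distr (Py y) borel Zpath) {z. zip_path z y \<in> S} \<partial>distr P borel Ypath) = emeasure P S"
    unfolding margin using mm by (subst nn_integral_distr) (auto simp: disint)
  have const: "(\<integral>\<^sup>+z'. (c :: ennreal) \<partial>distr (Py y) borel Zpath) = c" for c y
    using prob_space.emeasure_space_1[OF prZ[of y]] by simp
  have ind: "(\<integral>\<^sup>+z. indicator S (zip_path z y) \<partial>distr (Py y) borel Zpath) =
     emeasure (distr (Py y) borel Zpath) {z. zip_path z y \<in> S}" for y
  proof -
    have "(\<lambda>z. indicator S (zip_path z y)) = (indicator {z. zip_path z y \<in> S} :: _ \<Rightarrow> ennreal)"
      by (auto simp: indicator_def fun_eq_iff)
    then show ?thesis using slice[of y] by simp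
  qed
  have int1: "indicator {(z, z', y). zip_path z y \<in> S} (z, z', y) = (indicator S (zip_path z y) :: ennreal)"
    and int2: "indicator {(z, z', y). zip_path z' y \<in> S} (z, z', y) = (indicator S (zip_path z' y) :: ennreal)"
    for z z' y by (auto simp: indicator_def)
  show "emeasure (Q_measure P Py) {(z, z', y). zip_path z y \<in> S} = emeasure P S"
    unfolding emeasure_Q_measure[OF P(2) Pym 1] int1 const ind avg ..
  show "emeasure (Q_measure P Py) {(z, z', y). zip_path z' y \<in> S} = emeasure P S"
    unfolding emeasure_Q_measure[OF P(2) Pym 2] int2 ind const avg ..
qed

lemma AE_Q_measure:
  fixes P :: "(int \<Rightarrow> 'g::polish_space \<times> 'f::polish_space) measure"
  assumes P: "prob_space P" "sets P = sets borel" and Py: "version_Py P Py"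
    and ae: "AE \<omega> in P. \<Phi> \<omega>"
  shows "AE (z, z', y) in Q_measure P Py. \<Phi> (zip_path z y) \<and> \<Phi> (zip_path z' y)"
proof -
  have sQ: "sets (Q_measure P Py) = sets (borel \<Otimes>\<^sub>M (borel \<Otimes>\<^sub>M borel))"
    using Py by (intro sets_Q_measure) (simp add: version_Py_def)
  from ae obtain N where N: "{\<omega> \<in> space P. \<not> \<Phi> \<omega>} \<subseteq> N" "emeasure P N = 0" "N \<in> sets P" by (auto elim: AE_E)
  then have Nb: "N \<in> sets borel" using P(2) by simp
  note Q = Q_measure_marginals[OF P Py Nb]
  let ?N = "{(z, z', y). zip_path z y \<in> N} \<union> {(z, z', y). zip_path z' y \<in> N}"
  have "?N \<in> null_sets (Q_measure P Py)"
    using Q N(2) sQ by (intro null_sets.Un) (auto simp: null_sets_def)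
  moreover have "{q \<in> space (Q_measure P Py). \<not> (case q of (z, z', y) \<Rightarrow> \<Phi> (zip_path z y) \<and> \<Phi> (zip_path z' y))} \<subseteq> ?N"
    using N(1) sets_eq_imp_space_eq[OF P(2)] by auto
  ultimately show ?thesis by (rule AE_I')
qed

section \<open>Triviality of the tail\<close>

lemma AZ_subset: "A \<in> AZ \<Longrightarrow> A \<in> sets (FZ {int n..})"
  by (auto simp: AZ_def)

lemma AZ_subset_borel: "A \<in> AZ \<Longrightarrow> A \<in> sets borel"
  using AZ_subset[of A 0] coord_field_borel by (auto simp: FZ_eq_coord_field)

lemma AZ_Compl: "A \<in> AZ \<Longrightarrow> - A \<in> AZ"
  using sets.compl_sets[of A "FZ {int n..}" for n]
  by (auto simp: AZ_def FZ_eq_coord_field Compl_eq_Diff_UNIV)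

lemma regular_cond_distr_measurable:
  "regular_cond_distr P \<G> X N \<kappa> \<Longrightarrow> \<kappa> \<in> \<G> \<rightarrow>\<^sub>M prob_algebra N"
  by (simp add: regular_cond_distr_def)

text \<open>The fields of \<open>Z\<close> up to time \<open>k\<close> increase to the field of all of \<open>Z\<close>, so their union is an
algebra that generates it.\<close>

lemma approximation_by_past:
  fixes \<mu> \<nu> :: "(int \<Rightarrow> 'g::polish_space \<times> 'f::polish_space) measure"
  assumes \<mu>: "prob_space \<mu>" "sets \<mu> = sets borel" and \<nu>: "prob_space \<nu>" "sets \<nu> = sets borel"
    and A: "A \<in> sets (FZ UNIV)" and "\<epsilon> > 0"
  obtains k0 :: nat and B where "B \<in> sets (FZ {..int k0})"
    "measure \<mu> ((A - B) \<union> (B - A)) < \<epsilon>" "measure \<nu> ((A - B) \<union> (B - A)) < \<epsilon>"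
proof -
  let ?D = "\<Union>k::nat. sets (FZ {..int k} :: (int \<Rightarrow> 'g \<times> 'f) measure)"
  have mono: "sets (FZ {..int k} :: (int \<Rightarrow> 'g \<times> 'f) measure) \<subseteq> sets (FZ {..int l})" if "k \<le> l" for k l
    unfolding FZ_eq_coord_field using that by (intro coord_field_mono) auto
  have alg: "algebra UNIV ?D"
  proof (subst algebra_iff_Un, intro conjI ballI)
    fix a b assume "a \<in> ?D" "b \<in> ?D"
    then obtain k l where kl: "a \<in> sets (FZ {..int k})" "b \<in> sets (FZ {..int l})" by auto
    then show "UNIV - a \<in> ?D"
      using sets.compl_sets[OF kl(1)] by (auto simp: FZ_eq_coord_field)
    have "a \<in> sets (FZ {..int (max k l)})" "b \<in> sets (FZ {..int (max k l)})"
      using kl mono[of k "max k l"] mono[of l "max k l"] by auto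
    then show "a \<union> b \<in> ?D" by blast
  qed auto
  have "(\<lambda>x. x) \<in> sigma UNIV ?D \<rightarrow>\<^sub>M (coord_field UNIV {} :: (int \<Rightarrow> 'g \<times> 'f) measure)"
  proof (rule measurable_into_coord_field)
    fix k :: int
    have 1: "(\<lambda>x. Zpath x k) \<in> borel_measurable (coord_field {..int (nat k)} {} :: (int \<Rightarrow> 'g \<times> 'f) measure)"
      by (rule measurable_coord_field_Z) auto
    show "(\<lambda>x. Zpath x k) \<in> borel_measurable (sigma UNIV ?D)"
    proof (rule measurableI)
      fix U :: "'g set" assume "U \<in> sets borel"
      from measurable_sets[OF 1 this] have "(\<lambda>x. Zpath x k) -` U \<in> ?D"
        by (auto simp: FZ_eq_coord_field intro!: exI[of _ "nat k"])
      then show "(\<lambda>x. Zpath x k) -` U \<inter> space (sigma UNIV ?D) \<in> sets (sigma UNIV ?D)"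
        by (simp add: space_measure_of_conv sigma_sets.Basic del: UN_iff)
    qed simp
  qed auto
  then have "A \<in> sigma_sets UNIV ?D"
    using A measurable_sets[of "\<lambda>x. x" "sigma UNIV ?D" "coord_field UNIV {}" A]
    by (simp add: FZ_eq_coord_field space_measure_of_conv)
  moreover have "?D \<subseteq> sets borel" using coord_field_borel by (auto simp: FZ_eq_coord_field)
  ultimately obtain B where "B \<in> ?D"
    "measure \<mu> ((A - B) \<union> (B - A)) < \<epsilon>" "measure \<nu> ((A - B) \<union> (B - A)) < \<epsilon>"
    using approximation_by_algebra[OF prob_space.finite_measure[OF \<mu>(1)] prob_space.finite_measure[OF \<nu>(1)] alg, of A \<epsilon>]
      \<mu>(2) \<nu>(2) sets_eq_imp_space_eq[OF \<mu>(2)] sets_eq_imp_space_eq[OF \<nu>(2)] \<open>\<epsilon> > 0\<close> by auto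
  then show thesis using that by blast
qed

lemma half_le_summand:
  fixes a b :: ennreal
  assumes "1 \<le> a + b"
  shows "ennreal (1/2) \<le> a \<or> ennreal (1/2) \<le> b"
proof (cases "a = top \<or> b = top")
  case False
  then obtain r s where rs: "a = ennreal r" "b = ennreal s" "0 \<le> r" "0 \<le> s"
    by (metis ennreal_cases)
  with assms have "1 \<le> r + s"
    by (simp add: ennreal_plus[symmetric] ennreal_1[symmetric] del: ennreal_plus ennreal_1)
  then have "1/2 \<le> r \<or> 1/2 \<le> s" by linarith
  then show ?thesis unfolding rs(1,2) using ennreal_leI by blast
qed auto

lemma measure_symdiff_triangle:
  assumes "finite_measure M" "A \<in> sets M" "B \<in> sets M" "C \<in> sets M"
  shows "measure M ((A - C) \<union> (C - A)) \<le> measure M ((A - B) \<union> (B - A)) + measure M ((B - C) \<union> (C - B))"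
proof -
  interpret finite_measure M by fact
  have "measure M ((A - C) \<union> (C - A)) \<le> measure M (((A - B) \<union> (B - A)) \<union> ((B - C) \<union> (C - B)))"
    using assms by (intro finite_measure_mono) auto
  also have "\<dots> \<le> measure M ((A - B) \<union> (B - A)) + measure M ((B - C) \<union> (C - B))"
    using assms by (intro measure_Un_le) auto
  finally show ?thesis .
qed

text \<open>A tail event \<open>A\<close> is approximated by past events \<open>C\<close> and by remote future events \<open>D\<close>. If it
separates the two conditional laws, then for every large cut \<open>k\<close> the reference puts at least one half
on \<open>- D\<close> or on \<open>D\<close>, which places one of the two paths in the exceptional set of that cut. The
exceptional sets are uniformly small, hence so is the set of triples caught for all large \<open>k\<close>.\<close>

lemma separated_tail_small:
  fixes P :: "(int \<Rightarrow> 'g::polish_space \<times> 'f::polish_space) measure" and \<delta> \<eta> :: real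
  assumes st: "stationary_law P" and Py: "version_Py P Py"
    and K: "regular_cond_distr P (coord_field {..0} UNIV) (\<lambda>\<omega>. \<omega>) borel K"
    and reg: "absolutely_regular P" and nd: "nondegenerate P" and "\<delta> > 0" "\<eta> > 0"
  obtains L where "L \<in> sets (Q_measure P Py)" "emeasure (Q_measure P Py) L \<le> ennreal (2 * \<delta> / \<eta>)"
    "AE (z, z', y) in Q_measure P Py.
      (\<exists>A\<in>AZ. 4 * \<eta> < measure (K (zip_path z y)) A \<and> 4 * \<eta> < measure (K (zip_path z' y)) (- A)) \<longrightarrow> (z, z', y) \<in> L"
proof -
  have P: "prob_space P" "sets P = sets borel" using st by (auto simp: stationary_law_def)
  interpret P: prob_space P by fact
  have sQ: "sets (Q_measure P Py) = sets (borel \<Otimes>\<^sub>M (borel \<Otimes>\<^sub>M borel))"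
    using Py by (intro sets_Q_measure) (simp add: version_Py_def)
  have pr: "prob_space (K \<omega>)" "sets (K \<omega>) = sets borel" for \<omega>
    using measurable_space[OF regular_cond_distr_measurable[OF K], of \<omega>]
    by (simp_all add: space_prob_algebra)
  obtain n :: nat and \<epsilon>0 :: real where "\<epsilon>0 > 0" and small0: "future_controlled P n \<epsilon>0 \<delta>"
    by (rule future_controlled_if_regular_nondegenerate[OF P reg nd \<open>\<delta> > 0\<close>])
  define \<epsilon> where "\<epsilon> = min \<epsilon>0 \<eta>"
  have \<epsilon>: "\<epsilon> > 0" "\<epsilon> \<le> \<eta>" using \<open>\<epsilon>0 > 0\<close> \<open>\<eta> > 0\<close> by (auto simp: \<epsilon>_def)
  have "ennreal \<epsilon> \<le> ennreal \<epsilon>0" by (intro ennreal_leI) (simp add: \<epsilon>_def)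
  then have small: "future_controlled P n \<epsilon> \<delta>"
    using small0 order_trans unfolding future_controlled_def by blast
  obtain \<D> :: "(int \<Rightarrow> 'g \<times> 'f) set set" where \<D>: "countable \<D>" "algebra UNIV \<D>" "sigma_sets UNIV \<D> = sets (FZ {int n..})"
    by (rule countable_algebra_generating_FZ)
  have "\<exists>\<C> :: (int \<Rightarrow> 'g \<times> 'f) set set. countable \<C> \<and> algebra UNIV \<C> \<and> sigma_sets UNIV \<C> = sets (FZ {..int k})" for k
    by (rule countable_algebra_generating_FZ[of "{..int k}"]) blast
  then obtain \<C> :: "nat \<Rightarrow> (int \<Rightarrow> 'g \<times> 'f) set set" where \<C>: "\<And>k. countable (\<C> k)" "\<And>k. algebra UNIV (\<C> k)"
    "\<And>k. sigma_sets UNIV (\<C> k) = sets (FZ {..int k})" by metis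
  interpret \<D>: algebra UNIV \<D> by (rule \<D>(2))
  interpret \<C>: algebra UNIV "\<C> k" for k by (rule \<C>(2))
  have \<D>_FZ: "D \<in> sets (FZ {int n..})" if "D \<in> \<D>" for D
    using that \<D>(3) by (metis sigma_sets.Basic)
  have \<C>_FZ: "C \<in> sets (FZ {..int k})" if "C \<in> \<C> k" for C k
    using that \<C>(3) by (metis sigma_sets.Basic)
  have FZb: "S \<in> sets borel" if "S \<in> sets (FZ I)" for S :: "(int \<Rightarrow> 'g \<times> 'f) set" and I
    using that coord_field_borel by (auto simp: FZ_eq_coord_field)
  define p where "p k = from_nat_into (\<C> k \<times> \<D>)" for k
  have ne: "\<C> k \<times> \<D> \<noteq> {}" for k using \<C>.empty_sets \<D>.empty_sets by blast
  have p_in: "fst (p k i) \<in> \<C> k" "snd (p k i) \<in> \<D>" for k i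
    using from_nat_into[OF ne, of k i] by (auto simp: p_def mem_Times_iff)
  have p_surj: "\<exists>i. p k i = (C, D)" if "C \<in> \<C> k" "D \<in> \<D>" for k C D
    using from_nat_into_surj[of "\<C> k \<times> \<D>" "(C, D)"] that \<C>(1) \<D>(1) by (auto simp: p_def)
  \<comment> \<open>The threshold \<open>4 * \<eta>\<close> leaves room: \<open>C\<close> still has probability at least \<open>3 * \<eta>\<close>, and half of that,
    the reference contributing at least \<open>1 / 2\<close>, exceeds \<open>\<eta>\<close>.\<close>
  define W where "W k i = {\<omega>. emeasure (K \<omega>) (fst (p k i) \<inter> shift_path (int k) -` snd (p k i)) \<le> ennreal \<epsilon> \<and>
      ennreal \<eta> \<le> emeasure (K \<omega>) (fst (p k i)) * future_prob P n (snd (p k i)) (shift_path (int k) \<omega>)}" for k i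
  define Bad where "Bad k = (\<Union>i. W k i)" for k
  have Bad: "Bad k \<in> sets borel" "ennreal \<eta> * emeasure P (Bad k) \<le> ennreal \<delta>" for k
  proof -
    have m1: "fst (p k i) \<in> sets (coord_field {..int k} UNIV)" for i
      using \<C>_FZ[OF p_in(1)] coord_field_mono[of "{..int k}" "{..int k}" "{}" UNIV]
      by (auto simp: FZ_eq_coord_field)
    have m2: "snd (p k i) \<in> sets (FZ {int n..})" for i by (rule \<D>_FZ[OF p_in(2)])
    show "Bad k \<in> sets borel" "ennreal \<eta> * emeasure P (Bad k) \<le> ennreal \<delta>"
      unfolding Bad_def W_def
      using separation_small[OF st K small m1 m2, where \<eta> = \<eta>] by (simp_all only:)
  qed
  have PBad: "emeasure P (Bad k) \<le> ennreal (\<delta> / \<eta>)" for k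
    using Bad(2)[of k] \<open>\<eta> > 0\<close> \<open>\<delta> > 0\<close>
    by (simp add: P.emeasure_eq_measure ennreal_mult[symmetric] field_simps)
  let ?Q = "Q_measure P Py"
  define T where "T k = {(z, z', y). zip_path z y \<in> Bad k} \<union> {(z, z', y). zip_path z' y \<in> Bad k}" for k
  have T: "T k \<in> sets ?Q" "emeasure ?Q (T k) \<le> ennreal (2 * \<delta> / \<eta>)" for k
  proof -
    note Q = Q_measure_marginals[OF P Py Bad(1)[of k]]
    show "T k \<in> sets ?Q" unfolding T_def sQ using Q(3,4) by blast
    have "emeasure ?Q (T k) \<le> emeasure P (Bad k) + emeasure P (Bad k)"
      unfolding T_def using Q(3,4) sQ by (subst Q(1)[symmetric], subst Q(2)[symmetric], intro emeasure_subadditive) auto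
    also have "\<dots> \<le> ennreal (\<delta> / \<eta>) + ennreal (\<delta> / \<eta>)" by (intro add_mono PBad)
    also have "\<dots> = ennreal (2 * \<delta> / \<eta>)"
      using \<open>\<eta> > 0\<close> \<open>\<delta> > 0\<close> by (simp add: ennreal_plus[symmetric] del: ennreal_plus)
    finally show "emeasure ?Q (T k) \<le> ennreal (2 * \<delta> / \<eta>)" .
  qed
  define L where "L = (\<Union>m. \<Inter>k\<in>{m..}. T k)"
  show thesis
  proof (rule that[of L])
    have I: "(\<Inter>k\<in>{m..}. T k) \<in> sets ?Q" for m
      using T(1) by (intro sets.countable_INT') auto
    then show "L \<in> sets ?Q" unfolding L_def by auto
    have inc: "incseq (\<lambda>m. \<Inter>k\<in>{m..}. T k)" unfolding incseq_def by fastforce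
    have "emeasure ?Q L = (SUP m. emeasure ?Q (\<Inter>k\<in>{m..}. T k))"
      unfolding L_def using I inc by (subst SUP_emeasure_incseq) auto
    also have "\<dots> \<le> ennreal (2 * \<delta> / \<eta>)"
    proof (rule SUP_least)
      fix m
      have "emeasure ?Q (\<Inter>k\<in>{m..}. T k) \<le> emeasure ?Q (T m)"
        using T(1) by (intro emeasure_mono) auto
      also note T(2)
      finally show "emeasure ?Q (\<Inter>k\<in>{m..}. T k) \<le> ennreal (2 * \<delta> / \<eta>)" .
    qed
    finally show "emeasure ?Q L \<le> ennreal (2 * \<delta> / \<eta>)" .
    have "AE \<omega> in P. \<forall>D\<in>\<D>. \<forall>k. 1 \<le> future_prob P n D (shift_path (int k) \<omega>) + future_prob P n (- D) (shift_path (int k) \<omega>)"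
      using \<D>(1) future_prob_complement[OF st FZb[OF \<D>_FZ]]
      by (simp add: AE_ball_countable AE_all_countable)
    from AE_Q_measure[OF P Py this]
    show "AE (z, z', y) in ?Q. (\<exists>A\<in>AZ. 4 * \<eta> < measure (K (zip_path z y)) A \<and>
        4 * \<eta> < measure (K (zip_path z' y)) (- A)) \<longrightarrow> (z, z', y) \<in> L"
    proof (rule AE_mp, intro AE_I2, clarsimp)
      fix z z' y A
      assume compl: "\<forall>D\<in>\<D>. \<forall>k. 1 \<le> future_prob P n D (shift_path (int k) (zip_path z y)) + future_prob P n (- D) (shift_path (int k) (zip_path z y))"
      assume A: "A \<in> AZ" and A1: "4 * \<eta> < measure (K (zip_path z y)) A"
        and A2: "4 * \<eta> < measure (K (zip_path z' y)) (- A)"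
      define \<mu> \<nu> where "\<mu> = K (zip_path z y)" and "\<nu> = K (zip_path z' y)"
      interpret \<mu>: prob_space \<mu> unfolding \<mu>_def by (rule pr)
      interpret \<nu>: prob_space \<nu> unfolding \<nu>_def by (rule pr)
      have s: "sets \<mu> = sets borel" "sets \<nu> = sets borel" by (simp_all add: \<mu>_def \<nu>_def pr)
      note s[measurable_cong]
      have sp: "space \<mu> = UNIV" "space \<nu> = UNIV"
        using s[THEN sets_eq_imp_space_eq] by simp_all
      have Ab [measurable]: "A \<in> sets borel" by (rule AZ_subset_borel[OF A])
      have e4: "\<epsilon> / 4 > 0" using \<epsilon>(1) by simp
      have AU: "A \<in> sets (FZ UNIV)"
        using AZ_subset[OF A, of 0] coord_field_mono[of "{0..}" UNIV "{}" "{}"] by (auto simp: FZ_eq_coord_field)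
      obtain k0 :: nat and B where B: "B \<in> sets (FZ {..int k0})"
        "measure \<mu> ((A - B) \<union> (B - A)) < \<epsilon> / 4" "measure \<nu> ((A - B) \<union> (B - A)) < \<epsilon> / 4"
        by (rule approximation_by_past[OF \<mu>.prob_space_axioms s(1) \<nu>.prob_space_axioms s(2) AU e4])
      have "(z, z', y) \<in> T k" if "k0 \<le> k" for k
      proof -
        have Bk: "B \<in> sigma_sets UNIV (\<C> k)"
          using B(1) coord_field_mono[of "{..int k0}" "{..int k}" "{}" "{}"] that
          unfolding \<C>(3) by (auto simp: FZ_eq_coord_field)
        have Csub: "\<C> k \<subseteq> sets \<mu>" "\<C> k \<subseteq> sets \<nu>" and Dsub: "\<D> \<subseteq> sets borel"
          using FZb[OF \<C>_FZ] FZb[OF \<D>_FZ] s by auto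
        obtain C where C: "C \<in> \<C> k" "measure \<mu> ((B - C) \<union> (C - B)) < \<epsilon> / 4" "measure \<nu> ((B - C) \<union> (C - B)) < \<epsilon> / 4"
          using approximation_by_algebra[OF \<mu>.finite_measure_axioms \<nu>.finite_measure_axioms \<C>(2) Csub sp Bk e4] by blast
        have Bb [measurable]: "B \<in> sets borel" using FZb[OF B(1)] .
        have Cb [measurable]: "C \<in> sets borel" using FZb[OF \<C>_FZ[OF C(1)]] .
        have C': "measure \<mu> ((A - C) \<union> (C - A)) < \<epsilon> / 2" "measure \<nu> ((A - C) \<union> (C - A)) < \<epsilon> / 2"
          using measure_symdiff_triangle[OF \<mu>.finite_measure_axioms, of A B C] B(2) C(2)
            measure_symdiff_triangle[OF \<nu>.finite_measure_axioms, of A B C] B(3) C(3) by auto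
        let ?S = "shift_path (int k) :: (int \<Rightarrow> 'g \<times> 'f) \<Rightarrow> _"
        have "shift_path (- int k) -` A \<in> sets (FZ {int n..})"
          using shift_vimage_coord_field[OF AZ_subset[OF A, of "n + k", unfolded FZ_eq_coord_field], of "- int k" "{int n..}" "{}"]
          by (auto simp: FZ_eq_coord_field)
        then have A': "shift_path (- int k) -` A \<in> sigma_sets UNIV \<D>" unfolding \<D>(3) .
        have fin: "finite_measure (distr \<mu> borel ?S)" "finite_measure (distr \<nu> borel ?S)"
          by (rule \<mu>.finite_measure_distr \<nu>.finite_measure_distr, measurable)+
        obtain D where D: "D \<in> \<D>"
          "measure (distr \<mu> borel ?S) ((shift_path (- int k) -` A - D) \<union> (D - shift_path (- int k) -` A)) < \<epsilon> / 2"
          "measure (distr \<nu> borel ?S) ((shift_path (- int k) -` A - D) \<union> (D - shift_path (- int k) -` A)) < \<epsilon> / 2"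
          using approximation_by_algebra[OF fin \<D>(2) _ _ _ _ A', of "\<epsilon> / 2"] \<epsilon>(1) Dsub by auto
        have Db [measurable]: "D \<in> sets borel" using FZb[OF \<D>_FZ[OF D(1)]] .
        have Db' [measurable]: "?S -` D \<in> sets borel"
          using measurable_sets[OF measurable_shift Db] by simp
        have Am [measurable]: "shift_path (- int k) -` A \<in> sets borel"
          using measurable_sets[OF measurable_shift Ab] by simp
        have vim: "?S -` ((shift_path (- int k) -` A - D) \<union> (D - shift_path (- int k) -` A)) = (A - ?S -` D) \<union> (?S -` D - A)"
          by auto
        have D': "measure \<mu> ((A - ?S -` D) \<union> (?S -` D - A)) < \<epsilon> / 2" "measure \<nu> ((A - ?S -` D) \<union> (?S -` D - A)) < \<epsilon> / 2"
        proof -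
          have md: "measure (distr \<kappa> borel ?S) ((shift_path (- int k) -` A - D) \<union> (D - shift_path (- int k) -` A)) =
              measure \<kappa> ((A - ?S -` D) \<union> (?S -` D - A))"
            if "sets \<kappa> = sets borel" for \<kappa>
          proof -
            have "?S \<in> \<kappa> \<rightarrow>\<^sub>M borel" using that by (simp cong: measurable_cong_sets)
            then have "measure (distr \<kappa> borel ?S) ((shift_path (- int k) -` A - D) \<union> (D - shift_path (- int k) -` A)) =
                measure \<kappa> (?S -` ((shift_path (- int k) -` A - D) \<union> (D - shift_path (- int k) -` A)) \<inter> space \<kappa>)"
              by (rule measure_distr) measurable
            then show ?thesis unfolding vim using sets_eq_imp_space_eq[OF that] by simp
          qed
          show "measure \<mu> ((A - ?S -` D) \<union> (?S -` D - A)) < \<epsilon> / 2"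
            "measure \<nu> ((A - ?S -` D) \<union> (?S -` D - A)) < \<epsilon> / 2"
            using D(2,3) unfolding md[OF s(1)] md[OF s(2)] by auto
        qed
        define x where "x E = future_prob P n E (?S (zip_path z y))" for E
        have x_z': "x E = future_prob P n E (?S (zip_path z' y))" for E
          unfolding x_def
          by (rule coord_field_agree_fun[OF measurable_future_prob[unfolded FY_eq_coord_field]])
            (auto simp: path_shift)
        have "1 \<le> x D + x (- D)" using compl D(1) unfolding x_def by blast
        \<comment> \<open>The reference sees only the observations, so this alternative is common to both paths.\<close>
        then have cases: "ennreal (1/2) \<le> x (- D) \<or> ennreal (1/2) \<le> x D"
          using half_le_summand by blast
        have in_W: "zip_path w y \<in> Bad k"
          if \<kappa>: "K (zip_path w y) = \<kappa>" and CC: "C0 \<in> \<C> k" "D0 \<in> \<D>"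
            and m: "measure \<kappa> (C0 \<inter> ?S -` D0) < \<epsilon>" "3 * \<eta> \<le> measure \<kappa> C0"
            and xx: "ennreal (1/2) \<le> future_prob P n D0 (?S (zip_path w y))" for w \<kappa> C0 D0
        proof -
          interpret \<kappa>: prob_space \<kappa> unfolding \<kappa>[symmetric] by (rule pr)
          obtain i where i: "p k i = (C0, D0)" using p_surj[OF CC] by blast
          have "ennreal \<eta> \<le> ennreal (3 * \<eta>) * ennreal (1/2)"
            using \<open>\<eta> > 0\<close> by (subst ennreal_mult[symmetric]) (auto intro!: ennreal_leI)
          also have "\<dots> \<le> emeasure \<kappa> C0 * future_prob P n D0 (?S (zip_path w y))"
            using m(2) xx unfolding \<kappa>.emeasure_eq_measure by (intro mult_mono ennreal_leI) auto
          finally have "zip_path w y \<in> W k i"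
            using m(1) by (simp add: W_def i \<kappa> \<kappa>.emeasure_eq_measure ennreal_leI)
          then show ?thesis unfolding Bad_def by blast
        qed
        show ?thesis
        proof (rule disjE[OF cases])
          assume x: "ennreal (1/2) \<le> x (- D)"
          have "measure \<mu> (C \<inter> ?S -` (- D)) \<le> measure \<mu> (((A - C) \<union> (C - A)) \<union> ((A - ?S -` D) \<union> (?S -` D - A)))"
            by (intro \<mu>.finite_measure_mono) auto
          also have "\<dots> \<le> measure \<mu> ((A - C) \<union> (C - A)) + measure \<mu> ((A - ?S -` D) \<union> (?S -` D - A))"
            by (rule measure_Un_le) measurable
          finally have 1: "measure \<mu> (C \<inter> ?S -` (- D)) < \<epsilon>" using C'(1) D'(1) by simp
          have "measure \<mu> A \<le> measure \<mu> (C \<union> ((A - C) \<union> (C - A)))" by (intro \<mu>.finite_measure_mono) auto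
          also have "\<dots> \<le> measure \<mu> C + measure \<mu> ((A - C) \<union> (C - A))" by (rule measure_Un_le) measurable
          finally have "3 * \<eta> \<le> measure \<mu> C" using A1 C'(1) \<epsilon> by (simp add: \<mu>_def)
          then have "zip_path z y \<in> Bad k"
            using \<D>.compl_sets[OF D(1)] 1 x unfolding x_def
            by (intro in_W[OF _ C(1), of z \<mu> "- D"]) (auto simp: \<mu>_def Compl_eq_Diff_UNIV)
          then show ?thesis by (simp add: T_def)
        next
          assume x: "ennreal (1/2) \<le> x D"
          have "measure \<nu> (- C \<inter> ?S -` D) \<le> measure \<nu> (((A - C) \<union> (C - A)) \<union> ((A - ?S -` D) \<union> (?S -` D - A)))"
            by (intro \<nu>.finite_measure_mono) auto
          also have "\<dots> \<le> measure \<nu> ((A - C) \<union> (C - A)) + measure \<nu> ((A - ?S -` D) \<union> (?S -` D - A))"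
            by (rule measure_Un_le) measurable
          finally have 1: "measure \<nu> (- C \<inter> ?S -` D) < \<epsilon>" using C'(2) D'(2) by simp
          have nC: "- C \<in> sets borel" using Cb by auto
          have "measure \<nu> (- A) \<le> measure \<nu> (- C \<union> ((A - C) \<union> (C - A)))"
            using nC by (intro \<nu>.finite_measure_mono) (auto simp: s)
          also have "\<dots> \<le> measure \<nu> (- C) + measure \<nu> ((A - C) \<union> (C - A))"
            using nC by (intro measure_Un_le) (auto simp: s)
          finally have "3 * \<eta> \<le> measure \<nu> (- C)" using A2 C'(2) \<epsilon> by (simp add: \<nu>_def)
          then have "zip_path z' y \<in> Bad k"
            using \<C>.compl_sets[OF C(1)] 1 x unfolding x_z'
            by (intro in_W[OF _ _ D(1), of z' \<nu> "- C"]) (auto simp: \<nu>_def Compl_eq_Diff_UNIV)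
          then show ?thesis by (simp add: T_def)
        qed
      qed
      then show "(z, z', y) \<in> L" unfolding L_def by (auto intro!: exI[of _ k0])
    qed
  qed
qed

text \<open>Separation at level \<open>\<eta>\<close> is confined to sets of arbitrarily small measure, hence to a null set; then
\<open>\<eta>\<close> runs through a sequence tending to 0.\<close>

lemma tail_not_separated:
  fixes P :: "(int \<Rightarrow> 'g::polish_space \<times> 'f::polish_space) measure"
  assumes st: "stationary_law P" and Py: "version_Py P Py"
    and K: "regular_cond_distr P (coord_field {..0} UNIV) (\<lambda>\<omega>. \<omega>) borel K"
    and reg: "absolutely_regular P" and nd: "nondegenerate P"
  shows "AE (z, z', y) in Q_measure P Py. \<forall>A\<in>AZ.
     measure (K (zip_path z y)) A = 0 \<or> measure (K (zip_path z' y)) (- A) = 0"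
proof -
  let ?Q = "Q_measure P Py"
  define sep where "sep \<eta> = (\<lambda>(z, z', y). \<exists>A\<in>AZ. 4 * \<eta> < measure (K (zip_path z y)) A \<and>
    4 * \<eta> < measure (K (zip_path z' y)) (- A))" for \<eta> :: real
  have no_sep: "AE q in ?Q. \<not> sep \<eta> q" if \<eta>: "\<eta> > 0" for \<eta>
  proof -
    have "\<exists>L. L \<in> sets ?Q \<and> emeasure ?Q L \<le> ennreal (2 * (\<eta> / 2 / real (Suc j)) / \<eta>) \<and> (AE q in ?Q. sep \<eta> q \<longrightarrow> q \<in> L)" for j
    proof -
      have pos: "\<eta> / 2 / real (Suc j) > 0" using that by simp
      obtain L where L: "L \<in> sets ?Q" "emeasure ?Q L \<le> ennreal (2 * (\<eta> / 2 / real (Suc j)) / \<eta>)"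
        "AE (z, z', y) in ?Q. (\<exists>A\<in>AZ. 4 * \<eta> < measure (K (zip_path z y)) A \<and>
          4 * \<eta> < measure (K (zip_path z' y)) (- A)) \<longrightarrow> (z, z', y) \<in> L"
        by (rule separated_tail_small[OF assms pos \<eta>])
      from L(3) have "AE q in ?Q. sep \<eta> q \<longrightarrow> q \<in> L"
        by (rule eventually_mono) (auto simp: sep_def)
      with L(1,2) show ?thesis by blast
    qed
    then have "\<forall>j. \<exists>L. L \<in> sets ?Q \<and> emeasure ?Q L \<le> ennreal (2 * (\<eta> / 2 / real (Suc j)) / \<eta>) \<and>
        (AE q in ?Q. sep \<eta> q \<longrightarrow> q \<in> L)" by (rule allI)
    then obtain L where "\<forall>j. L j \<in> sets ?Q \<and> emeasure ?Q (L j) \<le> ennreal (2 * (\<eta> / 2 / real (Suc j)) / \<eta>) \<and>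
        (AE q in ?Q. sep \<eta> q \<longrightarrow> q \<in> L j)" by (rule choice[THEN exE])
    then have L: "\<And>j. L j \<in> sets ?Q" "\<And>j. emeasure ?Q (L j) \<le> ennreal (2 * (\<eta> / 2 / real (Suc j)) / \<eta>)"
      "\<And>j. AE q in ?Q. sep \<eta> q \<longrightarrow> q \<in> L j" by simp_all
    have "emeasure ?Q (\<Inter>j. L j) \<le> ennreal (1 / real (Suc j))" for j
    proof -
      have "emeasure ?Q (\<Inter>j. L j) \<le> emeasure ?Q (L j)" using L(1) by (intro emeasure_mono) auto
      also have "\<dots> \<le> ennreal (2 * (\<eta> / 2 / real (Suc j)) / \<eta>)" by (rule L(2))
      also have "2 * (\<eta> / 2 / real (Suc j)) / \<eta> = 1 / real (Suc j)" using \<eta> by (simp del: of_nat_Suc)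
      finally show ?thesis .
    qed
    moreover have "(\<lambda>j. ennreal (1 / real (Suc j))) \<longlonglongrightarrow> ennreal 0"
      by (intro tendsto_ennrealI) (rule LIMSEQ_Suc, rule lim_1_over_n)
    ultimately have "emeasure ?Q (\<Inter>j. L j) \<le> ennreal 0" by (intro LIMSEQ_le_const) auto
    then have "(\<Inter>j. L j) \<in> null_sets ?Q" using L(1) by (auto simp: null_sets_def)
    then have "AE q in ?Q. q \<notin> (\<Inter>j. L j)" by (rule AE_not_in)
    moreover have "AE q in ?Q. \<forall>j. sep \<eta> q \<longrightarrow> q \<in> L j" using L(3) by (simp only: AE_all_countable simp_thms)
    ultimately show ?thesis by eventually_elim blast
  qed
  have "AE q in ?Q. \<forall>j. \<not> sep (1 / real (Suc j)) q"
    unfolding AE_all_countable by (intro allI no_sep) simp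
  then show ?thesis
  proof (rule AE_mp, intro AE_I2, clarsimp)
    fix z z' y A
    assume ns: "\<forall>j. \<not> sep (1 / (1 + real j)) (z, z', y)" and A: "A \<in> AZ"
      and ne: "measure (K (zip_path z' y)) (- A) \<noteq> 0"
    show "measure (K (zip_path z y)) A = 0"
    proof (rule ccontr)
      assume ne': "measure (K (zip_path z y)) A \<noteq> 0"
      define m where "m = min (measure (K (zip_path z y)) A) (measure (K (zip_path z' y)) (- A))"
      have "m > 0" using ne ne' by (simp add: m_def zero_less_measure_iff)
      then obtain j where "inverse (real (Suc j)) < m / 4" using reals_Archimedean[of "m / 4"] by auto
      then have "sep (1 / (1 + real j)) (z, z', y)"
        using A by (auto simp: sep_def m_def inverse_eq_divide intro!: bexI[of _ A])
      with ns show False by blast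
    qed
  qed
qed

theorem theorem3p8:
  fixes P :: "(int \<Rightarrow> 'g::polish_space \<times> 'f::polish_space) measure"
    and Py :: "(int \<Rightarrow> 'f) \<Rightarrow> (int \<Rightarrow> 'g \<times> 'f) measure"
    and Pyz :: "(int \<Rightarrow> 'f) \<Rightarrow> (int \<Rightarrow> 'g) \<Rightarrow> (int \<Rightarrow> 'g \<times> 'f) measure"
  assumes "stationary_law P"
    and "version_Py P Py"
    and "version_Pyz P Pyz"
    and "absolutely_regular P"
    and "nondegenerate P"
  shows
    "(AE (z, z', y) in Q_measure P Py.
        (\<lambda>n::nat. tv_norm (sets (FZ {int n..})) (Pyz y (past z)) (Pyz y (past z'))) \<longlonglongrightarrow> 0) \<and>
     (AE (z, z', y) in Q_measure P Py.
        \<forall>A\<in>AZ. measure (Pyz y (past z)) A = (measure (Pyz y (past z)) A)\<^sup>2 \<and>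
                (measure (Pyz y (past z)) A)\<^sup>2 = measure (Pyz y (past z')) A) \<and>
     (AE (z, z', y) in Q_measure P Py.
        \<exists>n::nat. \<not> mutually_singular_on (sets (FZ {int n..})) (Pyz y (past z)) (Pyz y (past z')))"
proof -
  let ?Q = "Q_measure P Py"
  define K where "K \<omega> = Pyz (Ypath \<omega>) (past (Zpath \<omega>))" for \<omega>
  have K: "regular_cond_distr P (coord_field {..0} UNIV) (\<lambda>\<omega>. \<omega>) borel K"
    using assms(3) unfolding version_Pyz_def K_def FZ_eq_coord_field FY_eq_coord_field sigma_join_coord_field
    by simp
  have K_zip: "K (zip_path z y) = Pyz y (past z)" for z y by (simp add: K_def)
  have pr: "prob_space (Pyz y (past z))" "sets (Pyz y (past z)) = sets borel" for y z
    using measurable_space[OF regular_cond_distr_measurable[OF K], of "zip_path z y"]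
    by (simp_all add: K_zip space_prob_algebra)
  have sp: "space (Pyz y (past z)) = UNIV" for y z using sets_eq_imp_space_eq[OF pr(2)[of y z]] by simp
  have trivial: "AE (z, z', y) in ?Q. \<forall>A\<in>AZ.
     (measure (Pyz y (past z)) A = 0 \<or> measure (Pyz y (past z)) A = 1) \<and>
      measure (Pyz y (past z)) A = measure (Pyz y (past z')) A"
    using tail_not_separated[OF assms(1,2) K assms(4,5)]
  proof (rule AE_mp, intro AE_I2, clarify)
    fix z z' :: "int \<Rightarrow> 'g" and y :: "int \<Rightarrow> 'f" and A :: "(int \<Rightarrow> 'g \<times> 'f) set"
    assume sep: "\<forall>A\<in>AZ. measure (K (zip_path z y)) A = 0 \<or> measure (K (zip_path z' y)) (- A) = 0"
      and A: "A \<in> AZ"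
    have compl: "measure (Pyz y (past w)) (- A) = 1 - measure (Pyz y (past w)) A" for w
      using prob_space.prob_compl[OF pr(1), of A y w] AZ_subset_borel[OF A] pr(2)[of y w] sp[of y w]
      by (simp add: Compl_eq_Diff_UNIV)
    have "measure (Pyz y (past z)) A = 0 \<or> measure (Pyz y (past z')) A = 1"
      using sep[rule_format, OF A] compl[of z'] by (auto simp: K_zip)
    moreover have "measure (Pyz y (past z)) A = 1 \<or> measure (Pyz y (past z')) A = 0"
      using sep[rule_format, OF AZ_Compl[OF A]] compl[of z] by (auto simp: K_zip)
    ultimately show "(measure (Pyz y (past z)) A = 0 \<or> measure (Pyz y (past z)) A = 1) \<and>
      measure (Pyz y (past z)) A = measure (Pyz y (past z')) A" by auto
  qed
  have forget: "AE (z, z', y) in ?Q.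
      (\<lambda>n::nat. tv_norm (sets (FZ {int n..})) (Pyz y (past z)) (Pyz y (past z'))) \<longlonglongrightarrow> 0"
    using trivial
  proof (rule AE_mp, intro AE_I2, clarify)
    fix z z' y
    assume triv: "\<forall>A\<in>AZ. (measure (Pyz y (past z)) A = 0 \<or> measure (Pyz y (past z)) A = 1) \<and>
      measure (Pyz y (past z)) A = measure (Pyz y (past z')) A"
    have "(\<lambda>n. SUP A\<in>sets (FZ {int n..}). \<bar>measure (Pyz y (past z)) A - measure (Pyz y (past z')) A\<bar>) \<longlonglongrightarrow> 0"
    proof (rule tail_agreement_imp_total_variation_vanishes[OF pr(1) pr(1)])
      show "sigma_algebra (space (Pyz y (past z))) (sets (FZ {int n..}))" for n
        using sets.sigma_algebra_axioms[of "FZ {int n..}"] by (simp add: sp FZ_eq_coord_field)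
      show "sets (FZ {int (Suc n)..}) \<subseteq> sets (FZ {int n..} :: (int \<Rightarrow> 'g \<times> 'f) measure)" for n
        unfolding FZ_eq_coord_field by (rule coord_field_mono) auto
      show "measure (Pyz y (past z)) A = measure (Pyz y (past z')) A" if "\<And>n. A \<in> sets (FZ {int n..})" for A
        using triv that by (auto simp: AZ_def)
    qed (simp_all add: sp pr FZ_eq_coord_field coord_field_borel)
    from tendsto_mult[OF tendsto_const[of 2] this]
    show "(\<lambda>n::nat. tv_norm (sets (FZ {int n..})) (Pyz y (past z)) (Pyz y (past z'))) \<longlonglongrightarrow> 0"
      unfolding tv_norm_def by simp
  qed
  moreover have "AE (z, z', y) in ?Q.
        \<forall>A\<in>AZ. measure (Pyz y (past z)) A = (measure (Pyz y (past z)) A)\<^sup>2 \<and>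
                (measure (Pyz y (past z)) A)\<^sup>2 = measure (Pyz y (past z')) A"
    using trivial
  proof (rule AE_mp, intro AE_I2, clarify)
    fix z z' :: "int \<Rightarrow> 'g" and y :: "int \<Rightarrow> 'f" and A :: "(int \<Rightarrow> 'g \<times> 'f) set"
    assume triv: "\<forall>A\<in>AZ. (measure (Pyz y (past z)) A = 0 \<or> measure (Pyz y (past z)) A = 1) \<and>
      measure (Pyz y (past z)) A = measure (Pyz y (past z')) A" and A: "A \<in> AZ"
    from triv[rule_format, OF A]
    show "measure (Pyz y (past z)) A = (measure (Pyz y (past z)) A)\<^sup>2 \<and>
        (measure (Pyz y (past z)) A)\<^sup>2 = measure (Pyz y (past z')) A"
      by (metis one_power2 zero_power2)
  qed
  moreover have "AE (z, z', y) in ?Q.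
      \<exists>n::nat. \<not> mutually_singular_on (sets (FZ {int n..})) (Pyz y (past z)) (Pyz y (past z'))"
    using forget
  proof (rule AE_mp, intro AE_I2, clarify)
    fix z z' y
    let ?\<mu> = "Pyz y (past z)" and ?\<nu> = "Pyz y (past z')"
    assume lim: "(\<lambda>n::nat. tv_norm (sets (FZ {int n..})) ?\<mu> ?\<nu>) \<longlonglongrightarrow> 0"
    interpret \<mu>: prob_space ?\<mu> by (rule pr)
    interpret \<nu>: prob_space ?\<nu> by (rule pr)
    from order_tendstoD(2)[OF lim, of 2] obtain n :: nat where n: "tv_norm (sets (FZ {int n..})) ?\<mu> ?\<nu> < 2"
      by (auto simp: eventually_sequentially)
    show "\<exists>n::nat. \<not> mutually_singular_on (sets (FZ {int n..})) ?\<mu> ?\<nu>"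
    proof (intro exI notI)
      assume "mutually_singular_on (sets (FZ {int n..})) ?\<mu> ?\<nu>"
      then obtain A where A: "A \<in> sets (FZ {int n..})" "emeasure ?\<mu> A = 0" "emeasure ?\<nu> (space ?\<nu> - A) = 0"
        by (auto simp: mutually_singular_on_def)
      have Ab: "A \<in> sets ?\<nu>" using A(1) coord_field_borel by (auto simp: pr FZ_eq_coord_field)
      have "measure ?\<mu> A = 0" using A(2) by (simp add: measure_def)
      moreover have "measure ?\<nu> A = 1" using A(3) \<nu>.prob_compl[OF Ab] by (simp add: measure_def)
      ultimately have one: "\<bar>measure ?\<mu> A - measure ?\<nu> A\<bar> = 1" by simp
      have "bdd_above ((\<lambda>A. \<bar>measure ?\<mu> A - measure ?\<nu> A\<bar>) ` sets (FZ {int n..}))"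
      proof (rule bdd_aboveI2)
        fix A show "\<bar>measure ?\<mu> A - measure ?\<nu> A\<bar> \<le> 1"
          using \<mu>.prob_le_1[of A] \<nu>.prob_le_1[of A] measure_nonneg[of ?\<mu> A] measure_nonneg[of ?\<nu> A] by linarith
      qed
      from cSUP_upper[OF A(1) this] one
      show False using n unfolding tv_norm_def by simp
    qed
  qed
  ultimately show ?thesis by (intro conjI)
qed

end
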